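(* Let $H$ be a cocommutative Hopf algebra over a field $\mathbf{k}$. The collection of Lie-$2$ $H$-pseudoalgebras and morphisms between them form a category (denoted $\mathbf{Lie2}H$).
   Context: Polylinear maps. $H^{\otimes n}$ is a right $H$-module via $(h_1\otimes\cdots\otimes h_n)h=h_1h_{(1)}\otimes\cdots\otimes h_nh_{(n)}$. Polylinear maps of left $H$-modules are $H^{\otimes n}$-linear maps $L_1\otimes\cdots\otimes L_n\to H^{\otimes n}\otimes_HM$ ($H^{\otimes n}$ acts factorwise on the source, by left multiplication on the target). Composition: if $\psi(y_1,\dots,y_l)=\sum_i(h_i^1\otimes\cdots\otimes h_i^l)\otimes_He_i$ and $\varphi(x_1,\dots,x_{m-1},e_i,x_{m+1},\dots,x_k)=\sum_j(f^1_{ij}\otimes\cdots\otimes f^k_{ij})\otimes_He_{ij}$, then $\varphi(x_1,\dots,x_{m-1},\psi(y_1,\dots,y_l),x_{m+1},\dots,x_k)=\sum_{i,j}(f^1_{ij}\otimes\cdots\otimes f^{m-1}_{ij}\otimes h_i^1f^m_{ij(1)}\otimes\cdots\otimes h^l_if^m_{ij(l)}\otimes f^{m+1}_{ij}\otimes\cdots\otimes f^k_{ij})\otimes_He_{ij}$. Slot convention: each factor of $H^{\otimes N}$ is attached to one argument; in identities (and for sources/targets of arrows) whose terms involve the same elements in different orders, the $H$-factors are permuted so that they appear in one fixed order of the elements (well defined by cocommutativity). Skew-symmetric means: under this convention, exchanging two arguments changes the sign. A left-$2$ module over $H$ is a category $C=(C_1\rightrightarrows C_0)$ internal to left $H$-modules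 (objects $C_0$ and arrows $C_1$ are left $H$-modules; source $s$, target $t$, identity map $x\mapsto1_x$ and composition are $H$-linear). Morphisms are internal functors $F=(F_0,F_1)$. $H^{\otimes n}\otimes_HC$ denotes the internal category with objects $H^{\otimes n}\otimes_HC_0$ and arrows $H^{\otimes n}\otimes_HC_1$. A Lie-$2$ $H$-pseudoalgebra $(C,[\cdot*\cdot],\mathcal{J})$: a left-$2$ module $C$ over $H$; an $H^{\otimes2}$-linear skew-symmetric functor $[\cdot*\cdot]:C\otimes C\to H^{\otimes2}\otimes_HC$; and an $H^{\otimes3}$-linear skew-symmetric natural isomorphism $\mathcal{J}_{x,y,z}:[[x*y]*z]\to[x*[y*z]]-[y*[x*z]]$ in $H^{\otimes3}\otimes_HC$ (skew-symmetry refers to its arrow part $\mathcal{J}_{x,y,z}-1_{[[x*y]*z]}$), such that for all $x,y,z,w\in C_0$ the following two composites $[[[x*y]*z]*w]\to[x*[y*[z*w]]]-[y*[x*[z*w]]]-[z*[x*[y*w]]]+[z*[y*[x*w]]]$ are equal (an object inside a bracket with an arrow means its identity arrow, and $1$ means the identity arrow of the corresponding summand): first $[\mathcal{J}_{x,y,z}*w]$, then $\mathcal{J}_{x,[y*z],w}-\mathcal{J}_{y,[x*z],w}$, then $[x*\mathcal{J}_{y,z,w}]-\mathcal{J}_{y,z,[x*w]}-[y*\mathcal{J}_{x,z,w}]+\mathcal{J}_{x,z,[y*w]}$; and first $\mathcal{J}_{[x*y],z,w}$, then $1-[z*\mathcal{J}_{x,y,w}]$, then $\mathcal{J}_{x,y,[z*w]}-1+1$.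 A morphism $(F_0,F_1,F_2):(C,[\cdot*\cdot],\mathcal{J})\to(C',[\cdot*\cdot]',\mathcal{J}')$: a morphism $(F_0,F_1)$ of left-$2$ modules and a natural isomorphism $(F_2)^{x,y}:[F_0(x)*F_0(y)]'\to(\mathrm{id}_{H^{\otimes2}}\otimes_HF_0)[x*y]$ such that for all $x,y,z\in C_0$ $$\big((F_2)^{x,[y*z]}-(F_2)^{y,[x*z]}\big)\circ\big([F_0(x)*(F_2)^{y,z}]'-[F_0(y)*(F_2)^{x,z}]'\big)\circ\mathcal{J}'_{F_0(x),F_0(y),F_0(z)}$$ $$=(\mathrm{id}_{H^{\otimes3}}\otimes_HF_1)(\mathcal{J}_{x,y,z})\circ(F_2)^{[x*y],z}\circ[(F_2)^{x,y}*F_0(z)]',$$ where expressions such as $(F_2)^{[x*y],z}$ are formed by the composition rule above. Composition and identities in this category: the composite of $(F_0,F_1,F_2):C\to C'$ followed by $(G_0,G_1,G_2):C'\to C''$ is $(G_0\circ F_0,\ G_1\circ F_1,\ (GF)_2)$ with $(GF)_2^{x,y}=(\mathrm{id}_{H^{\otimes2}}\otimes_HG_1)\big((F_2)^{x,y}\big)\circ(G_2)^{F_0(x),F_0(y)}$, and the identity morphism of $C$ is $(\mathrm{id}_{C_0},\mathrm{id}_{C_1},\mathrm{id})$ with last component the identity arrow of $[x*y]$. *)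

theory Defs
  imports Complex_Main "HOL-Algebra.Free_Abelian_Groups" "HOL-Library.FuncSet"
begin

section \<open>Abelian groups by generators and relations\<close>

text \<open>Abelian groups are \<^const>\<open>comm_group\<close>s of HOL-Algebra; the group operation is written
  additively below.\<close>

abbreviation gadd :: "('a, 'b) monoid_scheme \<Rightarrow> 'a \<Rightarrow> 'a \<Rightarrow> 'a" (infixl "\<boxplus>\<index>" 65)
  where "x \<boxplus>\<^bsub>G\<^esub> y \<equiv> x \<otimes>\<^bsub>G\<^esub> y"

abbreviation gsub :: "('a, 'b) monoid_scheme \<Rightarrow> 'a \<Rightarrow> 'a \<Rightarrow> 'a" (infixl "\<boxminus>\<index>" 65)
  where "x \<boxminus>\<^bsub>G\<^esub> y \<equiv> x \<otimes>\<^bsub>G\<^esub> inv\<^bsub>G\<^esub> y"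

abbreviation gneg :: "('a, 'b) monoid_scheme \<Rightarrow> 'a \<Rightarrow> 'a" ("\<boxminus>\<index> _" [81] 80)
  where "\<boxminus>\<^bsub>G\<^esub> y \<equiv> inv\<^bsub>G\<^esub> y"

definition relators :: "'g set \<Rightarrow> ('g \<Rightarrow>\<^sub>0 int) set \<Rightarrow> ('g \<Rightarrow>\<^sub>0 int) set" where
  "relators X R = generate (free_Abelian_group X) R"

definition presented :: "'g set \<Rightarrow> ('g \<Rightarrow>\<^sub>0 int) set \<Rightarrow> ('g \<Rightarrow>\<^sub>0 int) set monoid" where
  "presented X R = free_Abelian_group X Mod relators X R"

definition gen_class :: "'g set \<Rightarrow> ('g \<Rightarrow>\<^sub>0 int) set \<Rightarrow> 'g \<Rightarrow> ('g \<Rightarrow>\<^sub>0 int) set" where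
  "gen_class X R g = relators X R #>\<^bsub>free_Abelian_group X\<^esub> frag_of g"

text \<open>The homomorphism out of a presented group that extends a map \<open>f\<close> on generators.  It is
  evaluated on an arbitrary representative, which is harmless when \<open>f\<close> respects the relations.\<close>

definition lift :: "('b, 'c) monoid_scheme \<Rightarrow> ('g \<Rightarrow> 'b) \<Rightarrow> ('g \<Rightarrow>\<^sub>0 int) set \<Rightarrow> 'b" where
  "lift G f A = (let p = (SOME p. p \<in> A) in
     finprod G (\<lambda>g. f g [^]\<^bsub>G\<^esub> Poly_Mapping.lookup p g) (Poly_Mapping.keys p))"

definition type_group :: "'a::ab_group_add monoid" where
  "type_group = \<lparr>carrier = UNIV, monoid.mult = (+), one = 0\<rparr>"


section \<open>Cocommutative Hopf algebras\<close>

type_synonym 'h tpow = "('h list \<Rightarrow>\<^sub>0 int) set"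

record ('k, 'h) hopf =
  scale :: "'k \<Rightarrow> 'h \<Rightarrow> 'h"
  comul :: "'h \<Rightarrow> 'h tpow"
  counit :: "'h \<Rightarrow> 'k"
  antipode :: "'h \<Rightarrow> 'h"

text \<open>The tensor power of \<open>n\<close> copies of \<open>H\<close> over the field, for \<open>n \<ge> 1\<close>: generated by the lists
  \<open>[h\<^sub>1, \<dots>, h\<^sub>n]\<close>, standing for the pure tensors, subject to additivity in each factor
  and to scalars moving freely between the factors.\<close>

definition tpow_gens :: "nat \<Rightarrow> 'h list set" where
  "tpow_gens n = {hs. length hs = n}"

definition tpow_rels :: "('k::field, 'h::ring_1) hopf \<Rightarrow> nat \<Rightarrow> ('h list \<Rightarrow>\<^sub>0 int) set" where
  "tpow_rels H n =
     {frag_of (hs[i := a + b]) - frag_of (hs[i := a]) - frag_of (hs[i := b])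
        | hs i a b. length hs = n \<and> i < n}
   \<union> {frag_of (hs[i := scale H c (hs ! i)]) - frag_of (hs[j := scale H c (hs ! j)])
        | hs i j c. length hs = n \<and> i < n \<and> j < n}"

definition tpow :: "('k::field, 'h::ring_1) hopf \<Rightarrow> nat \<Rightarrow> 'h tpow monoid" where
  "tpow H n = presented (tpow_gens n) (tpow_rels H n)"

definition ptens :: "('k::field, 'h::ring_1) hopf \<Rightarrow> 'h list \<Rightarrow> 'h tpow" where
  "ptens H hs = gen_class (tpow_gens (length hs)) (tpow_rels H (length hs)) hs"

definition tpow_scale :: "('k::field, 'h::ring_1) hopf \<Rightarrow> nat \<Rightarrow> 'k \<Rightarrow> 'h tpow \<Rightarrow> 'h tpow" where
  "tpow_scale H n c S = lift (tpow H n) (\<lambda>hs. ptens H (hs[0 := scale H c (hs ! 0)])) S"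

definition tpow_mult :: "('k::field, 'h::ring_1) hopf \<Rightarrow> nat \<Rightarrow> 'h tpow \<Rightarrow> 'h tpow \<Rightarrow> 'h tpow" where
  "tpow_mult H n S T =
     lift (tpow H n) (\<lambda>hs. lift (tpow H n) (\<lambda>gs. ptens H (map2 (*) hs gs)) T) S"

text \<open>\<open>perm_tpow H is\<close> puts the factor with index \<open>is ! a\<close> into position \<open>a\<close>.\<close>

definition perm_tpow :: "('k::field, 'h::ring_1) hopf \<Rightarrow> nat list \<Rightarrow> 'h tpow \<Rightarrow> 'h tpow" where
  "perm_tpow H is S = lift (tpow H (length is)) (\<lambda>hs. ptens H (map (\<lambda>i. hs ! i) is)) S"

text \<open>\<open>comul_at H n i\<close> applies the comultiplication to the \<open>i\<close>-th of \<open>n\<close> factors (counting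
  from \<open>0\<close>), and \<open>iter_comul H r\<close> is the iterated comultiplication with \<open>r + 1\<close> factors.\<close>

definition comul_at :: "('k::field, 'h::ring_1) hopf \<Rightarrow> nat \<Rightarrow> nat \<Rightarrow> 'h tpow \<Rightarrow> 'h tpow" where
  "comul_at H n i S = lift (tpow H (Suc n))
     (\<lambda>hs. lift (tpow H (Suc n)) (\<lambda>us. ptens H (take i hs @ us @ drop (Suc i) hs))
        (comul H (hs ! i))) S"

primrec iter_comul :: "('k::field, 'h::ring_1) hopf \<Rightarrow> nat \<Rightarrow> 'h \<Rightarrow> 'h tpow" where
  "iter_comul H 0 h = ptens H [h]"
| "iter_comul H (Suc r) h = comul_at H (Suc r) 0 (iter_comul H r h)"

definition algebra_over_field :: "('k::field, 'h::ring_1) hopf \<Rightarrow> bool" where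
  "algebra_over_field H \<longleftrightarrow> vector_space (scale H) \<and>
     (\<forall>c x y. scale H c (x * y) = scale H c x * y \<and> scale H c (x * y) = x * scale H c y)"

definition coalgebra_over_field :: "('k::field, 'h::ring_1) hopf \<Rightarrow> bool" where
  "coalgebra_over_field H \<longleftrightarrow>
     (\<forall>h. comul H h \<in> carrier (tpow H 2)) \<and>
     (\<forall>g h. comul H (g + h) = comul H g \<boxplus>\<^bsub>tpow H 2\<^esub> comul H h) \<and>
     (\<forall>c h. comul H (scale H c h) = tpow_scale H 2 c (comul H h)) \<and>
     Vector_Spaces.linear (scale H) (*) (counit H) \<and>
     (\<forall>h. comul_at H 2 0 (comul H h) = comul_at H 2 1 (comul H h)) \<and>
     (\<forall>h. lift type_group (\<lambda>us. scale H (counit H (us ! 0)) (us ! 1)) (comul H h) = h) \<and>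
     (\<forall>h. lift type_group (\<lambda>us. scale H (counit H (us ! 1)) (us ! 0)) (comul H h) = h)"

definition bialgebra_over_field :: "('k::field, 'h::ring_1) hopf \<Rightarrow> bool" where
  "bialgebra_over_field H \<longleftrightarrow> algebra_over_field H \<and> coalgebra_over_field H \<and>
     (\<forall>g h. comul H (g * h) = tpow_mult H 2 (comul H g) (comul H h)) \<and>
     comul H 1 = ptens H [1, 1] \<and>
     (\<forall>g h. counit H (g * h) = counit H g * counit H h) \<and>
     counit H 1 = 1"

definition hopf_algebra :: "('k::field, 'h::ring_1) hopf \<Rightarrow> bool" where
  "hopf_algebra H \<longleftrightarrow> bialgebra_over_field H \<and>
     Vector_Spaces.linear (scale H) (scale H) (antipode H) \<and>
     (\<forall>h. lift type_group (\<lambda>us. antipode H (us ! 0) * us ! 1) (comul H h)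
          = scale H (counit H h) 1) \<and>
     (\<forall>h. lift type_group (\<lambda>us. us ! 0 * antipode H (us ! 1)) (comul H h)
          = scale H (counit H h) 1)"

definition cocommutative_hopf_algebra :: "('k::field, 'h::ring_1) hopf \<Rightarrow> bool" where
  "cocommutative_hopf_algebra H \<longleftrightarrow> hopf_algebra H \<and>
     (\<forall>h. perm_tpow H [1, 0] (comul H h) = comul H h)"


section \<open>Left modules\<close>

record ('r, 'm) lmod = "'m monoid" +
  act :: "'r \<Rightarrow> 'm \<Rightarrow> 'm"

definition left_module :: "('h::ring_1, 'm) lmod \<Rightarrow> bool" where
  "left_module M \<longleftrightarrow> comm_group M \<and>
     (\<forall>h. \<forall>x \<in> carrier M. act M h x \<in> carrier M) \<and>
     (\<forall>h. \<forall>x \<in> carrier M. \<forall>y \<in> carrier M.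
        act M h (x \<boxplus>\<^bsub>M\<^esub> y) = act M h x \<boxplus>\<^bsub>M\<^esub> act M h y) \<and>
     (\<forall>g h. \<forall>x \<in> carrier M. act M (g + h) x = act M g x \<boxplus>\<^bsub>M\<^esub> act M h x) \<and>
     (\<forall>g h. \<forall>x \<in> carrier M. act M (g * h) x = act M g (act M h x)) \<and>
     (\<forall>x \<in> carrier M. act M 1 x = x)"

definition left_hom :: "('r, 'm) lmod \<Rightarrow> ('r, 'n) lmod \<Rightarrow> ('m \<Rightarrow> 'n) \<Rightarrow> bool" where
  "left_hom M N f \<longleftrightarrow> f \<in> hom M N \<and>
     (\<forall>h. \<forall>x \<in> carrier M. f (act M h x) = act N h (f x))"


section \<open>The modules obtained by tensoring over the Hopf algebra\<close>

text \<open>The right action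
  \<open>(h\<^sub>1 \<otimes> \<dots> \<otimes> h\<^sub>n) h = h\<^sub>1 h\<^sub>(\<^sub>1\<^sub>) \<otimes> \<dots> \<otimes> h\<^sub>n h\<^sub>(\<^sub>n\<^sub>)\<close>.\<close>

definition tpow_ract :: "('k::field, 'h::ring_1) hopf \<Rightarrow> nat \<Rightarrow> 'h tpow \<Rightarrow> 'h \<Rightarrow> 'h tpow" where
  "tpow_ract H n S h = tpow_mult H n S (iter_comul H (n - 1) h)"

type_synonym ('h, 'm) tens = "(('h tpow \<times> 'm) \<Rightarrow>\<^sub>0 int) set"

definition tens_gens :: "('k::field, 'h::ring_1) hopf \<Rightarrow> nat \<Rightarrow> ('h, 'm) lmod \<Rightarrow> ('h tpow \<times> 'm) set"
  where "tens_gens H n M = carrier (tpow H n) \<times> carrier M"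

definition tens_rels ::
  "('k::field, 'h::ring_1) hopf \<Rightarrow> nat \<Rightarrow> ('h, 'm) lmod \<Rightarrow> (('h tpow \<times> 'm) \<Rightarrow>\<^sub>0 int) set" where
  "tens_rels H n M =
     {frag_of (S \<boxplus>\<^bsub>tpow H n\<^esub> T, x) - frag_of (S, x) - frag_of (T, x)
        | S T x. S \<in> carrier (tpow H n) \<and> T \<in> carrier (tpow H n) \<and> x \<in> carrier M}
   \<union> {frag_of (S, x \<boxplus>\<^bsub>M\<^esub> y) - frag_of (S, x) - frag_of (S, y)
        | S x y. S \<in> carrier (tpow H n) \<and> x \<in> carrier M \<and> y \<in> carrier M}
   \<union> {frag_of (tpow_ract H n S h, x) - frag_of (S, act M h x)
        | S h x. S \<in> carrier (tpow H n) \<and> x \<in> carrier M}"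

definition tens_elt ::
  "('k::field, 'h::ring_1) hopf \<Rightarrow> nat \<Rightarrow> ('h, 'm) lmod \<Rightarrow> 'h tpow \<Rightarrow> 'm \<Rightarrow> ('h, 'm) tens" where
  "tens_elt H n M S x = gen_class (tens_gens H n M) (tens_rels H n M) (S, x)"

definition tens_group ::
  "('k::field, 'h::ring_1) hopf \<Rightarrow> nat \<Rightarrow> ('h, 'm) lmod \<Rightarrow> ('h, 'm) tens monoid" where
  "tens_group H n M = presented (tens_gens H n M) (tens_rels H n M)"

text \<open>The tensor product of the \<open>n\<close>-th tensor power of \<open>H\<close> with \<open>M\<close> over \<open>H\<close>, on which the
  tensor power acts by left multiplication.\<close>

definition tens ::
  "('k::field, 'h::ring_1) hopf \<Rightarrow> nat \<Rightarrow> ('h, 'm) lmod \<Rightarrow> ('h tpow, ('h, 'm) tens) lmod" where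
  "tens H n M = \<lparr>carrier = carrier (tens_group H n M),
     monoid.mult = monoid.mult (tens_group H n M),
     one = one (tens_group H n M),
     act = (\<lambda>S. lift (tens_group H n M) (\<lambda>(T, x). tens_elt H n M (tpow_mult H n S T) x))\<rparr>"

text \<open>\<open>tens_map H n N f\<close> is the identity of the tensor power tensored with \<open>f\<close>, where \<open>N\<close> is
  the target module of \<open>f\<close>.\<close>

definition tens_map ::
  "('k::field, 'h::ring_1) hopf \<Rightarrow> nat \<Rightarrow> ('h, 'n) lmod \<Rightarrow> ('m \<Rightarrow> 'n) \<Rightarrow> ('h, 'm) tens \<Rightarrow> ('h, 'n) tens"
  where "tens_map H n N f = lift (tens H n N) (\<lambda>(S, x). tens_elt H n N S (f x))"

definition perm_tens ::
  "('k::field, 'h::ring_1) hopf \<Rightarrow> ('h, 'm) lmod \<Rightarrow> nat list \<Rightarrow> ('h, 'm) tens \<Rightarrow> ('h, 'm) tens" where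
  "perm_tens H M is =
     lift (tens H (length is) M) (\<lambda>(S, x). tens_elt H (length is) M (perm_tpow H is S) x)"


section \<open>Polylinear maps and their composition\<close>

text \<open>A polylinear map of \<open>n\<close> arguments from \<open>L\<close>, i.e. a linear map out of the \<open>n\<close>-fold tensor
  product of \<open>L\<close> over the field, is given by its values on lists of \<open>n\<close> arguments.  Homogeneity
  over the field is contained in the last clause, for \<open>hs\<close> with entries in the image of the field.\<close>

definition polylinear ::
  "('k::field, 'h::ring_1) hopf \<Rightarrow> nat \<Rightarrow> ('h, 'l) lmod \<Rightarrow> ('h, 'm) lmod \<Rightarrow>
   ('l list \<Rightarrow> ('h, 'm) tens) \<Rightarrow> bool" where
  "polylinear H n L M \<phi> \<longleftrightarrow>
     (\<forall>xs. length xs = n \<and> set xs \<subseteq> carrier L \<longrightarrow>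
        \<phi> xs \<in> carrier (tens H n M) \<and>
        (\<forall>i < n. \<forall>x \<in> carrier L. \<forall>y \<in> carrier L.
           \<phi> (xs[i := x \<boxplus>\<^bsub>L\<^esub> y]) = \<phi> (xs[i := x]) \<boxplus>\<^bsub>tens H n M\<^esub> \<phi> (xs[i := y])) \<and>
        (\<forall>hs. length hs = n \<longrightarrow>
           \<phi> (map2 (act L) hs xs) = act (tens H n M) (ptens H hs) (\<phi> xs)))"

text \<open>When the arguments at \<open>i\<close> and \<open>j\<close> are exchanged, the factors of the value are put back
  into the order of the original arguments.\<close>

definition skew_symmetric ::
  "('k::field, 'h::ring_1) hopf \<Rightarrow> nat \<Rightarrow> ('h, 'l) lmod \<Rightarrow> ('h, 'm) lmod \<Rightarrow>
   ('l list \<Rightarrow> ('h, 'm) tens) \<Rightarrow> bool" where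
  "skew_symmetric H n L M \<phi> \<longleftrightarrow>
     (\<forall>xs. length xs = n \<and> set xs \<subseteq> carrier L \<longrightarrow>
        (\<forall>i < n. \<forall>j < n. i \<noteq> j \<longrightarrow>
           perm_tens H M ([0..<n][i := j, j := i]) (\<phi> (xs[i := xs ! j, j := xs ! i]))
           = \<boxminus>\<^bsub>tens H n M\<^esub> \<phi> xs))"

text \<open>Composition inserts into the \<open>m\<close>-th of \<open>k\<close> arguments (counting from \<open>0\<close>) the value of a map
  with \<open>l\<close> arguments.  On the factors this is
  \<open>f\<^sup>1 \<otimes> \<dots> \<otimes> h\<^sup>1 f\<^sup>m\<^sub>(\<^sub>1\<^sub>) \<otimes> \<dots> \<otimes> h\<^sup>l f\<^sup>m\<^sub>(\<^sub>l\<^sub>) \<otimes> \<dots> \<otimes> f\<^sup>k\<close>,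
  with \<open>S\<close> in the role of \<open>h\<close> and \<open>T\<close> in the role of \<open>f\<close>.\<close>

definition insert_factors ::
  "('k::field, 'h::ring_1) hopf \<Rightarrow> nat \<Rightarrow> nat \<Rightarrow> nat \<Rightarrow> 'h tpow \<Rightarrow> 'h tpow \<Rightarrow> 'h tpow" where
  "insert_factors H k l m S T =
     lift (tpow H (k + l - 1))
       (\<lambda>fs. lift (tpow H (k + l - 1))
          (\<lambda>us. ptens H (take m fs @ us @ drop (Suc m) fs))
          (tpow_ract H l S (fs ! m))) T"

text \<open>\<open>\<phi>\<close> is the outer map as a function of its \<open>m\<close>-th argument, the others being fixed, and
  \<open>\<Psi>\<close> is the value of the inner map.\<close>

definition plug ::
  "('k::field, 'h::ring_1) hopf \<Rightarrow> nat \<Rightarrow> nat \<Rightarrow> nat \<Rightarrow> ('h, 'm) lmod \<Rightarrow>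
   ('e \<Rightarrow> ('h, 'm) tens) \<Rightarrow> ('h, 'e) tens \<Rightarrow> ('h, 'm) tens" where
  "plug H k l m M \<phi> \<Psi> =
     lift (tens H (k + l - 1) M)
       (\<lambda>(S, e). lift (tens H (k + l - 1) M)
          (\<lambda>(T, e'). tens_elt H (k + l - 1) M (insert_factors H k l m S T) e') (\<phi> e)) \<Psi>"


section \<open>Left-2 modules\<close>

record ('r, 'o, 'a) twomod =
  Ob :: "('r, 'o) lmod"
  Ar :: "('r, 'a) lmod"
  src :: "'a \<Rightarrow> 'o"
  tgt :: "'a \<Rightarrow> 'o"
  idn :: "'o \<Rightarrow> 'a"
  cmp :: "'a \<Rightarrow> 'a \<Rightarrow> 'a"

text \<open>\<open>cmp C g f\<close> is \<open>g\<close> after \<open>f\<close>.\<close>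

definition composable :: "('r, 'o, 'a, 'z) twomod_scheme \<Rightarrow> ('r, 'a \<times> 'a) lmod" where
  "composable C = \<lparr>carrier = {(g, f). g \<in> carrier (Ar C) \<and> f \<in> carrier (Ar C) \<and> src C g = tgt C f},
     monoid.mult = (\<lambda>(g, f) (g', f'). (g \<boxplus>\<^bsub>Ar C\<^esub> g', f \<boxplus>\<^bsub>Ar C\<^esub> f')),
     one = (\<one>\<^bsub>Ar C\<^esub>, \<one>\<^bsub>Ar C\<^esub>),
     act = (\<lambda>h (g, f). (act (Ar C) h g, act (Ar C) h f))\<rparr>"

definition left_2module :: "('h::ring_1, 'o, 'a, 'z) twomod_scheme \<Rightarrow> bool" where
  "left_2module C \<longleftrightarrow>
     left_module (Ob C) \<and> left_module (Ar C) \<and>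
     left_hom (Ar C) (Ob C) (src C) \<and> left_hom (Ar C) (Ob C) (tgt C) \<and>
     left_hom (Ob C) (Ar C) (idn C) \<and>
     left_hom (composable C) (Ar C) (\<lambda>(g, f). cmp C g f) \<and>
     (\<forall>x \<in> carrier (Ob C). src C (idn C x) = x \<and> tgt C (idn C x) = x) \<and>
     (\<forall>(g, f) \<in> carrier (composable C).
        src C (cmp C g f) = src C f \<and> tgt C (cmp C g f) = tgt C g) \<and>
     (\<forall>f \<in> carrier (Ar C). cmp C f (idn C (src C f)) = f \<and> cmp C (idn C (tgt C f)) f = f) \<and>
     (\<forall>h g f. (h, g) \<in> carrier (composable C) \<and> (g, f) \<in> carrier (composable C) \<longrightarrow>
        cmp C (cmp C h g) f = cmp C h (cmp C g f))"

definition internal_functor ::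
  "('h::ring_1, 'o, 'a, 'z) twomod_scheme \<Rightarrow> ('h, 'p, 'b, 'y) twomod_scheme \<Rightarrow>
   ('o \<Rightarrow> 'p) \<Rightarrow> ('a \<Rightarrow> 'b) \<Rightarrow> bool" where
  "internal_functor C D F0 F1 \<longleftrightarrow>
     left_hom (Ob C) (Ob D) F0 \<and> left_hom (Ar C) (Ar D) F1 \<and>
     (\<forall>f \<in> carrier (Ar C). src D (F1 f) = F0 (src C f) \<and> tgt D (F1 f) = F0 (tgt C f)) \<and>
     (\<forall>x \<in> carrier (Ob C). F1 (idn C x) = idn D (F0 x)) \<and>
     (\<forall>(g, f) \<in> carrier (composable C). F1 (cmp C g f) = cmp D (F1 g) (F1 f))"

text \<open>All structure maps are obtained by tensoring those of \<open>C\<close>.  The composition of \<open>C\<close> is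
  defined on the module of composable pairs, so the tensored one applies to composable arrows
  \<open>G\<close>, \<open>F\<close> through the identification of the tensored module of composable pairs with the
  composable pairs of tensored arrows.\<close>

definition tens_cat ::
  "('k::field, 'h::ring_1) hopf \<Rightarrow> nat \<Rightarrow> ('h, 'o, 'a, 'z) twomod_scheme \<Rightarrow>
   ('h tpow, ('h, 'o) tens, ('h, 'a) tens) twomod" where
  "tens_cat H n C = \<lparr>
     Ob = tens H n (Ob C),
     Ar = tens H n (Ar C),
     src = tens_map H n (Ob C) (src C),
     tgt = tens_map H n (Ob C) (tgt C),
     idn = tens_map H n (Ar C) (idn C),
     cmp = (\<lambda>G F. tens_map H n (Ar C) (\<lambda>(g, f). cmp C g f)
        (THE P. P \<in> carrier (tens H n (composable C)) \<and>
           tens_map H n (Ar C) fst P = G \<and> tens_map H n (Ar C) snd P = F))\<rparr>"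

definition arrow_from_to :: "('r, 'o, 'a, 'z) twomod_scheme \<Rightarrow> 'a \<Rightarrow> 'o \<Rightarrow> 'o \<Rightarrow> bool" where
  "arrow_from_to D f x y \<longleftrightarrow> f \<in> carrier (Ar D) \<and> src D f = x \<and> tgt D f = y"

definition iso_from_to :: "('r, 'o, 'a, 'z) twomod_scheme \<Rightarrow> 'a \<Rightarrow> 'o \<Rightarrow> 'o \<Rightarrow> bool" where
  "iso_from_to D f x y \<longleftrightarrow> arrow_from_to D f x y \<and>
     (\<exists>g. arrow_from_to D g y x \<and> cmp D g f = idn D x \<and> cmp D f g = idn D y)"


section \<open>Lie-2 pseudoalgebras\<close>

record ('h, 'o, 'a) lie2 = "('h, 'o, 'a) twomod" +
  br0 :: "'o \<Rightarrow> 'o \<Rightarrow> ('h, 'o) tens"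
  br1 :: "'a \<Rightarrow> 'a \<Rightarrow> ('h, 'a) tens"
  jac :: "'o \<Rightarrow> 'o \<Rightarrow> 'o \<Rightarrow> ('h, 'a) tens"

text \<open>The brackets of objects or arrows \<open>[X * y]\<close> and \<open>[x * Y]\<close> where one argument is a
  value with \<open>l\<close> factors.\<close>

abbreviation lbr0 :: "('k::field, 'h::ring_1) hopf \<Rightarrow> ('h, 'o, 'a) lie2 \<Rightarrow> nat \<Rightarrow>
    ('h, 'o) tens \<Rightarrow> 'o \<Rightarrow> ('h, 'o) tens" where
  "lbr0 H C l X y \<equiv> plug H 2 l 0 (Ob C) (\<lambda>e. br0 C e y) X"

abbreviation rbr0 :: "('k::field, 'h::ring_1) hopf \<Rightarrow> ('h, 'o, 'a) lie2 \<Rightarrow> nat \<Rightarrow>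
    'o \<Rightarrow> ('h, 'o) tens \<Rightarrow> ('h, 'o) tens" where
  "rbr0 H C l x Y \<equiv> plug H 2 l 1 (Ob C) (\<lambda>e. br0 C x e) Y"

abbreviation lbr1 :: "('k::field, 'h::ring_1) hopf \<Rightarrow> ('h, 'o, 'a) lie2 \<Rightarrow> nat \<Rightarrow>
    ('h, 'a) tens \<Rightarrow> 'a \<Rightarrow> ('h, 'a) tens" where
  "lbr1 H C l F g \<equiv> plug H 2 l 0 (Ar C) (\<lambda>e. br1 C e g) F"

abbreviation rbr1 :: "('k::field, 'h::ring_1) hopf \<Rightarrow> ('h, 'o, 'a) lie2 \<Rightarrow> nat \<Rightarrow>
    'a \<Rightarrow> ('h, 'a) tens \<Rightarrow> ('h, 'a) tens" where
  "rbr1 H C l f G \<equiv> plug H 2 l 1 (Ar C) (\<lambda>e. br1 C f e) G"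

text \<open>The source \<open>[[x * y] * z]\<close> and the target \<open>[x * [y * z]] - [y * [x * z]]\<close> of the Jacobiator, on
  objects and on arrows.  The factors of the last term are permuted into the order \<open>x, y, z\<close>.\<close>

definition jsrc0 :: "('k::field, 'h::ring_1) hopf \<Rightarrow> ('h, 'o, 'a) lie2 \<Rightarrow>
    'o \<Rightarrow> 'o \<Rightarrow> 'o \<Rightarrow> ('h, 'o) tens" where
  "jsrc0 H C x y z = lbr0 H C 2 (br0 C x y) z"

definition jtgt0 :: "('k::field, 'h::ring_1) hopf \<Rightarrow> ('h, 'o, 'a) lie2 \<Rightarrow>
    'o \<Rightarrow> 'o \<Rightarrow> 'o \<Rightarrow> ('h, 'o) tens" where
  "jtgt0 H C x y z = rbr0 H C 2 x (br0 C y z)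
     \<boxminus>\<^bsub>tens H 3 (Ob C)\<^esub> perm_tens H (Ob C) [1, 0, 2] (rbr0 H C 2 y (br0 C x z))"

definition jsrc1 :: "('k::field, 'h::ring_1) hopf \<Rightarrow> ('h, 'o, 'a) lie2 \<Rightarrow>
    'a \<Rightarrow> 'a \<Rightarrow> 'a \<Rightarrow> ('h, 'a) tens" where
  "jsrc1 H C f g h = lbr1 H C 2 (br1 C f g) h"

definition jtgt1 :: "('k::field, 'h::ring_1) hopf \<Rightarrow> ('h, 'o, 'a) lie2 \<Rightarrow>
    'a \<Rightarrow> 'a \<Rightarrow> 'a \<Rightarrow> ('h, 'a) tens" where
  "jtgt1 H C f g h = rbr1 H C 2 f (br1 C g h)
     \<boxminus>\<^bsub>tens H 3 (Ar C)\<^esub> perm_tens H (Ar C) [1, 0, 2] (rbr1 H C 2 g (br1 C f h))"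

text \<open>Functoriality of the bracket in both variables together, composition of pairs of arrows
  being componentwise.\<close>

definition lie2_bracket :: "('k::field, 'h::ring_1) hopf \<Rightarrow> ('h, 'o, 'a) lie2 \<Rightarrow> bool" where
  "lie2_bracket H C \<longleftrightarrow>
     polylinear H 2 (Ob C) (Ob C) (\<lambda>xs. br0 C (xs ! 0) (xs ! 1)) \<and>
     polylinear H 2 (Ar C) (Ar C) (\<lambda>fs. br1 C (fs ! 0) (fs ! 1)) \<and>
     skew_symmetric H 2 (Ob C) (Ob C) (\<lambda>xs. br0 C (xs ! 0) (xs ! 1)) \<and>
     skew_symmetric H 2 (Ar C) (Ar C) (\<lambda>fs. br1 C (fs ! 0) (fs ! 1)) \<and>
     (\<forall>f \<in> carrier (Ar C). \<forall>g \<in> carrier (Ar C).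
        arrow_from_to (tens_cat H 2 C) (br1 C f g)
          (br0 C (src C f) (src C g)) (br0 C (tgt C f) (tgt C g))) \<and>
     (\<forall>x \<in> carrier (Ob C). \<forall>y \<in> carrier (Ob C).
        br1 C (idn C x) (idn C y) = idn (tens_cat H 2 C) (br0 C x y)) \<and>
     (\<forall>(f', f) \<in> carrier (composable C). \<forall>(g', g) \<in> carrier (composable C).
        br1 C (cmp C f' f) (cmp C g' g) = cmp (tens_cat H 2 C) (br1 C f' g') (br1 C f g))"

definition lie2_jacobiator :: "('k::field, 'h::ring_1) hopf \<Rightarrow> ('h, 'o, 'a) lie2 \<Rightarrow> bool" where
  "lie2_jacobiator H C \<longleftrightarrow>
     polylinear H 3 (Ob C) (Ar C) (\<lambda>xs. jac C (xs ! 0) (xs ! 1) (xs ! 2)) \<and>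
     skew_symmetric H 3 (Ob C) (Ar C)
       (\<lambda>xs. jac C (xs ! 0) (xs ! 1) (xs ! 2)
          \<boxminus>\<^bsub>tens H 3 (Ar C)\<^esub> idn (tens_cat H 3 C) (jsrc0 H C (xs ! 0) (xs ! 1) (xs ! 2))) \<and>
     (\<forall>x \<in> carrier (Ob C). \<forall>y \<in> carrier (Ob C). \<forall>z \<in> carrier (Ob C).
        iso_from_to (tens_cat H 3 C) (jac C x y z) (jsrc0 H C x y z) (jtgt0 H C x y z)) \<and>
     (\<forall>f \<in> carrier (Ar C). \<forall>g \<in> carrier (Ar C). \<forall>h \<in> carrier (Ar C).
        cmp (tens_cat H 3 C) (jac C (tgt C f) (tgt C g) (tgt C h)) (jsrc1 H C f g h)
        = cmp (tens_cat H 3 C) (jtgt1 H C f g h) (jac C (src C f) (src C g) (src C h)))"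

text \<open>Arrows are composed from right to left and factors are in the order \<open>x, y, z, w\<close>.\<close>

definition lie2_coherence :: "('k::field, 'h::ring_1) hopf \<Rightarrow> ('h, 'o, 'a) lie2 \<Rightarrow> bool" where
  "lie2_coherence H C \<longleftrightarrow>
     (\<forall>x \<in> carrier (Ob C). \<forall>y \<in> carrier (Ob C). \<forall>z \<in> carrier (Ob C). \<forall>w \<in> carrier (Ob C).
      let A = tens H 4 (Ar C);
          after = cmp (tens_cat H 4 C);
          one_at = idn (tens_cat H 4 C);
          perm = perm_tens H (Ar C);
          perm0 = perm_tens H (Ob C);
          B = br0 C;
          J = jac C;
          \<comment> \<open>\<open>[[x * y] * [z * w]]\<close>, \<open>[z * [x * [y * w]]]\<close> and \<open>[z * [y * [x * w]]]\<close>\<close>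
          xy_zw = plug H 3 2 0 (Ob C) (\<lambda>e. rbr0 H C 2 e (B z w)) (B x y);
          z_x_yw = perm0 [1, 2, 0, 3] (rbr0 H C 3 z (rbr0 H C 2 x (B y w)));
          z_y_xw = perm0 [2, 1, 0, 3] (rbr0 H C 3 z (rbr0 H C 2 y (B x w)));
          a1 = lbr1 H C 3 (J x y z) (idn C w);
          a2 = plug H 3 2 1 (Ar C) (\<lambda>e. J x e w) (B y z)
               \<boxminus>\<^bsub>A\<^esub> perm [1, 0, 2, 3] (plug H 3 2 1 (Ar C) (\<lambda>e. J y e w) (B x z));
          a3 = rbr1 H C 3 (idn C x) (J y z w)
               \<boxminus>\<^bsub>A\<^esub> perm [2, 0, 1, 3] (plug H 3 2 2 (Ar C) (\<lambda>e. J y z e) (B x w))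
               \<boxminus>\<^bsub>A\<^esub> perm [1, 0, 2, 3] (rbr1 H C 3 (idn C y) (J x z w))
               \<boxplus>\<^bsub>A\<^esub> perm [0, 2, 1, 3] (plug H 3 2 2 (Ar C) (\<lambda>e. J x z e) (B y w));
          b1 = plug H 3 2 0 (Ar C) (\<lambda>e. J e z w) (B x y);
          b2 = one_at xy_zw \<boxminus>\<^bsub>A\<^esub> perm [1, 2, 0, 3] (rbr1 H C 3 (idn C z) (J x y w));
          b3 = plug H 3 2 2 (Ar C) (\<lambda>e. J x y e) (B z w)
               \<boxminus>\<^bsub>A\<^esub> one_at z_x_yw \<boxplus>\<^bsub>A\<^esub> one_at z_y_xw
      in after a3 (after a2 a1) = after b3 (after b2 b1))"

definition lie2_pseudoalgebra :: "('k::field, 'h::ring_1) hopf \<Rightarrow> ('h, 'o, 'a) lie2 \<Rightarrow> bool" where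
  "lie2_pseudoalgebra H C \<longleftrightarrow>
     left_2module C \<and> lie2_bracket H C \<and> lie2_jacobiator H C \<and> lie2_coherence H C"


section \<open>Morphisms\<close>

record ('h, 'o, 'a, 'p, 'b) lie2_mor =
  F0 :: "'o \<Rightarrow> 'p"
  F1 :: "'a \<Rightarrow> 'b"
  F2 :: "'o \<times> 'o \<Rightarrow> ('h, 'b) tens"

text \<open>The maps are extensional, so that morphisms are equal exactly if they agree on the
  carriers.  As a natural transformation internal to modules, the last component is
  polylinear.\<close>

definition lie2_morphism ::
  "('k::field, 'h::ring_1) hopf \<Rightarrow> ('h, 'o, 'a) lie2 \<Rightarrow> ('h, 'p, 'b) lie2 \<Rightarrow>
   ('h, 'o, 'a, 'p, 'b) lie2_mor \<Rightarrow> bool" where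
  "lie2_morphism H C D F \<longleftrightarrow>
     F0 F \<in> extensional (carrier (Ob C)) \<and>
     F1 F \<in> extensional (carrier (Ar C)) \<and>
     F2 F \<in> extensional (carrier (Ob C) \<times> carrier (Ob C)) \<and>
     internal_functor C D (F0 F) (F1 F) \<and>
     polylinear H 2 (Ob C) (Ar D) (\<lambda>xs. F2 F (xs ! 0, xs ! 1)) \<and>
     (\<forall>x \<in> carrier (Ob C). \<forall>y \<in> carrier (Ob C).
        iso_from_to (tens_cat H 2 D) (F2 F (x, y))
          (br0 D (F0 F x) (F0 F y)) (tens_map H 2 (Ob D) (F0 F) (br0 C x y))) \<and>
     (\<forall>f \<in> carrier (Ar C). \<forall>g \<in> carrier (Ar C).
        cmp (tens_cat H 2 D) (F2 F (tgt C f, tgt C g)) (br1 D (F1 F f) (F1 F g))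
        = cmp (tens_cat H 2 D) (tens_map H 2 (Ar D) (F1 F) (br1 C f g)) (F2 F (src C f, src C g))) \<and>
     (\<forall>x \<in> carrier (Ob C). \<forall>y \<in> carrier (Ob C). \<forall>z \<in> carrier (Ob C).
      let A = tens H 3 (Ar D);
          after = cmp (tens_cat H 3 D);
          perm = perm_tens H (Ar D);
          one = (\<lambda>u. idn D (F0 F u));
          a1 = jac D (F0 F x) (F0 F y) (F0 F z);
          a2 = rbr1 H D 2 (one x) (F2 F (y, z))
               \<boxminus>\<^bsub>A\<^esub> perm [1, 0, 2] (rbr1 H D 2 (one y) (F2 F (x, z)));
          a3 = plug H 2 2 1 (Ar D) (\<lambda>e. F2 F (x, e)) (br0 C y z)
               \<boxminus>\<^bsub>A\<^esub> perm [1, 0, 2] (plug H 2 2 1 (Ar D) (\<lambda>e. F2 F (y, e)) (br0 C x z));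
          b1 = lbr1 H D 2 (F2 F (x, y)) (one z);
          b2 = plug H 2 2 0 (Ar D) (\<lambda>e. F2 F (e, z)) (br0 C x y);
          b3 = tens_map H 3 (Ar D) (F1 F) (jac C x y z)
      in after (after a3 a2) a1 = after (after b3 b2) b1)"

definition lie2_id ::
  "('k::field, 'h::ring_1) hopf \<Rightarrow> ('h, 'o, 'a) lie2 \<Rightarrow> ('h, 'o, 'a, 'o, 'a) lie2_mor" where
  "lie2_id H C = \<lparr>
     F0 = (\<lambda>x \<in> carrier (Ob C). x),
     F1 = (\<lambda>f \<in> carrier (Ar C). f),
     F2 = (\<lambda>(x, y) \<in> carrier (Ob C) \<times> carrier (Ob C). idn (tens_cat H 2 C) (br0 C x y))\<rparr>"

definition lie2_comp ::
  "('k::field, 'h::ring_1) hopf \<Rightarrow> ('h, 'o, 'a) lie2 \<Rightarrow> ('h, 'p, 'b) lie2 \<Rightarrow> ('h, 'q, 'c) lie2 \<Rightarrow>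
   ('h, 'p, 'b, 'q, 'c) lie2_mor \<Rightarrow> ('h, 'o, 'a, 'p, 'b) lie2_mor \<Rightarrow>
   ('h, 'o, 'a, 'q, 'c) lie2_mor" where
  "lie2_comp H C D E G F = \<lparr>
     F0 = (\<lambda>x \<in> carrier (Ob C). F0 G (F0 F x)),
     F1 = (\<lambda>f \<in> carrier (Ar C). F1 G (F1 F f)),
     F2 = (\<lambda>(x, y) \<in> carrier (Ob C) \<times> carrier (Ob C).
        cmp (tens_cat H 2 E) (tens_map H 2 (Ar E) (F1 G) (F2 F (x, y))) (F2 G (F0 F x, F0 F y)))\<rparr>"


section \<open>Categories\<close>

text \<open>\<open>Comp A B C g f\<close> is \<open>g\<close> after \<open>f\<close> for \<open>f\<close> from \<open>A\<close> to \<open>B\<close> and \<open>g\<close> from \<open>B\<close> to \<open>C\<close>.\<close>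

locale category =
  fixes Obj :: "'c set"
    and Hom :: "'c \<Rightarrow> 'c \<Rightarrow> 'm set"
    and Id :: "'c \<Rightarrow> 'm"
    and Comp :: "'c \<Rightarrow> 'c \<Rightarrow> 'c \<Rightarrow> 'm \<Rightarrow> 'm \<Rightarrow> 'm"
  assumes Id_in_Hom: "A \<in> Obj \<Longrightarrow> Id A \<in> Hom A A"
    and Comp_in_Hom: "\<lbrakk>A \<in> Obj; B \<in> Obj; C \<in> Obj; f \<in> Hom A B; g \<in> Hom B C\<rbrakk>
      \<Longrightarrow> Comp A B C g f \<in> Hom A C"
    and Comp_Id: "\<lbrakk>A \<in> Obj; B \<in> Obj; f \<in> Hom A B\<rbrakk> \<Longrightarrow> Comp A A B f (Id A) = f"
    and Id_Comp: "\<lbrakk>A \<in> Obj; B \<in> Obj; f \<in> Hom A B\<rbrakk> \<Longrightarrow> Comp A B B (Id B) f = f"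
    and Comp_assoc: "\<lbrakk>A \<in> Obj; B \<in> Obj; C \<in> Obj; D \<in> Obj;
        f \<in> Hom A B; g \<in> Hom B C; h \<in> Hom C D\<rbrakk>
      \<Longrightarrow> Comp A B D (Comp B C D h g) f = Comp A C D h (Comp A B C g f)"

end

theory Submission
  imports Defs
begin

text \<open>In a category internal to abelian groups the composition is forced to be
  \<open>g \<circ> f = g + f - 1\<^sub>b\<close>, where \<open>b\<close> is the object in the middle.  Hence a category obtained by
  tensoring is again such a category, all its arrows are invertible, and additive maps that respect
  source, target and identities respect composition.

  Coassociativity makes the substitution of a value into an argument well defined, and
  cocommutativity the permutation of factors.  For a morphism \<open>F\<close> put
  \<open>R\<^sub>F(x, y, z) = F\<^sub>2(x, [y * z]) \<circ> [F\<^sub>0 x * F\<^sub>2(y, z)]\<close> and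
  \<open>L\<^sub>F(x, y, z) = F\<^sub>2([x * y], z) \<circ> [F\<^sub>2(x, y) * F\<^sub>0 z]\<close>.  The compatibility of \<open>F\<close> with the
  Jacobiators then reads \<open>(R\<^sub>F(x, y, z) - R\<^sub>F(y, x, z)) \<circ> J' = F\<^sub>1(J) \<circ> L\<^sub>F(x, y, z)\<close>.
  Naturality of \<open>G\<^sub>2\<close>, substituted into one argument, gives \<open>R = G\<^sub>1(R\<^sub>F) \<circ> R\<^sub>G\<close> and
  \<open>L = G\<^sub>1(L\<^sub>F) \<circ> L\<^sub>G\<close> for the composite, whose compatibility follows by pasting those of \<open>F\<close>
  and \<open>G\<close>.\<close>

text \<open>Two obstacles shape the proof. Every group is presented and every operation is a
  \<open>lift\<close>, evaluated on an unspecified representative, so nothing can be said about an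
  operation before it is known to respect the relators. Each operation therefore enters with two
  facts, that it is a homomorphism and what it does to generators; identities are then checked on
  generators. The other obstacle is the composition in \<open>tens_cat\<close>, a definite
  description over the tensored module of composable pairs. Existence and uniqueness of the pair are
  extracted from (g, f) + (1, 1) = (g, 1) + (1, f): all these pairs depend linearly on (g, f), so
  the equation persists after tensoring and determines a pair by its two projections. Every
  substitution in the compatibility of a morphism puts a value with two factors into a map of two
  arguments, which is why \<open>plug\<close> is treated for \<open>k = l = 2\<close>, with three
  resulting factors.\<close>

lemma group_homI: "group G \<Longrightarrow> group K \<Longrightarrow> h \<in> hom G K \<Longrightarrow> group_hom G K h"
  by (simp add: group_hom_def group_hom_axioms_def)

lemma hom_add:
  assumes "comm_group K" "f \<in> hom G K" "g \<in> hom G K"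
  shows "(\<lambda>x. f x \<boxplus>\<^bsub>K\<^esub> g x) \<in> hom G K"
proof -
  interpret K: comm_group K by fact
  have "f x \<in> carrier K" "g x \<in> carrier K" if "x \<in> carrier G" for x
    using assms(2,3) that by (auto simp: hom_def)
  then show ?thesis using assms(2,3) by (auto simp: hom_def K.m_ac)
qed

text \<open>Relators occur in just two shapes, \<open>a - b\<close> and \<open>a - b - c\<close>.
  This lemma and the next turn the vanishing of such an element into the equation that the relator
  encodes.\<close>

lemma (in comm_group) minus_eq_one_iff:
  assumes "a \<in> carrier G" "b \<in> carrier G"
  shows "a \<boxminus>\<^bsub>G\<^esub> b = \<one>\<^bsub>G\<^esub> \<longleftrightarrow> a = b"
  using assms by (simp add: inv_solve_right')

lemma (in comm_group) minus_minus_eq_one_iff: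
  assumes "a \<in> carrier G" "b \<in> carrier G" "c \<in> carrier G"
  shows "(a \<boxminus>\<^bsub>G\<^esub> b) \<boxminus>\<^bsub>G\<^esub> c = \<one>\<^bsub>G\<^esub> \<longleftrightarrow> a = b \<boxplus>\<^bsub>G\<^esub> c"
proof -
  have "(a \<boxminus>\<^bsub>G\<^esub> b) \<boxminus>\<^bsub>G\<^esub> c = \<one>\<^bsub>G\<^esub> \<longleftrightarrow> a \<boxminus>\<^bsub>G\<^esub> b = c"
    using assms by (intro minus_eq_one_iff) simp_all
  also have "\<dots> \<longleftrightarrow> a = c \<boxplus>\<^bsub>G\<^esub> b" using assms by (intro inv_solve_right')
  finally show ?thesis using assms by (simp only: m_comm)
qed

section \<open>Groups given by generators and relations\<close>

lemma normal_relators: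
  assumes "R \<subseteq> carrier (free_Abelian_group X)"
  shows "relators X R \<lhd> free_Abelian_group X"
  unfolding relators_def comm_group.normal_iff_subgroup[OF abelian_free_Abelian_group]
  by (rule group.generate_is_subgroup[OF group_free_Abelian_group assms])

lemma comm_group_presented:
  assumes "R \<subseteq> carrier (free_Abelian_group X)"
  shows "comm_group (presented X R)"
  unfolding presented_def
  by (rule comm_group.abelian_FactGroup[OF abelian_free_Abelian_group
        normal_imp_subgroup[OF normal_relators[OF assms]]])

lemma group_hom_r_coset:
  assumes R: "R \<subseteq> carrier (free_Abelian_group X)"
  shows "group_hom (free_Abelian_group X) (presented X R)
    (\<lambda>p. relators X R #>\<^bsub>free_Abelian_group X\<^esub> p)"
proof -
  interpret N: normal "relators X R" "free_Abelian_group X" using normal_relators[OF R] .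
  show ?thesis
    using N.r_coset_hom_Mod comm_group.axioms(2)[OF comm_group_presented[OF R]]
    by (simp add: group_homI presented_def)
qed

lemma r_coset_relator:
  assumes R: "R \<subseteq> carrier (free_Abelian_group X)" and r: "r \<in> R"
  shows "relators X R #>\<^bsub>free_Abelian_group X\<^esub> r = \<one>\<^bsub>presented X R\<^esub>"
proof -
  interpret N: normal "relators X R" "free_Abelian_group X" using normal_relators[OF R] .
  have "r \<in> relators X R" using r by (simp add: relators_def generate.incl)
  then show ?thesis
    using group.coset_join2[OF group_free_Abelian_group _ N.subgroup_axioms, of r] N.subset
    by (simp add: presented_def subset_iff)
qed

lemma gen_class_closed:
  assumes "g \<in> X"
  shows "gen_class X R g \<in> carrier (presented X R)"
  unfolding gen_class_def presented_def carrier_FactGroup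
  by (rule imageI) (use assms in simp)

lemma minus_closed_free_Abelian_group:
  assumes "p \<in> carrier (free_Abelian_group X)" "q \<in> carrier (free_Abelian_group X)"
  shows "p - q \<in> carrier (free_Abelian_group X)"
  using assms order_trans[OF keys_diff[of p q]] by simp

text \<open>The relators are written with the subtraction of formal sums, while homomorphisms speak
  of the product and inverse of the group record; this passes from one to the other.\<close>

lemma hom_free_Abelian_group_minus:
  assumes "group G" "h \<in> hom (free_Abelian_group X) G"
    and p: "p \<in> carrier (free_Abelian_group X)" and q: "q \<in> carrier (free_Abelian_group X)"
  shows "h (p - q) = h p \<boxminus>\<^bsub>G\<^esub> h q"
proof -
  interpret h: group_hom "free_Abelian_group X" G h
    using assms by (simp add: group_homI)
  show ?thesis
    using h.hom_mult[OF p, of "- q"] h.hom_inv[OF q] p q by simp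
qed

lemma gen_class_eqI:
  assumes R: "R \<subseteq> carrier (free_Abelian_group X)" and r: "frag_of a - frag_of b \<in> R"
    and X: "a \<in> X" "b \<in> X"
  shows "gen_class X R a = gen_class X R b"
proof -
  interpret P: comm_group "presented X R" using comm_group_presented[OF R] .
  interpret q: group_hom "free_Abelian_group X" "presented X R"
    "\<lambda>p. relators X R #>\<^bsub>free_Abelian_group X\<^esub> p" by (rule group_hom_r_coset[OF R])
  have "gen_class X R a \<boxminus>\<^bsub>presented X R\<^esub> gen_class X R b = \<one>\<^bsub>presented X R\<^esub>"
    using hom_free_Abelian_group_minus[OF P.is_group q.homh, of "frag_of a" "frag_of b"]
      r_coset_relator[OF R r] X
    by (simp add: gen_class_def)
  then show ?thesis by (simp add: P.minus_eq_one_iff gen_class_closed X)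
qed

lemma gen_class_addI:
  assumes R: "R \<subseteq> carrier (free_Abelian_group X)"
    and r: "frag_of a - frag_of b - frag_of c \<in> R"
    and X: "a \<in> X" "b \<in> X" "c \<in> X"
  shows "gen_class X R a = gen_class X R b \<boxplus>\<^bsub>presented X R\<^esub> gen_class X R c"
proof -
  interpret P: comm_group "presented X R" using comm_group_presented[OF R] .
  interpret q: group_hom "free_Abelian_group X" "presented X R"
    "\<lambda>p. relators X R #>\<^bsub>free_Abelian_group X\<^esub> p" by (rule group_hom_r_coset[OF R])
  have ab: "frag_of a - frag_of b \<in> carrier (free_Abelian_group X)"
    using X by (intro minus_closed_free_Abelian_group) simp_all
  have "(gen_class X R a \<boxminus>\<^bsub>presented X R\<^esub> gen_class X R b)
      \<boxminus>\<^bsub>presented X R\<^esub> gen_class X R c = \<one>\<^bsub>presented X R\<^esub>"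
    using hom_free_Abelian_group_minus[OF P.is_group q.homh, of "frag_of a" "frag_of b"]
      hom_free_Abelian_group_minus[OF P.is_group q.homh ab, of "frag_of c"]
      r_coset_relator[OF R r] X
    by (simp add: gen_class_def)
  then show ?thesis by (simp add: P.minus_minus_eq_one_iff gen_class_closed X)
qed

text \<open>The right-hand side is the expression in the definition of \<open>lift\<close>. So
  \<open>lift\<close> can be computed by any homomorphism with the prescribed values on generators,
  in particular by the one from the universal property of the free group.\<close>

lemma hom_free_Abelian_group_eq_finprod:
  assumes "comm_group G" and h: "h \<in> hom (free_Abelian_group X) G"
    and f: "\<And>g. g \<in> X \<Longrightarrow> h (frag_of g) = f g"
    and p: "p \<in> carrier (free_Abelian_group X)"
  shows "h p = finprod G (\<lambda>g. f g [^]\<^bsub>G\<^esub> Poly_Mapping.lookup p g) (Poly_Mapping.keys p)"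
proof -
  interpret G: comm_group G by fact
  interpret h: group_hom "free_Abelian_group X" G h
    by (simp add: group_homI h)
  have f_closed: "f g \<in> carrier G" if "g \<in> X" for g
    using h.hom_closed[of "frag_of g"] f[OF that] that by simp
  \<comment> \<open>The support and the coefficients are decoupled from \<open>p\<close>, so that
    the induction can shrink the index set without changing the coefficients.\<close>
  have "h (\<Sum>g\<in>I. frag_cmul (c g) (frag_of g)) = finprod G (\<lambda>g. f g [^]\<^bsub>G\<^esub> c g) I"
    if "finite I" "I \<subseteq> X" for I c
    using that
  proof (induction I)
    case empty
    then show ?case using h.hom_one by simp
  next
    case (insert g I)
    have cm: "frag_cmul (c i) (frag_of i) \<in> carrier (free_Abelian_group X)" if "i \<in> X" for i
      using that keys_cmul[of "c i" "frag_of i"] by auto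
    have 1: "(\<Sum>g\<in>I. frag_cmul (c g) (frag_of g)) \<in> carrier (free_Abelian_group X)"
      by (intro sum_closed_free_Abelian_group cm) (use insert in auto)
    have 2: "h (frag_cmul (c g) (frag_of g)) = f g [^]\<^bsub>G\<^esub> c g"
      using group_hom.hom_int_pow[OF h.group_hom_axioms, of "frag_of g" "c g"] insert f by simp
    have "h (frag_cmul (c g) (frag_of g) + (\<Sum>g\<in>I. frag_cmul (c g) (frag_of g)))
        = h (frag_cmul (c g) (frag_of g)) \<otimes>\<^bsub>G\<^esub> h (\<Sum>g\<in>I. frag_cmul (c g) (frag_of g))"
      using h.hom_mult[OF cm 1] insert by simp
    then show ?case
      using insert f_closed 2 by (simp add: G.finprod_insert subset_iff Pi_iff)
  qed
  from this[of "Poly_Mapping.keys p" "Poly_Mapping.lookup p"] p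
  show ?thesis
    using frag_expansion[of p] by (simp add: frag_extend_def)
qed

text \<open>A class is represented by a formal sum, and formal sums are built from generators by
  subtraction. This is the tool by which identities between tensors are reduced to pure
  tensors.\<close>

lemma presented_hom_eqI:
  assumes R: "R \<subseteq> carrier (free_Abelian_group X)" and G: "group G"
    and h: "h \<in> hom (presented X R) G" "h' \<in> hom (presented X R) G"
    and eq: "\<And>g. g \<in> X \<Longrightarrow> h (gen_class X R g) = h' (gen_class X R g)"
    and x: "x \<in> carrier (presented X R)"
  shows "h x = h' x"
proof -
  let ?F = "free_Abelian_group X" and ?q = "\<lambda>p. relators X R #>\<^bsub>free_Abelian_group X\<^esub> p"
  interpret P: comm_group "presented X R" using comm_group_presented[OF R] .
  interpret q: group_hom ?F "presented X R" ?q by (rule group_hom_r_coset[OF R])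
  interpret h: group_hom "presented X R" G h by (rule group_homI[OF P.is_group G h(1)])
  interpret h': group_hom "presented X R" G h' by (rule group_homI[OF P.is_group G h(2)])
  have "h (?q p) = h' (?q p)" if "Poly_Mapping.keys p \<subseteq> X" for p
    using that
  proof (rule free_Abelian_group_induct)
    show "h (?q 0) = h' (?q 0)" using q.hom_one by simp
  next
    fix a b
    assume 2: "Poly_Mapping.keys a \<subseteq> X" "Poly_Mapping.keys b \<subseteq> X"
      "h (?q a) = h' (?q a)" "h (?q b) = h' (?q b)"
    have "?q (a - b) = ?q a \<otimes>\<^bsub>presented X R\<^esub> inv\<^bsub>presented X R\<^esub> ?q b"
      using 2 q.hom_mult[of a "-b"] q.hom_inv[of b] by simp
    then show "h (?q (a - b)) = h' (?q (a - b))" using 2 q.hom_closed by simp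
  qed (use eq in \<open>simp add: gen_class_def\<close>)
  then show ?thesis using x by (auto simp: presented_def carrier_FactGroup)
qed

text \<open>The homomorphism \<open>h\<close> out of the free group kills the relators, hence the
  subgroup they generate, so its value depends only on the class. The hypothesis \<open>rel\<close>
  states each relation as an equation between values of \<open>f\<close>, so that no calculation in
  the free group is left to the applications.\<close>

lemma lift_presented:
  assumes G: "comm_group G" and R: "R \<subseteq> carrier (free_Abelian_group X)"
    and f: "\<And>g. g \<in> X \<Longrightarrow> f g \<in> carrier G"
    and rel: "\<And>r. r \<in> R \<Longrightarrow>
      (\<exists>a\<in>X. \<exists>b\<in>X. r = frag_of a - frag_of b \<and> f a = f b) \<or>
      (\<exists>a\<in>X. \<exists>b\<in>X. \<exists>c\<in>X. r = frag_of a - frag_of b - frag_of c \<and> f a = f b \<boxplus>\<^bsub>G\<^esub> f c)"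
  shows lift_presented_hom: "lift G f \<in> hom (presented X R) G"
    and lift_gen_class: "g \<in> X \<Longrightarrow> lift G f (gen_class X R g) = f g"
proof -
  let ?F = "free_Abelian_group X" and ?q = "\<lambda>p. relators X R #>\<^bsub>free_Abelian_group X\<^esub> p"
  interpret G: comm_group G by fact
  interpret F: comm_group ?F by (rule abelian_free_Abelian_group)
  interpret P: comm_group "presented X R" using comm_group_presented[OF R] .
  interpret N: normal "relators X R" ?F using normal_relators[OF R] .
  interpret q: group_hom ?F "presented X R" ?q by (rule group_hom_r_coset[OF R])
  obtain h where h: "h \<in> hom ?F G" and hf: "\<And>g. g \<in> X \<Longrightarrow> h (frag_of g) = f g"
    using G.free_Abelian_group_universal[of f X] f by blast
  interpret h: group_hom ?F G h by (rule group_homI[OF F.is_group G.is_group h])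
  note minus = hom_free_Abelian_group_minus[OF G.is_group h]
  have frag: "frag_of g \<in> carrier ?F" if "g \<in> X" for g using that by simp
  have h2: "h (frag_of a - frag_of b) = f a \<boxminus>\<^bsub>G\<^esub> f b" if "a \<in> X" "b \<in> X" for a b
    using minus[OF frag[OF that(1)] frag[OF that(2)]] by (simp only: hf that)
  have h3: "h (frag_of a - frag_of b - frag_of c) = f a \<boxminus>\<^bsub>G\<^esub> f b \<boxminus>\<^bsub>G\<^esub> f c"
    if "a \<in> X" "b \<in> X" "c \<in> X" for a b c
    using minus[OF minus_closed_free_Abelian_group[OF frag[OF that(1)] frag[OF that(2)]]
        frag[OF that(3)]]
    by (simp only: hf h2 that)
  have "h r = \<one>\<^bsub>G\<^esub>" if "r \<in> R" for r
    using rel[OF that]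
  proof (elim disjE bexE conjE)
    fix a b assume "a \<in> X" "b \<in> X" "r = frag_of a - frag_of b" "f a = f b"
    then show ?thesis by (simp only: h2 G.minus_eq_one_iff f)
  next
    fix a b c assume "a \<in> X" "b \<in> X" "c \<in> X" "r = frag_of a - frag_of b - frag_of c"
        "f a = f b \<boxplus>\<^bsub>G\<^esub> f c"
    then show ?thesis by (simp add: h3 G.minus_minus_eq_one_iff f)
  qed
  then have "R \<subseteq> kernel ?F G h"
    using R unfolding kernel_def by blast
  then have ker: "h r = \<one>\<^bsub>G\<^esub>" if "r \<in> relators X R" for r
    using group.generate_subgroup_incl[OF group_free_Abelian_group _ h.subgroup_kernel, of R] that
    by (auto simp: relators_def kernel_def)
  \<comment> \<open>Whatever representative \<open>SOME\<close> picks, it is \<open>r + p\<close>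
    with \<open>r\<close> in \<open>relators X R\<close>, and \<open>h\<close> does not see
    \<open>r\<close>.\<close>
  have lift_q: "lift G f (?q p) = h p" if p: "p \<in> carrier ?F" for p
  proof -
    have "p \<in> ?q p" by (rule group.rcos_self[OF group_free_Abelian_group p N.subgroup_axioms])
    then have "(SOME p'. p' \<in> ?q p) \<in> ?q p" by (rule someI[where P = "\<lambda>p'. p' \<in> ?q p"])
    then obtain r where r: "r \<in> relators X R" "(SOME p'. p' \<in> ?q p) = r + p"
      by (auto simp: r_coset_def)
    have rc: "r \<in> carrier ?F" by (rule subsetD[OF N.subset r(1)])
    have "r + p \<in> carrier ?F" using F.m_closed[OF rc p] by simp
    then have "lift G f (?q p) = h (r + p)"
      unfolding lift_def Let_def r(2)
      using hom_free_Abelian_group_eq_finprod[OF G h hf] by simp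
    also have "\<dots> = h p" using h.hom_mult[OF rc p] ker[OF r(1)] h.hom_closed[OF p] by simp
    finally show ?thesis .
  qed
  show "lift G f \<in> hom (presented X R) G"
  proof (rule homI)
    fix x assume "x \<in> carrier (presented X R)"
    then obtain p where "p \<in> carrier ?F" "x = ?q p" by (auto simp: presented_def carrier_FactGroup)
    then show "lift G f x \<in> carrier G" using lift_q h.hom_closed by simp
  next
    fix x y assume "x \<in> carrier (presented X R)" "y \<in> carrier (presented X R)"
    then obtain p p' where p: "p \<in> carrier ?F" "x = ?q p" "p' \<in> carrier ?F" "y = ?q p'"
      by (auto simp: presented_def carrier_FactGroup)
    have "x \<otimes>\<^bsub>presented X R\<^esub> y = ?q (p \<otimes>\<^bsub>?F\<^esub> p')"
      using p q.hom_mult[OF p(1,3)] by simp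
    then show "lift G f (x \<otimes>\<^bsub>presented X R\<^esub> y) = lift G f x \<otimes>\<^bsub>G\<^esub> lift G f y"
      using p(2,4) lift_q[OF p(1)] lift_q[OF p(3)] lift_q[OF F.m_closed[OF p(1,3)]]
        h.hom_mult[OF p(1,3)] by simp
  qed
  show "lift G f (gen_class X R g) = f g" if "g \<in> X"
    using lift_q[of "frag_of g"] hf that by (simp add: gen_class_def)
qed

section \<open>Tensor powers\<close>

lemma map2_list_update:
  assumes "length xs = length ys" "i < length ys"
  shows "map2 f xs (ys[i := b]) = (map2 f xs ys)[i := f (xs ! i) b]"
    and "map2 f (xs[i := a]) ys = (map2 f xs ys)[i := f a (ys ! i)]"
  using assms by (auto intro!: nth_equalityI simp: nth_list_update)

text \<open>The target is only a group, without scalars, so homogeneity can be expressed only as the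
  freedom to move a scalar between slots. The clauses match the relations in
  \<open>tpow_rels\<close>.\<close>

definition kmultilinear ::
  "('k::field, 'h::ring_1) hopf \<Rightarrow> nat \<Rightarrow> ('b, 'c) monoid_scheme \<Rightarrow> ('h list \<Rightarrow> 'b) \<Rightarrow> bool" where
  "kmultilinear H n G f \<longleftrightarrow>
     (\<forall>hs. length hs = n \<longrightarrow> f hs \<in> carrier G) \<and>
     (\<forall>hs i a b. length hs = n \<and> i < n \<longrightarrow>
        f (hs[i := a + b]) = f (hs[i := a]) \<boxplus>\<^bsub>G\<^esub> f (hs[i := b])) \<and>
     (\<forall>hs i j c. length hs = n \<and> i < n \<and> j < n \<longrightarrow>
        f (hs[i := scale H c (hs ! i)]) = f (hs[j := scale H c (hs ! j)]))"

lemma kmultilinearD: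
  assumes "kmultilinear H n G f" "length hs = n"
  shows "f hs \<in> carrier G"
    and "i < n \<Longrightarrow> f (hs[i := a + b]) = f (hs[i := a]) \<boxplus>\<^bsub>G\<^esub> f (hs[i := b])"
    and "i < n \<Longrightarrow> j < n \<Longrightarrow> f (hs[i := scale H c (hs ! i)]) = f (hs[j := scale H c (hs ! j)])"
  using assms unfolding kmultilinear_def by blast+

lemma tpow_rels_add:
  assumes "length hs = n" "i < n"
  shows "frag_of (hs[i := a + b]) - frag_of (hs[i := a]) - frag_of (hs[i := b]) \<in> tpow_rels H n"
  unfolding tpow_rels_def by (rule UnI1, rule CollectI, rule exI[of _ hs], rule exI[of _ i],
      rule exI[of _ a], rule exI[of _ b])
    (intro conjI refl assms)

lemma tpow_rels_scale:
  assumes "length hs = n" "i < n" "j < n"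
  shows "frag_of (hs[i := scale H c (hs ! i)]) - frag_of (hs[j := scale H c (hs ! j)])
      \<in> tpow_rels H n"
  unfolding tpow_rels_def by (rule UnI2, rule CollectI, rule exI[of _ hs], rule exI[of _ i],
      rule exI[of _ j], rule exI[of _ c])
    (intro conjI refl assms)

lemma tpow_rels_subset: "tpow_rels H n \<subseteq> carrier (free_Abelian_group (tpow_gens n))"
proof
  fix r assume "r \<in> tpow_rels H n"
  then show "r \<in> carrier (free_Abelian_group (tpow_gens n))"
    unfolding tpow_rels_def
    by (elim UnE CollectE exE conjE; simp only:)
       (intro minus_closed_free_Abelian_group; simp add: tpow_gens_def)+
qed

lemma comm_group_tpow: "comm_group (tpow H n)"
  unfolding tpow_def by (rule comm_group_presented[OF tpow_rels_subset])

lemma ptens_closed: "length hs = n \<Longrightarrow> ptens H hs \<in> carrier (tpow H n)"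
  unfolding tpow_def ptens_def by (simp add: tpow_gens_def gen_class_closed)

lemma tpow_hom_eqI:
  assumes "group G" "h \<in> hom (tpow H n) G" "h' \<in> hom (tpow H n) G"
    and "\<And>hs. length hs = n \<Longrightarrow> h (ptens H hs) = h' (ptens H hs)"
    and "S \<in> carrier (tpow H n)"
  shows "h S = h' S"
  by (rule presented_hom_eqI[OF tpow_rels_subset assms(1) assms(2,3)[unfolded tpow_def] _
        assms(5)[unfolded tpow_def]])
    (use assms(4) in \<open>simp add: ptens_def tpow_gens_def\<close>)

lemma kmultilinear_ptens: "kmultilinear H n (tpow H n) (ptens H)"
  unfolding kmultilinear_def
proof (intro conjI allI impI; (elim conjE)?)
  fix hs :: "'b list" assume n: "length hs = n"
  show "ptens H hs \<in> carrier (tpow H n)" using n by (rule ptens_closed)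
  fix i assume i: "i < n"
  show "ptens H (hs[i := a + b]) = ptens H (hs[i := a]) \<boxplus>\<^bsub>tpow H n\<^esub> ptens H (hs[i := b])" for a b
    unfolding ptens_def tpow_def length_list_update n
    by (rule gen_class_addI[OF tpow_rels_subset])
       (use n i in \<open>auto simp: tpow_gens_def intro!: tpow_rels_add tpow_rels_scale\<close>)
  fix j c assume j: "j < n"
  show "ptens H (hs[i := scale H c (hs ! i)]) = ptens H (hs[j := scale H c (hs ! j)])"
    unfolding ptens_def tpow_def length_list_update n
    by (rule gen_class_eqI[OF tpow_rels_subset])
       (use n i j in \<open>auto simp: tpow_gens_def intro!: tpow_rels_add tpow_rels_scale\<close>)
qed

text \<open>Universal property of the tensor power: the two families in \<open>tpow_rels\<close> are
  answered by the additivity and the balancing clause of \<open>kmultilinear\<close>.\<close>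

lemma lift_tpow:
  assumes G: "comm_group G" and f: "kmultilinear H n G f"
  shows lift_tpow_hom: "lift G f \<in> hom (tpow H n) G"
    and lift_ptens: "length hs = n \<Longrightarrow> lift G f (ptens H hs) = f hs"
proof -
  interpret G: comm_group G by fact
  have rel: "(\<exists>a\<in>tpow_gens n. \<exists>b\<in>tpow_gens n. r = frag_of a - frag_of b \<and> f a = f b) \<or>
      (\<exists>a\<in>tpow_gens n. \<exists>b\<in>tpow_gens n. \<exists>c\<in>tpow_gens n.
        r = frag_of a - frag_of b - frag_of c \<and> f a = f b \<boxplus>\<^bsub>G\<^esub> f c)"
    if r: "r \<in> tpow_rels H n" for r
    using r unfolding tpow_rels_def
  proof (elim UnE CollectE exE conjE)
    fix hs i a b
    assume *: "r = frag_of (hs[i := a + b]) - frag_of (hs[i := a]) - frag_of (hs[i := b])"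
      "length hs = n" "i < n"
    show ?thesis
      by (rule disjI2, rule bexI[of _ "hs[i := a + b]"], rule bexI[of _ "hs[i := a]"],
          rule bexI[of _ "hs[i := b]"], rule conjI[OF *(1) kmultilinearD(2)[OF f *(2,3)]])
        (simp_all add: tpow_gens_def *(2))
  next
    fix hs i j c
    assume *: "r = frag_of (hs[i := scale H c (hs ! i)]) - frag_of (hs[j := scale H c (hs ! j)])"
      "length hs = n" "i < n" "j < n"
    show ?thesis
      by (rule disjI1, rule bexI[of _ "hs[i := scale H c (hs ! i)]"],
        rule bexI[of _ "hs[j := scale H c (hs ! j)]"],
          rule conjI[OF *(1) kmultilinearD(3)[OF f *(2-4)]])
        (simp_all add: tpow_gens_def *(2))
  qed
  have clg: "f g \<in> carrier G" if "g \<in> tpow_gens n" for g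
    using that by (simp add: kmultilinearD(1)[OF f] tpow_gens_def)
  show "lift G f \<in> hom (tpow H n) G"
    unfolding tpow_def by (rule lift_presented_hom[OF G tpow_rels_subset clg rel])
  show "lift G f (ptens H hs) = f hs" if "length hs = n"
    unfolding ptens_def that
    by (rule lift_gen_class[OF G tpow_rels_subset clg rel]) (simp_all add: that tpow_gens_def)
qed

text \<open>Additivity in the outer argument is that of a \<open>lift\<close>, once multilinearity
  in \<open>hs\<close> is known for a fixed inner tensor \<open>T\<close>; this can be tested on
  pure \<open>T\<close>, where it is the hypothesis \<open>l\<close>. Additivity in \<open>T\<close>
  is then tested on pure outer tensors.\<close>

lemma lift_lift_tpow:
  assumes G: "comm_group G"
    and r: "\<And>hs. length hs = n \<Longrightarrow> kmultilinear H m G (F hs)"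
    and l: "\<And>gs. length gs = m \<Longrightarrow> kmultilinear H n G (\<lambda>hs. F hs gs)"
  shows lift_lift_ptens: "length hs = n \<Longrightarrow> length gs = m
      \<Longrightarrow> lift G (\<lambda>hs. lift G (F hs) (ptens H gs)) (ptens H hs) = F hs gs"
    and lift_lift_hom_left: "T \<in> carrier (tpow H m)
      \<Longrightarrow> (\<lambda>S. lift G (\<lambda>hs. lift G (F hs) T) S) \<in> hom (tpow H n) G"
    and lift_lift_hom_right: "S \<in> carrier (tpow H n)
      \<Longrightarrow> (\<lambda>T. lift G (\<lambda>hs. lift G (F hs) T) S) \<in> hom (tpow H m) G"
proof -
  interpret G: comm_group G by fact
  note inner = lift_tpow[OF G r]
  have inner_cl: "lift G (F hs) T \<in> carrier G" if "length hs = n" "T \<in> carrier (tpow H m)" for hs T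
    using inner(1)[OF that(1)] that(2) by (auto simp: hom_def)
  have kml: "kmultilinear H n G (\<lambda>hs. lift G (F hs) T)" if T: "T \<in> carrier (tpow H m)" for T
    unfolding kmultilinear_def
  proof (intro conjI allI impI; (elim conjE)?)
    fix hs :: "'c list" assume n: "length hs = n"
    show "lift G (F hs) T \<in> carrier G" by (rule inner_cl[OF n T])
    fix i assume i: "i < n"
    show "lift G (F (hs[i := a + b])) T = lift G (F (hs[i := a])) T
        \<boxplus>\<^bsub>G\<^esub> lift G (F (hs[i := b])) T" for a b
      by (rule tpow_hom_eqI[OF G.is_group inner(1) hom_add[OF G inner(1) inner(1)] _ T])
        (simp_all add: n i inner(2) kmultilinearD(2)[OF l])
    fix j c assume j: "j < n"
    show "lift G (F (hs[i := scale H c (hs ! i)])) T = lift G (F (hs[j := scale H c (hs ! j)])) T"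
      by (rule tpow_hom_eqI[OF G.is_group inner(1) inner(1) _ T])
        (simp_all add: n inner(2) kmultilinearD(3)[OF l n i j])
  qed
  show "lift G (\<lambda>hs. lift G (F hs) (ptens H gs)) (ptens H hs) = F hs gs"
    if "length hs = n" "length gs = m"
    using that lift_ptens[OF G kml[OF ptens_closed[OF that(2)]] that(1)] inner(2) by simp
  show left: "(\<lambda>S. lift G (\<lambda>hs. lift G (F hs) T) S) \<in> hom (tpow H n) G"
    if "T \<in> carrier (tpow H m)" for T
    using lift_tpow_hom[OF G kml[OF that]] .
  show "(\<lambda>T. lift G (\<lambda>hs. lift G (F hs) T) S) \<in> hom (tpow H m) G"
    if S: "S \<in> carrier (tpow H n)"
  proof (rule homI)
    interpret m: comm_group "tpow H m" by (rule comm_group_tpow)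
    fix T assume T: "T \<in> carrier (tpow H m)"
    show "lift G (\<lambda>hs. lift G (F hs) T) S \<in> carrier G"
      using left[OF T] S by (auto simp: hom_def)
    fix T' assume T': "T' \<in> carrier (tpow H m)"
    have TT': "T \<boxplus>\<^bsub>tpow H m\<^esub> T' \<in> carrier (tpow H m)" using T T' by simp
    show "lift G (\<lambda>hs. lift G (F hs) (T \<boxplus>\<^bsub>tpow H m\<^esub> T')) S
      = lift G (\<lambda>hs. lift G (F hs) T) S \<boxplus>\<^bsub>G\<^esub> lift G (\<lambda>hs. lift G (F hs) T') S"
      by (rule tpow_hom_eqI[OF G.is_group left[OF TT'] hom_add[OF G left[OF T] left[OF T']] _ S])
        (simp add: lift_ptens[OF G kml] T T' TT' hom_mult[OF inner(1)])
  qed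
qed

section \<open>Replacing one entry of a list by a list\<close>

definition subst_at :: "nat \<Rightarrow> 'a list \<Rightarrow> 'a list \<Rightarrow> 'a list" where
  "subst_at i fs us = take i fs @ us @ drop (Suc i) fs"

lemma length_subst_at: "i < length fs \<Longrightarrow> length (subst_at i fs us) = length fs + length us - 1"
  by (simp add: subst_at_def)

lemma subst_at_update_inner:
  assumes "i < length fs" "j < length us"
  shows "subst_at i fs (us[j := a]) = (subst_at i fs us)[i + j := a]"
    and "subst_at i fs us ! (i + j) = us ! j"
  using assms by (simp_all add: subst_at_def list_update_append nth_append)

lemma subst_at_update_same: "subst_at i (fs[i := a]) us = subst_at i fs us"
  by (simp add: subst_at_def)

lemma subst_at_update_less:
  assumes "i < length fs" "j < i"
  shows "subst_at i (fs[j := a]) us = (subst_at i fs us)[j := a]"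
    and "subst_at i fs us ! j = fs ! j"
  using assms by (simp_all add: subst_at_def list_update_append nth_append take_update_swap)

text \<open>The offset \<open>d\<close> avoids subtraction: the entry \<open>d\<close> places behind
  the successor of the gap sits at \<open>Suc (i + d)\<close> before the substitution and at
  \<open>i + (length us + d)\<close> after it, since one entry gives way to \<open>length us\<close>
  many.\<close>

lemma subst_at_update_greater:
  assumes "Suc (i + d) < length fs"
  shows "subst_at i (fs[Suc (i + d) := a]) us = (subst_at i fs us)[i + (length us + d) := a]"
    and "subst_at i fs us ! (i + (length us + d)) = fs ! Suc (i + d)"
  using assms
  by (simp_all add: subst_at_def list_update_append nth_append drop_update_swap min_def)

lemma map2_subst_at:
  assumes "length fs = length gs" "length us = length vs"
  shows "map2 f (subst_at i fs us) (subst_at i gs vs) = subst_at i (map2 f fs gs) (map2 f us vs)"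
  using assms by (simp add: subst_at_def take_map drop_map take_zip drop_zip)

lemma tpow_hom_eqI2:
  fixes H :: "('k::field, 'h::ring_1) hopf"
  assumes G: "group G"
    and h: "\<And>T. T \<in> carrier (tpow H m) \<Longrightarrow> (\<lambda>S. h S T) \<in> hom (tpow H n) G"
      "\<And>S. S \<in> carrier (tpow H n) \<Longrightarrow> h S \<in> hom (tpow H m) G"
    and h': "\<And>T. T \<in> carrier (tpow H m) \<Longrightarrow> (\<lambda>S. h' S T) \<in> hom (tpow H n) G"
      "\<And>S. S \<in> carrier (tpow H n) \<Longrightarrow> h' S \<in> hom (tpow H m) G"
    and eq: "\<And>fs gs. length fs = n \<Longrightarrow> length gs = m
      \<Longrightarrow> h (ptens H fs) (ptens H gs) = h' (ptens H fs) (ptens H gs)"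
    and S: "S \<in> carrier (tpow H n)" and T: "T \<in> carrier (tpow H m)"
  shows "h S T = h' S T"
proof (rule tpow_hom_eqI[OF G h(1)[OF T] h'(1)[OF T] _ S])
  fix fs :: "'h list" assume fs: "length fs = n"
  note p = ptens_closed[OF fs]
  show "h (ptens H fs) T = h' (ptens H fs) T"
    by (rule tpow_hom_eqI[OF G h(2)[OF p] h'(2)[OF p] eq[OF fs] T])
qed

lemma map2_mult_assoc:
  fixes xs ys zs :: "'a::semigroup_mult list"
  assumes "length xs = length ys" "length ys = length zs"
  shows "map2 (*) (map2 (*) xs ys) zs = map2 (*) xs (map2 (*) ys zs)"
  using assms by (intro nth_equalityI) (simp_all add: mult.assoc)

section \<open>The algebra structure of the tensor powers of H\<close>

locale coco_hopf =
  fixes H :: "('k::field, 'h::ring_1) hopf"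
  assumes coco: "cocommutative_hopf_algebra H"
begin

lemma bialgebra: "bialgebra_over_field H"
  using coco by (simp add: cocommutative_hopf_algebra_def hopf_algebra_def)

lemma algebra: "algebra_over_field H" and coalgebra: "coalgebra_over_field H"
  using bialgebra by (simp_all add: bialgebra_over_field_def)

lemma scale_right_distrib: "scale H c (a + b) = scale H c a + scale H c b"
  using algebra by (simp add: algebra_over_field_def vector_space.vector_space_assms(1))

lemma scale_left_commute: "scale H c (scale H d a) = scale H d (scale H c a)"
  using algebra
  by (simp add: algebra_over_field_def vector_space.vector_space_assms(3) mult.commute)

lemma scale_mult:
  "scale H c x * y = scale H c (x * y)" "x * scale H c y = scale H c (x * y)"
  using algebra by (simp_all add: algebra_over_field_def) metis+

lemma kmultilinear_tpow_scale:
  "kmultilinear H n (tpow H n) (\<lambda>hs. ptens H (hs[0 := scale H c (hs ! 0)]))"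
  unfolding kmultilinear_def
proof (intro conjI allI impI; (elim conjE)?)
  fix hs :: "'h list" assume n: "length hs = n"
  let ?s = "\<lambda>hs. hs[0 := scale H c (hs ! 0)]"
  show "ptens H (?s hs) \<in> carrier (tpow H n)"
    using n by (simp add: ptens_closed)
  have upd: "?s (hs[i := a]) = (?s hs)[i := if i = 0 then scale H c a else a]" if "i < n" for i a
    using that n by (cases "i = 0") (auto simp: list_update_swap)
  have nth: "?s hs ! i = (if i = 0 then scale H c (hs ! i) else hs ! i)" if "i < n" for i
    using that n by auto
  fix i assume i: "i < n"
  show "ptens H (?s (hs[i := a + b])) = ptens H (?s (hs[i := a]))
      \<boxplus>\<^bsub>tpow H n\<^esub> ptens H (?s (hs[i := b]))" for a b
    using n i unfolding upd[OF i]
    by (cases "i = 0") (simp_all add: scale_right_distrib kmultilinearD(2)[OF kmultilinear_ptens]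
        del: list_update_overwrite)
  fix j d assume j: "j < n"
  have *: "?s (hs[i := scale H d (hs ! i)]) = (?s hs)[i := scale H d (?s hs ! i)]" if "i < n" for i
    unfolding upd[OF that] nth[OF that] by (simp add: scale_left_commute)
  show "ptens H (?s (hs[i := scale H d (hs ! i)])) = ptens H (?s (hs[j := scale H d (hs ! j)]))"
    unfolding *[OF i] *[OF j] by (rule kmultilinearD(3)[OF kmultilinear_ptens _ i j]) (simp add: n)
qed

lemma tpow_scale_hom: "tpow_scale H n c \<in> hom (tpow H n) (tpow H n)"
  using lift_tpow_hom[OF comm_group_tpow kmultilinear_tpow_scale]
  unfolding tpow_scale_def[abs_def] .

text \<open>By definition the scalar is put into slot 0; balancing moves it into any slot
  \<open>i\<close>.\<close>

lemma tpow_scale_ptens: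
  assumes "length hs = n" "i < n"
  shows "tpow_scale H n c (ptens H hs) = ptens H (hs[i := scale H c (hs ! i)])"
  using lift_ptens[OF comm_group_tpow kmultilinear_tpow_scale, of hs n c] assms
    kmultilinearD(3)[OF kmultilinear_ptens, of hs n 0 i H c]
  unfolding tpow_scale_def by simp

text \<open>A tensor power as target has its own scalars, so the balancing condition on two slots
  reduces to homogeneity in each slot: both sides equal the scaled value.\<close>

lemma kmultilinear_tpowI:
  assumes "\<And>hs. length hs = n \<Longrightarrow> F hs \<in> carrier (tpow H N)"
    and "\<And>hs i a b. length hs = n \<Longrightarrow> i < n \<Longrightarrow>
      F (hs[i := a + b]) = F (hs[i := a]) \<boxplus>\<^bsub>tpow H N\<^esub> F (hs[i := b])"
    and "\<And>hs i c. length hs = n \<Longrightarrow> i < n \<Longrightarrow> F (hs[i := scale H c (hs ! i)]) = tpow_scale H N c (F hs)"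
  shows "kmultilinear H n (tpow H N) F"
  unfolding kmultilinear_def using assms by simp

lemma kmultilinear_map2_mult:
  assumes "length hs = n"
  shows "kmultilinear H n (tpow H n) (\<lambda>gs. ptens H (map2 (*) hs gs))"
    and "kmultilinear H n (tpow H n) (\<lambda>gs. ptens H (map2 (*) gs hs))"
  by (rule kmultilinear_tpowI;
      simp add: assms ptens_closed map2_list_update distrib_left distrib_right scale_mult
        kmultilinearD(2)[OF kmultilinear_ptens]
        tpow_scale_ptens)+

lemmas lift_lift_mult = lift_lift_tpow[OF comm_group_tpow kmultilinear_map2_mult]

lemma tpow_mult_ptens:
  "length hs = n \<Longrightarrow> length gs = n
    \<Longrightarrow> tpow_mult H n (ptens H hs) (ptens H gs) = ptens H (map2 (*) hs gs)"
  unfolding tpow_mult_def by (rule lift_lift_mult(1))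

lemma tpow_mult_hom_left: "T \<in> carrier (tpow H n) \<Longrightarrow> (\<lambda>S. tpow_mult H n S T)
    \<in> hom (tpow H n) (tpow H n)"
  unfolding tpow_mult_def by (rule lift_lift_mult(2))

lemma tpow_mult_hom_right: "S \<in> carrier (tpow H n) \<Longrightarrow> (\<lambda>T. tpow_mult H n S T)
    \<in> hom (tpow H n) (tpow H n)"
  unfolding tpow_mult_def by (rule lift_lift_mult(3))

lemma tpow_mult_closed:
  "S \<in> carrier (tpow H n) \<Longrightarrow> T \<in> carrier (tpow H n) \<Longrightarrow> tpow_mult H n S T \<in> carrier (tpow H n)"
  using tpow_mult_hom_right by (auto simp: hom_def)

lemma group_tpow: "group (tpow H n)"
  using comm_group_tpow by (rule comm_group.axioms(2))

text \<open>Reduction to pure tensors handles one variable at a time, hence the three stages for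
  \<open>U\<close>, \<open>T\<close> and \<open>S\<close>.\<close>

lemma tpow_mult_assoc:
  assumes S: "S \<in> carrier (tpow H n)" and T: "T \<in> carrier (tpow H n)"
      and U: "U \<in> carrier (tpow H n)"
  shows "tpow_mult H n (tpow_mult H n S T) U = tpow_mult H n S (tpow_mult H n T U)"
proof -
  note l = tpow_mult_hom_left and r = tpow_mult_hom_right and cl = tpow_mult_closed
      and p = ptens_closed
  have 1: "tpow_mult H n (tpow_mult H n (ptens H a) (ptens H b)) U
      = tpow_mult H n (ptens H a) (tpow_mult H n (ptens H b) U)"
    if "length a = n" "length b = n" for a b
    by (rule tpow_hom_eqI[OF group_tpow _ _ _ U, where h = "\<lambda>U. tpow_mult H n
      (tpow_mult H n (ptens H a) (ptens H b)) U"])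
      (auto intro!: r cl p hom_compose[OF r r, unfolded o_def] simp: that tpow_mult_ptens
          map2_mult_assoc)
  have 2: "tpow_mult H n (tpow_mult H n (ptens H a) T) U
      = tpow_mult H n (ptens H a) (tpow_mult H n T U)"
    if "length a = n" for a
    by (rule tpow_hom_eqI[OF group_tpow _ _ _ T, where h = "\<lambda>T. tpow_mult H n
      (tpow_mult H n (ptens H a) T) U"])
      (auto intro!: cl p U hom_compose[OF l r, unfolded o_def] hom_compose[OF r l, unfolded o_def]
          simp: that 1)
  show ?thesis
    by (rule tpow_hom_eqI[OF group_tpow _ _ _ S, where h = "\<lambda>S. tpow_mult H n (tpow_mult H n S T)
      U"])
      (auto intro!: l cl p U T hom_compose[OF l l, unfolded o_def] simp: 2)
qed

lemma tpow_mult_scale: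
  assumes S: "S \<in> carrier (tpow H n)" and T: "T \<in> carrier (tpow H n)" and n: "n > 0"
  shows "tpow_mult H n S (tpow_scale H n c T) = tpow_scale H n c (tpow_mult H n S T)"
  by (rule tpow_hom_eqI2[OF group_tpow
        tpow_mult_hom_left[OF hom_in_carrier[OF tpow_scale_hom]]
        hom_compose[OF tpow_scale_hom tpow_mult_hom_right, unfolded o_def]
        hom_compose[OF tpow_mult_hom_left tpow_scale_hom, unfolded o_def]
        hom_compose[OF tpow_mult_hom_right tpow_scale_hom, unfolded o_def] _ S T])
    (simp_all add: n tpow_mult_ptens tpow_scale_ptens[OF _ n] map2_list_update scale_mult)

section \<open>Replacing one tensor factor by a tensor\<close>

text \<open>Only the inserted tensor is extended linearly. The surrounding factors remain a list, as
  the factor at \<open>i\<close> still has to be read off to determine what is inserted.\<close>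

definition splice :: "nat \<Rightarrow> nat \<Rightarrow> nat \<Rightarrow> 'h list \<Rightarrow> 'h tpow \<Rightarrow> 'h tpow" where
  "splice n l i fs U = lift (tpow H (n + l - 1)) (\<lambda>us. ptens H (subst_at i fs us)) U"

text \<open>Common form of two operations: with \<theta> the comultiplication it is
  \<open>comul_at\<close>, and with \<theta> the right action on a tensor \<open>S\<close> it is
  \<open>insert_factors\<close>.\<close>

definition apply_at :: "nat \<Rightarrow> nat \<Rightarrow> nat \<Rightarrow> ('h \<Rightarrow> 'h tpow) \<Rightarrow> 'h tpow \<Rightarrow> 'h tpow" where
  "apply_at n l i \<theta> T = lift (tpow H (n + l - 1)) (\<lambda>fs. splice n l i fs (\<theta> (fs ! i))) T"

lemma kmultilinear_subst_at:
  assumes "length fs = n" "i < n"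
  shows "kmultilinear H l (tpow H (n + l - 1)) (\<lambda>us. ptens H (subst_at i fs us))"
proof (rule kmultilinear_tpowI)
  fix us :: "'h list" assume us: "length us = l"
  then have len: "length (subst_at i fs us) = n + l - 1"
    using assms by (simp add: length_subst_at)
  then show "ptens H (subst_at i fs us) \<in> carrier (tpow H (n + l - 1))"
    by (rule ptens_closed)
  fix j assume j: "j < l"
  have ij: "i + j < n + l - 1" using j assms by simp
  show "ptens H (subst_at i fs (us[j := a + b])) = ptens H (subst_at i fs (us[j := a]))
      \<boxplus>\<^bsub>tpow H (n + l - 1)\<^esub> ptens H (subst_at i fs (us[j := b]))" for a b
    using assms us j len ij
    by (simp add: subst_at_update_inner kmultilinearD(2)[OF kmultilinear_ptens])
  show "ptens H (subst_at i fs (us[j := scale H c (us ! j)])) =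
      tpow_scale H (n + l - 1) c (ptens H (subst_at i fs us))" for c
    using assms us j len ij by (simp add: subst_at_update_inner tpow_scale_ptens[of _ _ "i + j"])
qed

lemma splice_hom: "length fs = n \<Longrightarrow> i < n \<Longrightarrow> splice n l i fs \<in> hom (tpow H l) (tpow H (n + l - 1))"
  using lift_tpow_hom[OF comm_group_tpow kmultilinear_subst_at]
  unfolding splice_def[abs_def] .

lemma splice_ptens:
  "length fs = n \<Longrightarrow> i < n \<Longrightarrow> length us = l \<Longrightarrow> splice n l i fs (ptens H us)
      = ptens H (subst_at i fs us)"
  unfolding splice_def by (rule lift_ptens[OF comm_group_tpow kmultilinear_subst_at])

lemmas splice_closed = hom_in_carrier[OF splice_hom]

lemma splice_scale:
  assumes fs: "length fs = n" "i < n" and l: "l > 0" and U: "U \<in> carrier (tpow H l)"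
  shows "splice n l i fs (tpow_scale H l c U) = tpow_scale H (n + l - 1) c (splice n l i fs U)"
proof (rule tpow_hom_eqI[OF group_tpow _ _ _ U])
  show "(\<lambda>U. splice n l i fs (tpow_scale H l c U)) \<in> hom (tpow H l) (tpow H (n + l - 1))"
    using hom_compose[OF tpow_scale_hom splice_hom[OF fs]] by (simp add: o_def)
  show "(\<lambda>U. tpow_scale H (n + l - 1) c (splice n l i fs U)) \<in> hom (tpow H l) (tpow H (n + l - 1))"
    using hom_compose[OF splice_hom[OF fs] tpow_scale_hom] by (simp add: o_def)
  fix us :: "'h list" assume us: "length us = l"
  show "splice n l i fs (tpow_scale H l c (ptens H us))
      = tpow_scale H (n + l - 1) c (splice n l i fs (ptens H us))"
    using us fs l subst_at_update_inner[of i fs 0 us]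
      tpow_scale_ptens[of "subst_at i fs us" "n + l - 1" i c]
    by (simp add: splice_ptens tpow_scale_ptens[of us l 0] length_subst_at del: One_nat_def)
qed

lemma splice_mult:
  assumes fs: "length fs = n" "length gs = n" "i < n"
    and U: "U \<in> carrier (tpow H l)" and V: "V \<in> carrier (tpow H l)"
  shows "tpow_mult H (n + l - 1) (splice n l i fs U) (splice n l i gs V)
    = splice n l i (map2 (*) fs gs) (tpow_mult H l U V)"
proof -
  have fg: "length (map2 (*) fs gs) = n" using fs by simp
  note f = splice_hom[OF fs(1,3)] and g = splice_hom[OF fs(2,3)] and fg = splice_hom[OF fg fs(3)]
  show ?thesis
    by (rule tpow_hom_eqI2[OF group_tpow
          hom_compose[OF f tpow_mult_hom_left[OF hom_in_carrier[OF g]], unfolded o_def]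
          hom_compose[OF g tpow_mult_hom_right[OF hom_in_carrier[OF f]], unfolded o_def]
          hom_compose[OF tpow_mult_hom_left fg, unfolded o_def]
          hom_compose[OF tpow_mult_hom_right fg, unfolded o_def] _ U V])
      (use fs in \<open>simp_all add: splice_ptens tpow_mult_ptens length_subst_at map2_subst_at\<close>)
qed

definition klinear :: "nat \<Rightarrow> ('h \<Rightarrow> 'h tpow) \<Rightarrow> bool" where
  "klinear l \<theta> \<longleftrightarrow> (\<forall>h. \<theta> h \<in> carrier (tpow H l)) \<and>
     (\<forall>g h. \<theta> (g + h) = \<theta> g \<boxplus>\<^bsub>tpow H l\<^esub> \<theta> h) \<and>
     (\<forall>c h. \<theta> (scale H c h) = tpow_scale H l c (\<theta> h))"

text \<open>Slot \<open>i\<close> enters only through \<theta>, because splicing drops that entry;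
  every other slot \<open>j\<close> enters only through the spliced list. So linearity in slot
  \<open>i\<close> comes from \<theta>, and in slot \<open>j\<close> from the pure tensors.\<close>

lemma kmultilinear_splice:
  assumes i: "i < n" and l: "l > 0" and \<theta>: "klinear l \<theta>"
  shows "kmultilinear H n (tpow H (n + l - 1)) (\<lambda>fs. splice n l i fs (\<theta> (fs ! i)))"
proof (rule kmultilinear_tpowI)
  interpret N: comm_group "tpow H (n + l - 1)" by (rule comm_group_tpow)
  have \<theta>_closed: "\<theta> h \<in> carrier (tpow H l)" for h using \<theta> by (simp add: klinear_def)
  fix fs :: "'h list" assume fs: "length fs = n"
  show "splice n l i fs (\<theta> (fs ! i)) \<in> carrier (tpow H (n + l - 1))"
    by (rule splice_closed[OF fs i \<theta>_closed])
  have same: "splice n l i (fs[i := a]) = splice n l i fs" for a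
    by (simp add: splice_def[abs_def] subst_at_update_same)
  fix j assume j: "j < n"
  consider "j = i" | "j < i" | d where "j = Suc (i + d)"
    using less_iff_Suc_add linorder_neqE_nat by metis
  \<comment> \<open>The position \<open>p\<close> at which factor \<open>j\<close> reappears is
    \<open>j\<close> itself in front of the gap and \<open>i + (l + d)\<close> behind it. It does
    not depend on \<open>us\<close>, so the argument passes to arbitrary spliced tensors.\<close>
  then have *: "j \<noteq> i \<longrightarrow> (\<exists>p<n + l - 1. \<forall>us. length us = l \<longrightarrow>
      (\<forall>a. subst_at i (fs[j := a]) us = (subst_at i fs us)[p := a]) \<and> subst_at i fs us ! p
          = fs ! j)"
  proof cases
    case 2
    then show ?thesis using i l fs
      by (intro impI exI[of _ j]) (simp add: subst_at_update_less)
  next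
    case 3
    then show ?thesis using i l fs j
      by (intro impI exI[of _ "i + (l + d)"]) (auto simp: subst_at_update_greater)
  qed simp
  show "splice n l i (fs[j := a + b]) (\<theta> (fs[j := a + b] ! i))
    = splice n l i (fs[j := a]) (\<theta> (fs[j := a] ! i))
      \<boxplus>\<^bsub>tpow H (n + l - 1)\<^esub> splice n l i (fs[j := b]) (\<theta> (fs[j := b] ! i))" for a b
  proof (cases "j = i")
    case True
    then show ?thesis using fs i \<theta> \<theta>_closed
      by (simp add: same klinear_def hom_mult[OF splice_hom[OF fs i]])
  next
    case False
    with * obtain p where p: "p < n + l - 1"
      "\<And>us a. length us = l \<Longrightarrow> subst_at i (fs[j := a]) us = (subst_at i fs us)[p := a]" by blast
    have "splice n l i (fs[j := a + b]) U
      = splice n l i (fs[j := a]) U \<boxplus>\<^bsub>tpow H (n + l - 1)\<^esub> splice n l i (fs[j := b]) U"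
      if U: "U \<in> carrier (tpow H l)" for U
    proof (rule tpow_hom_eqI[OF group_tpow _ _ _ U])
      show "splice n l i (fs[j := a + b]) \<in> hom (tpow H l) (tpow H (n + l - 1))"
        by (rule splice_hom) (simp_all add: fs i)
      show "(\<lambda>U. splice n l i (fs[j := a]) U \<boxplus>\<^bsub>tpow H (n + l - 1)\<^esub> splice n l i (fs[j := b]) U)
          \<in> hom (tpow H l) (tpow H (n + l - 1))"
        by (intro hom_add comm_group_tpow splice_hom) (simp_all add: fs i)
    qed (use p(1) in \<open>simp add: fs i splice_ptens p(2) kmultilinearD(2)[OF kmultilinear_ptens]
          length_subst_at del: One_nat_def\<close>)
    then show ?thesis using False \<theta>_closed by simp
  qed
  show "splice n l i (fs[j := scale H c (fs ! j)]) (\<theta> (fs[j := scale H c (fs ! j)] ! i))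
    = tpow_scale H (n + l - 1) c (splice n l i fs (\<theta> (fs ! i)))" for c
  proof (cases "j = i")
    case True
    then show ?thesis using fs i l \<theta> \<theta>_closed
      by (simp add: same klinear_def splice_scale)
  next
    case False
    with * obtain p where p: "p < n + l - 1"
      "\<And>us a. length us = l \<Longrightarrow> subst_at i (fs[j := a]) us = (subst_at i fs us)[p := a]"
      "\<And>us. length us = l \<Longrightarrow> subst_at i fs us ! p = fs ! j" by blast
    have "splice n l i (fs[j := scale H c (fs ! j)]) U
        = tpow_scale H (n + l - 1) c (splice n l i fs U)"
      if U: "U \<in> carrier (tpow H l)" for U
    proof (rule tpow_hom_eqI[OF group_tpow _ _ _ U])
      show "splice n l i (fs[j := scale H c (fs ! j)]) \<in> hom (tpow H l) (tpow H (n + l - 1))"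
        by (rule splice_hom) (simp_all add: fs i)
      show "(\<lambda>U. tpow_scale H (n + l - 1) c (splice n l i fs U))
          \<in> hom (tpow H l) (tpow H (n + l - 1))"
        by (rule hom_compose[OF splice_hom tpow_scale_hom, unfolded o_def]) (simp_all add: fs i)
    qed (use p(1) in \<open>simp add: fs i splice_ptens p(2,3) tpow_scale_ptens[of _ _ p]
        length_subst_at del: One_nat_def\<close>)
    then show ?thesis using False \<theta>_closed by simp
  qed
qed

lemma apply_at_hom:
  assumes "i < n" "l > 0" "klinear l \<theta>"
  shows "apply_at n l i \<theta> \<in> hom (tpow H n) (tpow H (n + l - 1))"
  using lift_tpow_hom[OF comm_group_tpow kmultilinear_splice[OF assms]]
  unfolding apply_at_def[abs_def] .

lemma apply_at_ptens:
  assumes "i < n" "l > 0" "klinear l \<theta>" "length fs = n"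
  shows "apply_at n l i \<theta> (ptens H fs) = splice n l i fs (\<theta> (fs ! i))"
  unfolding apply_at_def by (rule lift_ptens[OF comm_group_tpow kmultilinear_splice[OF assms(1-3)]
      assms(4)])

lemmas apply_at_closed = hom_in_carrier[OF apply_at_hom]

lemma klinearD:
  assumes "klinear l \<theta>"
  shows "\<theta> h \<in> carrier (tpow H l)"
    and "\<theta> (g + h) = \<theta> g \<boxplus>\<^bsub>tpow H l\<^esub> \<theta> h"
    and "\<theta> (scale H c h) = tpow_scale H l c (\<theta> h)"
  using assms by (simp_all add: klinear_def)

text \<open>Three maps are allowed because the intended case is mixed: acting on \<open>S\<close> by
  \<open>g * h\<close> is acting by \<open>g\<close> and then multiplying by the coproduct of
  \<open>h\<close>, so \<theta> and \<theta>' become the action on \<open>S\<close> and \<theta>''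
  the comultiplication.\<close>

lemma apply_at_mult:
  assumes i: "i < n" and l: "l > 0"
    and \<theta>: "klinear l \<theta>" "klinear l \<theta>'" "klinear l \<theta>''"
    and mult: "\<And>g h. \<theta> (g * h) = tpow_mult H l (\<theta>' g) (\<theta>'' h)"
    and S: "S \<in> carrier (tpow H n)" and T: "T \<in> carrier (tpow H n)"
  shows "apply_at n l i \<theta> (tpow_mult H n S T)
    = tpow_mult H (n + l - 1) (apply_at n l i \<theta>' S) (apply_at n l i \<theta>'' T)"
proof -
  note h = apply_at_hom[OF i l \<theta>(1)] and h' = apply_at_hom[OF i l \<theta>(2)]
      and h'' = apply_at_hom[OF i l \<theta>(3)]
  show ?thesis
    by (rule tpow_hom_eqI2[OF group_tpow
          hom_compose[OF tpow_mult_hom_left h, unfolded o_def]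
          hom_compose[OF tpow_mult_hom_right h, unfolded o_def]
          hom_compose[OF h' tpow_mult_hom_left[OF hom_in_carrier[OF h'']], unfolded o_def]
          hom_compose[OF h'' tpow_mult_hom_right[OF hom_in_carrier[OF h']], unfolded o_def] _ S T])
      (simp_all add: i l \<theta> tpow_mult_ptens apply_at_ptens splice_mult klinearD(1)[OF \<theta>(2)]
        klinearD(1)[OF \<theta>(3)] mult del: One_nat_def)
qed

section \<open>Iterated comultiplication and the right action of H\<close>

lemma klinear_comul: "klinear 2 (comul H)"
  using coalgebra by (simp add: klinear_def coalgebra_over_field_def)

lemma comul_mult: "comul H (g * h) = tpow_mult H 2 (comul H g) (comul H h)"
  using bialgebra by (simp add: bialgebra_over_field_def)

lemma comul_at_eq: "comul_at H n i = apply_at n 2 i (comul H)"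
  by (rule ext) (simp add: comul_at_def apply_at_def splice_def subst_at_def)

lemma comul_at_hom: "i < n \<Longrightarrow> comul_at H n i \<in> hom (tpow H n) (tpow H (Suc n))"
  using apply_at_hom[OF _ _ klinear_comul, of i n] by (simp add: comul_at_eq)

lemma comul_at_mult:
  assumes "i < n" "S \<in> carrier (tpow H n)" "T \<in> carrier (tpow H n)"
  shows "comul_at H n i (tpow_mult H n S T) = tpow_mult H (Suc n) (comul_at H n i S)
      (comul_at H n i T)"
  using apply_at_mult[OF assms(1) _ klinear_comul klinear_comul klinear_comul comul_mult assms(2,3)]
  by (simp add: comul_at_eq)

lemma apply_at_scale:
  assumes i: "i < n" and l: "l > 0" and \<theta>: "klinear l \<theta>" and T: "T \<in> carrier (tpow H n)"
  shows "apply_at n l i \<theta> (tpow_scale H n c T) = tpow_scale H (n + l - 1) c (apply_at n l i \<theta> T)"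
proof (rule tpow_hom_eqI[OF group_tpow _ _ _ T])
  show "(\<lambda>T. apply_at n l i \<theta> (tpow_scale H n c T)) \<in> hom (tpow H n) (tpow H (n + l - 1))"
    by (intro hom_compose[OF tpow_scale_hom apply_at_hom, unfolded o_def] i l \<theta>)
  show "(\<lambda>T. tpow_scale H (n + l - 1) c (apply_at n l i \<theta> T)) \<in> hom (tpow H n) (tpow H (n + l - 1))"
    by (intro hom_compose[OF apply_at_hom tpow_scale_hom, unfolded o_def] i l \<theta>)
  fix hs :: "'h list" assume hs: "length hs = n"
  have same: "splice n l i (hs[i := a]) = splice n l i hs" for a
    by (simp add: splice_def[abs_def] subst_at_update_same)
  show "apply_at n l i \<theta> (tpow_scale H n c (ptens H hs))
      = tpow_scale H (n + l - 1) c (apply_at n l i \<theta> (ptens H hs))"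
    by (simp add: hs i l \<theta> tpow_scale_ptens[of _ _ i] apply_at_ptens same splice_scale
      klinearD[OF \<theta>])
qed

lemma klinear_iter_comul: "klinear (Suc r) (iter_comul H r)"
proof (induction r)
  case 0
  show ?case
    using kmultilinearD(2)[OF kmultilinear_ptens, of "[0]" 1 0 H]
    by (simp add: klinear_def ptens_closed tpow_scale_ptens[of _ _ 0])
next
  case (Suc r)
  have 0: "0 < Suc r" and 2: "(0::nat) < 2" by simp_all
  show ?case
    using apply_at_closed[OF 0 2 klinear_comul] hom_mult[OF apply_at_hom[OF 0 2 klinear_comul]]
      apply_at_scale[OF 0 2 klinear_comul] klinearD[OF Suc]
    by (simp add: klinear_def comul_at_eq)
qed

lemma iter_comul_mult: "iter_comul H r (g * h) = tpow_mult H (Suc r) (iter_comul H r g)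
    (iter_comul H r h)"
proof (induction r)
  case 0
  show ?case by (simp add: tpow_mult_ptens)
next
  case (Suc r)
  then show ?case
    by (simp add: comul_at_mult klinearD(1)[OF klinear_iter_comul])
qed

text \<open>\<open>iter_comul\<close> starts from the one-factor tensor of \<open>[h]\<close>;
  comultiplying there splices a tensor into a one-element list, which leaves that tensor as it
  is.\<close>

lemma iter_comul_1: "iter_comul H (Suc 0) h = comul H h"
proof -
  have hom: "splice 1 2 0 [h] \<in> hom (tpow H 2) (tpow H 2)"
    using splice_hom[of "[h]" 1 0 2] by (simp del: One_nat_def)
  have "splice 1 2 0 [h] U = U" if U: "U \<in> carrier (tpow H 2)" for U
    by (rule tpow_hom_eqI[OF group_tpow hom _ _ U, where h' = "\<lambda>U. U"])
      (simp_all add: splice_ptens subst_at_def hom_def del: One_nat_def)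
  then show ?thesis
    using klinearD(1)[OF klinear_comul]
    by (simp add: comul_at_eq apply_at_ptens klinear_comul)
qed

text \<open>Coassociativity enters here. By definition the iteration comultiplies factor 0; the
  second form, with factor 1, makes insertion into the second slot compatible with the right
  action.\<close>

lemma iter_comul_2:
  "iter_comul H 2 h = comul_at H 2 0 (comul H h)" "iter_comul H 2 h = comul_at H 2 1 (comul H h)"
proof -
  show "iter_comul H 2 h = comul_at H 2 0 (comul H h)"
    using iter_comul_1[of h] by (simp add: numeral_2_eq_2)
  then show "iter_comul H 2 h = comul_at H 2 1 (comul H h)"
    using coalgebra by (simp add: coalgebra_over_field_def)
qed

lemma iter_comul_closed: "n > 0 \<Longrightarrow> iter_comul H (n - 1) h \<in> carrier (tpow H n)"
  using klinearD(1)[OF klinear_iter_comul, of "n - 1" h] by simp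

lemma tpow_ract_hom: "n > 0 \<Longrightarrow> (\<lambda>S. tpow_ract H n S h) \<in> hom (tpow H n) (tpow H n)"
  unfolding tpow_ract_def by (rule tpow_mult_hom_left[OF iter_comul_closed])

lemmas tpow_ract_closed = hom_in_carrier[OF tpow_ract_hom]

lemma tpow_mult_ract:
  assumes "n > 0" "S \<in> carrier (tpow H n)" "T \<in> carrier (tpow H n)"
  shows "tpow_mult H n S (tpow_ract H n T h) = tpow_ract H n (tpow_mult H n S T) h"
  using assms by (simp add: tpow_ract_def tpow_mult_assoc iter_comul_closed del: One_nat_def)

text \<open>Both forms rest on the multiplicativity of the iterated coproduct. The first feeds
  \<open>apply_at_mult\<close>, the second says that the right action is an action.\<close>

lemma tpow_ract_mult:
  assumes "n > 0" "S \<in> carrier (tpow H n)"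
  shows "tpow_ract H n S (g * h) = tpow_mult H n (tpow_ract H n S g) (iter_comul H (n - 1) h)"
    and "tpow_ract H n S (g * h) = tpow_ract H n (tpow_ract H n S g) h"
  using assms iter_comul_mult[of "n - 1" g h]
  by (simp_all add: tpow_ract_def tpow_mult_assoc iter_comul_closed del: One_nat_def)

lemma klinear_tpow_ract:
  assumes "n > 0" "S \<in> carrier (tpow H n)"
  shows "klinear n (tpow_ract H n S)"
proof -
  have "klinear n (iter_comul H (n - 1))" using klinear_iter_comul[of "n - 1"] assms by simp
  then show ?thesis
    using assms unfolding klinear_def tpow_ract_def
    by (simp add: tpow_mult_closed tpow_mult_scale hom_mult[OF tpow_mult_hom_right])
qed

section \<open>Inserting a tensor into one of two factors\<close>

lemma insert_factors_eq: "insert_factors H k l m S = apply_at k l m (tpow_ract H l S)"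
  by (rule ext) (simp add: insert_factors_def apply_at_def splice_def subst_at_def)

context
  fixes m :: nat assumes m: "m < 2"
begin

text \<open>With \<open>k = l = 2\<close> the result has 2 + 2 - 1 = 3 factors. The slot
  \<open>m = 0\<close> belongs to \<open>[X * y]\<close>, the slot \<open>m = 1\<close> to
  \<open>[x * Y]\<close>.\<close>

lemma insert_factors_hom:
  "S \<in> carrier (tpow H 2) \<Longrightarrow> insert_factors H 2 2 m S \<in> hom (tpow H 2) (tpow H 3)"
  using apply_at_hom[OF m _ klinear_tpow_ract, of 2 S] by (simp add: insert_factors_eq)

lemmas insert_factors_closed = hom_in_carrier[OF insert_factors_hom]

text \<open>Additivity in \<open>S\<close> is not built into the outer \<open>lift\<close>, whose
  variable is \<open>T\<close>. On pure tensors \<open>T\<close> it is the additivity of the right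
  action followed by splicing.\<close>

lemma insert_factors_hom_left:
  assumes T: "T \<in> carrier (tpow H 2)"
  shows "(\<lambda>S. insert_factors H 2 2 m S T) \<in> hom (tpow H 2) (tpow H 3)"
proof (rule homI)
  fix S assume S: "S \<in> carrier (tpow H 2)"
  show "insert_factors H 2 2 m S T \<in> carrier (tpow H 3)"
    by (rule insert_factors_closed[OF S T])
  fix S' assume S': "S' \<in> carrier (tpow H 2)"
  interpret T2: comm_group "tpow H 2" by (rule comm_group_tpow)
  have SS': "S \<boxplus>\<^bsub>tpow H 2\<^esub> S' \<in> carrier (tpow H 2)" using S S' by simp
  show "insert_factors H 2 2 m (S \<boxplus>\<^bsub>tpow H 2\<^esub> S') T
    = insert_factors H 2 2 m S T \<boxplus>\<^bsub>tpow H 3\<^esub> insert_factors H 2 2 m S' T"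
  proof (rule tpow_hom_eqI[OF group_tpow insert_factors_hom[OF SS'] _ _ T])
    show "(\<lambda>T. insert_factors H 2 2 m S T \<boxplus>\<^bsub>tpow H 3\<^esub> insert_factors H 2 2 m S' T)
        \<in> hom (tpow H 2) (tpow H 3)"
      by (intro hom_add comm_group_tpow insert_factors_hom S S')
    fix hs :: "'h list" assume hs: "length hs = 2"
    show "insert_factors H 2 2 m (S \<boxplus>\<^bsub>tpow H 2\<^esub> S') (ptens H hs)
      = insert_factors H 2 2 m S (ptens H hs) \<boxplus>\<^bsub>tpow H 3\<^esub> insert_factors H 2 2 m S' (ptens H hs)"
      using hom_mult[OF splice_hom[OF hs m]] S S' SS'
      by (simp add: insert_factors_eq apply_at_ptens m klinear_tpow_ract hs
          hom_mult[OF tpow_ract_hom] tpow_ract_closed)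
  qed
qed

text \<open>Coassociativity makes both slots agree on the right.\<close>

lemma insert_factors_ract_right:
  assumes S: "S \<in> carrier (tpow H 2)" and T: "T \<in> carrier (tpow H 2)"
  shows "insert_factors H 2 2 m S (tpow_ract H 2 T h)
      = tpow_ract H 3 (insert_factors H 2 2 m S T) h"
proof -
  have "iter_comul H 2 h = comul_at H 2 m (comul H h)"
    using iter_comul_2[of h] m by (cases "m = 0") (auto simp: less_2_cases_iff)
  moreover have "apply_at 2 2 m (tpow_ract H 2 S) (tpow_mult H 2 T (comul H h))
    = tpow_mult H (2 + 2 - 1) (apply_at 2 2 m (tpow_ract H 2 S) T) (apply_at 2 2 m (comul H)
        (comul H h))"
    using tpow_ract_mult(1)[OF _ S]
    by (intro apply_at_mult m klinear_comul klinear_tpow_ract S T klinearD(1)[OF klinear_comul])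
      (simp_all add: iter_comul_1 del: iter_comul.simps)
  ultimately show ?thesis
    by (simp add: tpow_ract_def[of H 2 T] tpow_ract_def[of H 3] iter_comul_1 insert_factors_eq
        comul_at_eq del: iter_comul.simps)
qed

text \<open>For the factor \<open>f\<close> of \<open>T\<close> in slot \<open>m\<close>, both sides
  insert \<open>S\<close> acted on by \<open>h * f\<close>. This moves \<open>h\<close> from the
  inserted tensor to the outer one, as is needed for substituting a tensor over
  \<open>H\<close>.\<close>

lemma insert_factors_ract_left:
  assumes S: "S \<in> carrier (tpow H 2)" and T: "T \<in> carrier (tpow H 2)"
  shows "insert_factors H 2 2 m (tpow_ract H 2 S h) T
    = insert_factors H 2 2 m S (tpow_mult H 2 (ptens H ([1, 1][m := h])) T)"
proof -
  have Sh: "tpow_ract H 2 S h \<in> carrier (tpow H 2)" using S by (simp add: tpow_ract_closed)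
  have u: "length ([1, 1][m := h]) = 2" by (simp only: length_list_update) simp
  show ?thesis
  proof (rule tpow_hom_eqI[OF group_tpow insert_factors_hom[OF Sh] _ _ T])
    show "(\<lambda>T. insert_factors H 2 2 m S (tpow_mult H 2 (ptens H ([1, 1][m := h])) T))
        \<in> hom (tpow H 2) (tpow H 3)"
      by (intro hom_compose[OF tpow_mult_hom_right insert_factors_hom, unfolded o_def]
        ptens_closed u S)
    fix hs :: "'h list" assume hs: "length hs = 2"
    have mm: "map2 (*) ([1, 1][m := h]) hs = hs[m := h * hs ! m]"
    proof -
      obtain a b where "hs = [a, b]" using hs by (auto simp: length_Suc_conv numeral_2_eq_2)
      moreover have "m = 0 \<or> m = 1" using m by auto
      ultimately show ?thesis by auto
    qed
    have same: "splice 2 2 m (hs[m := a]) = splice 2 2 m hs" for a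
      by (simp add: splice_def[abs_def] subst_at_update_same)
    show "insert_factors H 2 2 m (tpow_ract H 2 S h) (ptens H hs)
      = insert_factors H 2 2 m S (tpow_mult H 2 (ptens H ([1, 1][m := h])) (ptens H hs))"
      using m by (simp add: tpow_mult_ptens u hs mm insert_factors_eq apply_at_ptens
          klinear_tpow_ract Sh S same
          tpow_ract_mult(2) del: list_update.simps)
  qed
qed

end

end

section \<open>Permutation of tensor factors\<close>

text \<open>Distinctness guarantees that the changed entry is used at position \<open>p\<close>
  only.\<close>

lemma map_nth_list_update:
  assumes "distinct is" "set is = {..<length hs}" "p < length is"
  shows "map ((!) (hs[is ! p := a])) is = (map ((!) hs) is)[p := a]"
proof -
  have "is ! q < length hs" if "q < length is" for q
    using assms(2) nth_mem[OF that] by blast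
  then show ?thesis
    using assms by (intro nth_equalityI) (auto simp: nth_list_update nth_eq_iff_index_eq)
qed

context coco_hopf begin

lemma kmultilinear_perm:
  assumes d: "distinct is" and s: "set is = {..<n}"
  shows "kmultilinear H n (tpow H n) (\<lambda>hs. ptens H (map ((!) hs) is))"
proof (rule kmultilinear_tpowI)
  have len: "length is = n" using distinct_card[OF d] s by simp
  fix hs :: "'h list" assume hs: "length hs = n"
  show "ptens H (map ((!) hs) is) \<in> carrier (tpow H n)"
    by (rule ptens_closed) (simp add: len)
  fix i assume "i < n"
  \<comment> \<open>\<open>p\<close> is the position into which factor \<open>i\<close> is
    moved.\<close>
  then obtain p where p: "p < n" "i = is ! p" using s len by (metis in_set_conv_nth lessThan_iff)
  note upd = map_nth_list_update[of "is" hs p, OF d, unfolded hs len, OF s p(1), folded p(2)]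
  show "ptens H (map ((!) (hs[i := a + b])) is)
    = ptens H (map ((!) (hs[i := a])) is) \<boxplus>\<^bsub>tpow H n\<^esub> ptens H (map ((!) (hs[i := b])) is)" for a b
    unfolding upd by (rule kmultilinearD(2)[OF kmultilinear_ptens]) (simp_all add: len p)
  show "ptens H (map ((!) (hs[i := scale H c (hs ! i)])) is)
    = tpow_scale H n c (ptens H (map ((!) hs) is))" for c
    unfolding upd using p len by (simp add: tpow_scale_ptens[of _ n p])
qed

lemma perm_tpow_hom:
  assumes "distinct is" "set is = {..<n}"
  shows "perm_tpow H is \<in> hom (tpow H n) (tpow H n)"
  using lift_tpow_hom[OF comm_group_tpow kmultilinear_perm[OF assms]] distinct_card[OF assms(1)]
      assms(2)
  unfolding perm_tpow_def[abs_def] by simp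

lemma perm_tpow_ptens:
  assumes "distinct is" "set is = {..<n}" "length hs = n"
  shows "perm_tpow H is (ptens H hs) = ptens H (map ((!) hs) is)"
  using lift_ptens[OF comm_group_tpow kmultilinear_perm[OF assms(1,2)] assms(3)]
    distinct_card[OF assms(1)] assms(2)
  unfolding perm_tpow_def by simp

lemma perm_tpow_mult:
  assumes "is": "distinct is" "set is = {..<n}"
    and S: "S \<in> carrier (tpow H n)" and T: "T \<in> carrier (tpow H n)"
  shows "perm_tpow H is (tpow_mult H n S T) = tpow_mult H n (perm_tpow H is S) (perm_tpow H is T)"
proof -
  note h = perm_tpow_hom[OF "is"]
  have len: "length is = n" using distinct_card[OF "is"(1)] "is"(2) by simp
  have nth: "is ! q < n" if "q < length is" for q
    using "is"(2) nth_mem[OF that] by blast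
  have map2: "map ((!) (map2 (*) fs gs)) is = map2 (*) (map ((!) fs) is) (map ((!) gs) is)"
    if "length fs = n" "length gs = n" for fs gs :: "'h list"
    using nth that by (intro nth_equalityI) auto
  show ?thesis
    by (rule tpow_hom_eqI2[OF group_tpow
          hom_compose[OF tpow_mult_hom_left h, unfolded o_def]
          hom_compose[OF tpow_mult_hom_right h, unfolded o_def]
          hom_compose[OF h tpow_mult_hom_left[OF hom_in_carrier[OF h]], unfolded o_def]
          hom_compose[OF h tpow_mult_hom_right[OF hom_in_carrier[OF h]], unfolded o_def] _ S T])
      (simp_all add: tpow_mult_ptens perm_tpow_ptens[OF "is"] len map2)
qed

lemma perm_swap: "distinct [1, 0, 2::nat]" "set [1, 0, 2] = {..<3::nat}"
  "distinct [1, 0::nat]" "set [1, 0] = {..<2::nat}"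
  by auto

text \<open>Cocommutativity enters here. The iterated coproduct comultiplies the first factor of the
  coproduct, so exchanging the first two of three factors acts inside that inner coproduct, which is
  symmetric.\<close>

lemma perm_tpow_iter_comul: "perm_tpow H [1, 0, 2] (iter_comul H 2 h) = iter_comul H 2 h"
proof -
  have cocomm: "perm_tpow H [1, 0] (comul H h) = comul H h" for h
    using coco by (simp add: cocommutative_hopf_algebra_def)
  \<comment> \<open>A tensor with two factors spliced in at position 0 occupies positions 0 and 1,
    exactly those that the permutation exchanges.\<close>
  have splice: "perm_tpow H [1, 0, 2] (splice 2 2 0 [a, b] U)
      = splice 2 2 0 [a, b] (perm_tpow H [1, 0] U)"
    if U: "U \<in> carrier (tpow H 2)" for a b U
  proof (rule tpow_hom_eqI[OF group_tpow _ _ _ U])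
    have hs: "splice 2 2 0 [a, b] \<in> hom (tpow H 2) (tpow H 3)"
      using splice_hom[of "[a, b]" 2 0 2] by simp
    show "(\<lambda>U. perm_tpow H [1, 0, 2] (splice 2 2 0 [a, b] U)) \<in> hom (tpow H 2) (tpow H 3)"
      by (rule hom_compose[OF hs perm_tpow_hom, unfolded o_def, OF perm_swap(1,2)])
    show "(\<lambda>U. splice 2 2 0 [a, b] (perm_tpow H [1, 0] U)) \<in> hom (tpow H 2) (tpow H 3)"
      by (rule hom_compose[OF perm_tpow_hom hs, unfolded o_def, OF perm_swap(3,4)])
    fix us :: "'h list" assume us: "length us = 2"
    then obtain c d where "us = [c, d]" by (auto simp: length_Suc_conv numeral_2_eq_2)
    then show "perm_tpow H [1, 0, 2] (splice 2 2 0 [a, b] (ptens H us))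
      = splice 2 2 0 [a, b] (perm_tpow H [1, 0] (ptens H us))"
      using perm_tpow_ptens[OF perm_swap(1,2), of "[c, d, b]"] perm_tpow_ptens[OF perm_swap(3,4),
          of "[c, d]"]
      by (simp add: splice_ptens subst_at_def)
  qed
  have "perm_tpow H [1, 0, 2] (comul_at H 2 0 U) = comul_at H 2 0 U"
      if U: "U \<in> carrier (tpow H 2)" for U
  proof (rule tpow_hom_eqI[OF group_tpow _ _ _ U])
    have h: "comul_at H 2 0 \<in> hom (tpow H 2) (tpow H 3)"
      using comul_at_hom[of 0 2] by simp
    then show "comul_at H 2 0 \<in> hom (tpow H 2) (tpow H 3)" .
    show "(\<lambda>U. perm_tpow H [1, 0, 2] (comul_at H 2 0 U)) \<in> hom (tpow H 2) (tpow H 3)"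
      by (rule hom_compose[OF h perm_tpow_hom, unfolded o_def, OF perm_swap(1,2)])
    fix us :: "'h list" assume us: "length us = 2"
    then obtain c d where "us = [c, d]" by (auto simp: length_Suc_conv numeral_2_eq_2)
    then show "perm_tpow H [1, 0, 2] (comul_at H 2 0 (ptens H us)) = comul_at H 2 0 (ptens H us)"
      using splice[OF klinearD(1)[OF klinear_comul], of c d c] cocomm[of c]
      by (simp add: comul_at_eq apply_at_ptens klinear_comul)
  qed
  then show ?thesis
    using klinearD(1)[OF klinear_comul] by (simp add: iter_comul_2(1) del: iter_comul.simps)
qed

text \<open>The exchange is multiplicative and fixes the iterated coproduct, so it commutes with
  multiplication by the latter. This is what lets it descend to tensors over
  \<open>H\<close>.\<close>

lemma perm_tpow_ract:
  assumes "S \<in> carrier (tpow H 3)"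
  shows "perm_tpow H [1, 0, 2] (tpow_ract H 3 S h) = tpow_ract H 3 (perm_tpow H [1, 0, 2] S) h"
proof -
  have ract: "tpow_ract H 3 T h = tpow_mult H 3 T (iter_comul H 2 h)" for T
    by (simp add: tpow_ract_def del: iter_comul.simps)
  have "iter_comul H 2 h \<in> carrier (tpow H 3)"
    using iter_comul_closed[of 3] by simp
  then show ?thesis
    by (simp only: ract perm_tpow_mult[OF perm_swap(1,2) assms] perm_tpow_iter_comul)
qed

end

section \<open>Modules tensored over H\<close>

text \<open>\<open>tens\<close> copies the operations of a presented group into a larger record, so
  the group property has to be carried from one record to the other.\<close>

lemma comm_group_cong:
  assumes "comm_group G" "carrier G' = carrier G" "monoid.mult G' = monoid.mult G" "one G' = one G"
  shows "comm_group G'"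
proof -
  interpret G: comm_group G by fact
  show ?thesis
  proof (rule comm_groupI)
    fix x assume "x \<in> carrier G'"
    then show "\<exists>y\<in>carrier G'. y \<boxplus>\<^bsub>G'\<^esub> x = \<one>\<^bsub>G'\<^esub>"
      using assms(2-4) G.l_inv_ex by auto
  qed (use assms(2-4) in \<open>simp_all add: G.m_ac\<close>)
qed

lemma left_moduleD:
  assumes "left_module M"
  shows "comm_group M"
    and "x \<in> carrier M \<Longrightarrow> act M h x \<in> carrier M"
    and "x \<in> carrier M \<Longrightarrow> y \<in> carrier M \<Longrightarrow> act M h (x \<boxplus>\<^bsub>M\<^esub> y) = act M h x \<boxplus>\<^bsub>M\<^esub> act M h y"
    and "x \<in> carrier M \<Longrightarrow> act M (g + h) x = act M g x \<boxplus>\<^bsub>M\<^esub> act M h x"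
    and "x \<in> carrier M \<Longrightarrow> act M (g * h) x = act M g (act M h x)"
    and "x \<in> carrier M \<Longrightarrow> act M 1 x = x"
  using assms unfolding left_module_def by blast+

lemma left_homD:
  assumes "left_hom M N f"
  shows "f \<in> hom M N"
    and "x \<in> carrier M \<Longrightarrow> f x \<in> carrier N"
    and "x \<in> carrier M \<Longrightarrow> y \<in> carrier M \<Longrightarrow> f (x \<boxplus>\<^bsub>M\<^esub> y) = f x \<boxplus>\<^bsub>N\<^esub> f y"
    and "x \<in> carrier M \<Longrightarrow> f (act M h x) = act N h (f x)"
  using assms unfolding left_hom_def by (auto simp: hom_def)

text \<open>Positivity of \<open>n\<close> ensures that the \<open>n - 1\<close> in
  \<open>tpow_ract\<close> yields an iterated coproduct with \<open>n\<close> factors.\<close>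

locale tensor_module = coco_hopf H for H :: "('k::field, 'h::ring_1) hopf" +
  fixes n :: nat and M :: "('h, 'm) lmod"
  assumes n: "n > 0" and M: "left_module M"
begin

sublocale M: comm_group M by (rule left_moduleD(1)[OF M])
sublocale T: comm_group "tpow H n" by (rule comm_group_tpow)

lemma tens_relsD:
  "S \<in> carrier (tpow H n) \<Longrightarrow> T \<in> carrier (tpow H n) \<Longrightarrow> x \<in> carrier M \<Longrightarrow>
    frag_of (S \<boxplus>\<^bsub>tpow H n\<^esub> T, x) - frag_of (S, x) - frag_of (T, x) \<in> tens_rels H n M"
  "S \<in> carrier (tpow H n) \<Longrightarrow> x \<in> carrier M \<Longrightarrow> y \<in> carrier M \<Longrightarrow>
    frag_of (S, x \<boxplus>\<^bsub>M\<^esub> y) - frag_of (S, x) - frag_of (S, y) \<in> tens_rels H n M"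
  "S \<in> carrier (tpow H n) \<Longrightarrow> x \<in> carrier M \<Longrightarrow>
    frag_of (tpow_ract H n S h, x) - frag_of (S, act M h x) \<in> tens_rels H n M"
  unfolding tens_rels_def mem_Collect_eq Un_iff by metis+

lemma tens_relsE:
  assumes "r \<in> tens_rels H n M"
  obtains (left) S T x where "S \<in> carrier (tpow H n)" "T \<in> carrier (tpow H n)" "x \<in> carrier M"
    "r = frag_of (S \<boxplus>\<^bsub>tpow H n\<^esub> T, x) - frag_of (S, x) - frag_of (T, x)"
  | (right) S x y where "S \<in> carrier (tpow H n)" "x \<in> carrier M" "y \<in> carrier M"
    "r = frag_of (S, x \<boxplus>\<^bsub>M\<^esub> y) - frag_of (S, x) - frag_of (S, y)"
  | (balanced) S h x where "S \<in> carrier (tpow H n)" "x \<in> carrier M"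
    "r = frag_of (tpow_ract H n S h, x) - frag_of (S, act M h x)"
  using assms unfolding tens_rels_def mem_Collect_eq Un_iff by metis

lemma gens: "(S, x) \<in> tens_gens H n M \<longleftrightarrow> S \<in> carrier (tpow H n) \<and> x \<in> carrier M"
  by (simp add: tens_gens_def)

lemma tens_rels_subset: "tens_rels H n M \<subseteq> carrier (free_Abelian_group (tens_gens H n M))"
proof
  fix r assume "r \<in> tens_rels H n M"
  then show "r \<in> carrier (free_Abelian_group (tens_gens H n M))"
    by (cases rule: tens_relsE)
      (simp_all only: , (intro minus_closed_free_Abelian_group;
        simp add: gens tpow_ract_closed n left_moduleD(2)[OF M])+)
qed

lemma tens_simps:
  "carrier (tens H n M) = carrier (presented (tens_gens H n M) (tens_rels H n M))"
  "monoid.mult (tens H n M) = monoid.mult (presented (tens_gens H n M) (tens_rels H n M))"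
  "one (tens H n M) = one (presented (tens_gens H n M) (tens_rels H n M))"
  by (simp_all add: tens_def tens_group_def)

lemma hom_tens: "hom (tens H n M) G = hom (presented (tens_gens H n M) (tens_rels H n M)) G"
  by (simp add: hom_def tens_simps)

lemma comm_group_module: "comm_group (tens H n M)"
  by (rule comm_group_cong[OF comm_group_presented[OF tens_rels_subset]]) (simp_all add: tens_simps)

sublocale comm_group "tens H n M" by (rule comm_group_module)

lemma elt_closed: "S \<in> carrier (tpow H n) \<Longrightarrow> x \<in> carrier M
    \<Longrightarrow> tens_elt H n M S x \<in> carrier (tens H n M)"
  unfolding tens_elt_def tens_simps by (rule gen_class_closed) (simp add: gens)

lemma tens_elt_add_left:
  assumes "S \<in> carrier (tpow H n)" "T \<in> carrier (tpow H n)" "x \<in> carrier M"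
  shows "tens_elt H n M (S \<boxplus>\<^bsub>tpow H n\<^esub> T) x = tens_elt H n M S x \<boxplus>\<^bsub>tens H n M\<^esub> tens_elt H n M T x"
  unfolding tens_elt_def tens_simps
  by (rule gen_class_addI[OF tens_rels_subset tens_relsD(1)[OF assms]]) (simp_all add: gens assms)

lemma tens_elt_add_right:
  assumes "S \<in> carrier (tpow H n)" "x \<in> carrier M" "y \<in> carrier M"
  shows "tens_elt H n M S (x \<boxplus>\<^bsub>M\<^esub> y) = tens_elt H n M S x \<boxplus>\<^bsub>tens H n M\<^esub> tens_elt H n M S y"
  unfolding tens_elt_def tens_simps
  by (rule gen_class_addI[OF tens_rels_subset tens_relsD(2)[OF assms]]) (simp_all add: gens assms)

lemma tens_elt_ract:
  assumes "S \<in> carrier (tpow H n)" "x \<in> carrier M"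
  shows "tens_elt H n M (tpow_ract H n S h) x = tens_elt H n M S (act M h x)"
  unfolding tens_elt_def
  by (rule gen_class_eqI[OF tens_rels_subset tens_relsD(3)[OF assms]])
    (simp_all add: gens assms tpow_ract_closed n left_moduleD(2)[OF M])

lemma hom_eqI:
  assumes "group G" "h \<in> hom (tens H n M) G" "h' \<in> hom (tens H n M) G"
    and "\<And>S x. S \<in> carrier (tpow H n) \<Longrightarrow> x \<in> carrier M
      \<Longrightarrow> h (tens_elt H n M S x) = h' (tens_elt H n M S x)"
    and "X \<in> carrier (tens H n M)"
  shows "h X = h' X"
  by (rule presented_hom_eqI[OF tens_rels_subset assms(1) assms(2,3)[unfolded hom_tens] _
        assms(5)[unfolded tens_simps]])
    (use assms(4) in \<open>auto simp: tens_elt_def tens_gens_def\<close>)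

definition balanced :: "('b, 'c) monoid_scheme \<Rightarrow> ('h tpow \<Rightarrow> 'm \<Rightarrow> 'b) \<Rightarrow> bool" where
  "balanced G f \<longleftrightarrow>
     (\<forall>S \<in> carrier (tpow H n). f S \<in> hom M G) \<and>
     (\<forall>x \<in> carrier M. (\<lambda>S. f S x) \<in> hom (tpow H n) G) \<and>
     (\<forall>S \<in> carrier (tpow H n). \<forall>x \<in> carrier M. \<forall>h. f (tpow_ract H n S h) x = f S (act M h x))"

text \<open>Universal property of the tensor product over \<open>H\<close>; the three kinds of
  relators correspond to additivity in either argument and to balancing over
  \<open>H\<close>.\<close>

lemma lift_tens:
  assumes G: "comm_group G" and f: "balanced G f"
  shows lift_tens_hom: "lift G (\<lambda>(S, x). f S x) \<in> hom (tens H n M) G"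
    and lift_tens_elt: "S \<in> carrier (tpow H n) \<Longrightarrow> x \<in> carrier M
      \<Longrightarrow> lift G (\<lambda>(S, x). f S x) (tens_elt H n M S x) = f S x"
proof -
  interpret G: comm_group G by fact
  let ?X = "tens_gens H n M" and ?f = "\<lambda>(S, x). f S x"
  have cl: "f S x \<in> carrier G" if "S \<in> carrier (tpow H n)" "x \<in> carrier M" for S x
    using f that by (auto simp: balanced_def hom_def)
  have add_left: "f (S \<boxplus>\<^bsub>tpow H n\<^esub> T) x = f S x \<boxplus>\<^bsub>G\<^esub> f T x"
    if "S \<in> carrier (tpow H n)" "T \<in> carrier (tpow H n)" "x \<in> carrier M" for S T x
    using f that by (auto simp: balanced_def hom_def)
  have add_right: "f S (x \<boxplus>\<^bsub>M\<^esub> y) = f S x \<boxplus>\<^bsub>G\<^esub> f S y"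
    if "S \<in> carrier (tpow H n)" "x \<in> carrier M" "y \<in> carrier M" for S x y
    using f that by (auto simp: balanced_def hom_def)
  have bal: "f (tpow_ract H n S h) x = f S (act M h x)"
    if "S \<in> carrier (tpow H n)" "x \<in> carrier M" for S x h
    using f that by (auto simp: balanced_def)
  have clg: "?f g \<in> carrier G" if "g \<in> ?X" for g
    using that cl by (auto simp: tens_gens_def)
  have rel: "(\<exists>a\<in>?X. \<exists>b\<in>?X. r = frag_of a - frag_of b \<and> ?f a = ?f b) \<or>
      (\<exists>a\<in>?X. \<exists>b\<in>?X. \<exists>c\<in>?X. r = frag_of a - frag_of b - frag_of c \<and> ?f a = ?f b \<boxplus>\<^bsub>G\<^esub> ?f c)"
    if r: "r \<in> tens_rels H n M" for r
    using r
  proof (cases rule: tens_relsE)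
    case (left S T x)
    show ?thesis
      by (rule disjI2, rule bexI[of _ "(S \<boxplus>\<^bsub>tpow H n\<^esub> T, x)"], rule bexI[of _ "(S, x)"],
          rule bexI[of _ "(T, x)"], rule conjI[OF left(4)])
        (simp_all add: gens add_left left(1-3))
  next
    case (right S x y)
    show ?thesis
      by (rule disjI2, rule bexI[of _ "(S, x \<boxplus>\<^bsub>M\<^esub> y)"], rule bexI[of _ "(S, x)"],
          rule bexI[of _ "(S, y)"], rule conjI[OF right(4)])
        (simp_all add: gens add_right right(1-3))
  next
    case (balanced S h x)
    show ?thesis
      by (rule disjI1, rule bexI[of _ "(tpow_ract H n S h, x)"], rule bexI[of _ "(S, act M h x)"],
          rule conjI[OF balanced(3)])
        (simp_all add: gens bal left_moduleD(2)[OF M] tpow_ract_closed n balanced(1,2))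
  qed
  show "lift G ?f \<in> hom (tens H n M) G"
    unfolding hom_tens by (rule lift_presented_hom[OF G tens_rels_subset clg rel])
  show "lift G ?f (tens_elt H n M S x) = f S x" if "S \<in> carrier (tpow H n)" "x \<in> carrier M"
    unfolding tens_elt_def
    by (subst lift_gen_class[OF G tens_rels_subset clg rel]) (simp_all add: that gens)
qed

end

section \<open>Functoriality of tensoring over H\<close>

context coco_hopf begin

lemma tensor_moduleI: "n > 0 \<Longrightarrow> left_module M \<Longrightarrow> tensor_module H n M"
  by unfold_locales

lemmas tens_hom_eqI = tensor_module.hom_eqI[OF tensor_moduleI]
  and tens_elt_closed = tensor_module.elt_closed[OF tensor_moduleI]
  and comm_group_tens = tensor_module.comm_group_module[OF tensor_moduleI]

lemma group_tens: "n > 0 \<Longrightarrow> left_module M \<Longrightarrow> group (tens H n M)"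
  by (rule comm_group.axioms(2)[OF comm_group_tens])

lemma tens_elt_hom:
  assumes "n > 0" "left_module M"
  shows tens_elt_hom_left: "x \<in> carrier M \<Longrightarrow> (\<lambda>S. tens_elt H n M S x)
      \<in> hom (tpow H n) (tens H n M)" (is "PROP ?A")
    and tens_elt_hom_right: "S \<in> carrier (tpow H n)
        \<Longrightarrow> tens_elt H n M S \<in> hom M (tens H n M)" (is "PROP ?B")
proof -
  interpret tensor_module H n M using assms by (rule tensor_moduleI)
  show "PROP ?A"
    by (simp add: hom_def tens_elt_add_left elt_closed)
  show "PROP ?B"
    by (simp add: hom_def tens_elt_add_right elt_closed)
qed

lemma tens_map:
  assumes n: "n > 0" and M: "left_module M" and N: "left_module N" and f: "left_hom M N f"
  shows tens_map_hom: "tens_map H n N f \<in> hom (tens H n M) (tens H n N)" (is "PROP ?A")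
    and tens_map_elt: "S \<in> carrier (tpow H n) \<Longrightarrow> x \<in> carrier M
      \<Longrightarrow> tens_map H n N f (tens_elt H n M S x) = tens_elt H n N S (f x)" (is "PROP ?B")
proof -
  interpret M: tensor_module H n M using n M by (rule tensor_moduleI)
  interpret N: tensor_module H n N using n N by (rule tensor_moduleI)
  have "M.balanced (tens H n N) (\<lambda>S x. tens_elt H n N S (f x))"
    unfolding M.balanced_def
    using tens_elt_hom_left[OF n N] hom_compose[OF left_homD(1)[OF f] tens_elt_hom_right[OF n N],
        unfolded o_def]
    by (simp add: left_homD[OF f] N.tens_elt_ract)
  note * = M.lift_tens[OF N.comm_group_module this]
  show "PROP ?A"
    unfolding tens_map_def by (rule *(1))
  show "PROP ?B"
    unfolding tens_map_def by (rule *(2))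
qed

lemmas tens_map_closed = hom_in_carrier[OF tens_map_hom]

lemma left_hom_compose:
  assumes "left_hom L M f" "left_hom M N g"
  shows "left_hom L N (\<lambda>x. g (f x))"
  unfolding left_hom_def
  using hom_compose[OF left_homD(1)[OF assms(1)] left_homD(1)[OF assms(2)]]
  by (simp add: o_def left_homD(2,4)[OF assms(1)] left_homD(4)[OF assms(2)])

text \<open>Components of identity and composite morphisms are restricted to carriers. Congruence
  lemmas of this kind replace them by unrestricted functions.\<close>

lemma left_hom_cong:
  assumes "left_hom M N f" "\<And>x. x \<in> carrier M \<Longrightarrow> f' x = f x" "left_module M"
  shows "left_hom M N f'"
proof -
  interpret M: comm_group M by (rule left_moduleD(1)[OF assms(3)])
  show ?thesis
    using assms left_moduleD(2)[OF assms(3)] by (simp add: left_hom_def hom_def Pi_iff)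
qed

lemma tens_map_cong:
  assumes n: "n > 0" and M: "left_module M" and N: "left_module N" and f: "left_hom M N f"
    and eq: "\<And>x. x \<in> carrier M \<Longrightarrow> f' x = f x" and X: "X \<in> carrier (tens H n M)"
  shows "tens_map H n N f' X = tens_map H n N f X"
  by (rule tens_hom_eqI[OF n M group_tens[OF n N] tens_map_hom[OF n M N left_hom_cong[OF f eq M]]
        tens_map_hom[OF n M N f] _ X])
    (simp_all add: tens_map_elt[OF n M N f] tens_map_elt[OF n M N left_hom_cong[OF f eq M]] eq)

lemma tens_map_compose:
  assumes n: "n > 0" and L: "left_module L" and M: "left_module M" and N: "left_module N"
    and f: "left_hom L M f" and g: "left_hom M N g" and X: "X \<in> carrier (tens H n L)"
  shows "tens_map H n N g (tens_map H n M f X) = tens_map H n N (\<lambda>x. g (f x)) X"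
  by (rule tens_hom_eqI[OF n L group_tens[OF n N]
        hom_compose[OF tens_map_hom[OF n L M f] tens_map_hom[OF n M N g], unfolded o_def]
        tens_map_hom[OF n L N left_hom_compose[OF f g]] _ X])
    (simp add: tens_map_elt[OF n L M f] tens_map_elt[OF n M N g]
      tens_map_elt[OF n L N left_hom_compose[OF f g]] left_homD(2)[OF f])

lemma tens_map_ident:
  assumes n: "n > 0" and M: "left_module M" and f: "\<And>x. x \<in> carrier M \<Longrightarrow> f x = x"
    and X: "X \<in> carrier (tens H n M)"
  shows "tens_map H n M f X = X"
proof -
  interpret M: comm_group M by (rule left_moduleD(1)[OF M])
  have h: "left_hom M M f"
    using f left_moduleD(2)[OF M] by (simp add: left_hom_def hom_def)
  show ?thesis
    by (rule tens_hom_eqI[OF n M group_tens[OF n M] tens_map_hom[OF n M M h] _ _ X])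
      (simp_all add: hom_def tens_map_elt[OF n M M h] f)
qed

text \<open>Transports a pointwise sum of linear maps through the tensor product. It carries the
  equation between composable pairs, and the formula for their composite, to the tensored
  modules.\<close>

lemma tens_map_add:
  assumes n: "n > 0" and M: "left_module M" and N: "left_module N"
    and f: "left_hom M N f" and g: "left_hom M N g" and h: "left_hom M N h"
    and eq: "\<And>x. x \<in> carrier M \<Longrightarrow> h x = f x \<boxplus>\<^bsub>N\<^esub> g x" and X: "X \<in> carrier (tens H n M)"
  shows "tens_map H n N h X = tens_map H n N f X \<boxplus>\<^bsub>tens H n N\<^esub> tens_map H n N g X"
  by (rule tens_hom_eqI[OF n M group_tens[OF n N] tens_map_hom[OF n M N h]
        hom_add[OF comm_group_tens[OF n N] tens_map_hom[OF n M N f] tens_map_hom[OF n M N g]] _ X])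
    (simp add: tens_map_elt[OF n M N] f g h eq hom_mult[OF tens_elt_hom_right[OF n N]]
        left_homD(2)[OF f]
      left_homD(2)[OF g])

lemma tens_act:
  assumes n: "n > 0" and M: "left_module M" and S: "S \<in> carrier (tpow H n)"
  shows tens_act_hom: "act (tens H n M) S \<in> hom (tens H n M) (tens H n M)" (is "PROP ?A")
    and tens_act_elt: "T \<in> carrier (tpow H n) \<Longrightarrow> x \<in> carrier M
      \<Longrightarrow> act (tens H n M) S (tens_elt H n M T x) = tens_elt H n M (tpow_mult H n S T)
          x" (is "PROP ?B")
proof -
  interpret M: tensor_module H n M using n M by (rule tensor_moduleI)
  \<comment> \<open>The action is defined as a lift into \<open>tens_group\<close>, the underlying
    group of \<open>tens\<close> without the action; the universal property has to be applied to
    that record.\<close>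
  have G: "comm_group (tens_group H n M)"
    by (rule comm_group_cong[OF M.comm_group_module]) (simp_all add: tens_def)
  have hom_group: "hom K (tens_group H n M) = hom K (tens H n M)" for K :: "('z, 'y) monoid_scheme"
    by (simp add: hom_def tens_def)
  have "M.balanced (tens_group H n M) (\<lambda>T x. tens_elt H n M (tpow_mult H n S T) x)"
    unfolding M.balanced_def hom_group
    using tens_elt_hom_right[OF n M] hom_compose[OF tpow_mult_hom_right[OF S]
        tens_elt_hom_left[OF n M], unfolded o_def]
    by (simp add: tpow_mult_closed S tpow_mult_ract n M.tens_elt_ract)
  note * = M.lift_tens[OF G this]
  show "PROP ?A"
    using *(1) unfolding hom_group by (simp add: tens_def)
  show "PROP ?B"
    using *(2)[of T x] by (simp add: tens_def)
qed

lemma tens_map_act: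
  assumes n: "n > 0" and M: "left_module M" and N: "left_module N" and f: "left_hom M N f"
    and S: "S \<in> carrier (tpow H n)" and X: "X \<in> carrier (tens H n M)"
  shows "tens_map H n N f (act (tens H n M) S X) = act (tens H n N) S (tens_map H n N f X)"
  by (rule tens_hom_eqI[OF n M group_tens[OF n N]
        hom_compose[OF tens_act_hom[OF n M S] tens_map_hom[OF n M N f], unfolded o_def]
        hom_compose[OF tens_map_hom[OF n M N f] tens_act_hom[OF n N S], unfolded o_def] _ X])
    (simp add: tens_act_elt[OF n M S] tens_act_elt[OF n N S] tens_map_elt[OF n M N f]
      tpow_mult_closed S left_homD(2)[OF f])

text \<open>The exchange of the first two of three factors restores the order x, y, z in a term
  formed in the order y, x, z. Its balancing over \<open>H\<close> is
  \<open>perm_tpow_ract\<close>.\<close>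

lemma perm_tens:
  assumes M: "left_module M"
  shows perm_tens_hom: "perm_tens H M [1, 0, 2] \<in> hom (tens H 3 M) (tens H 3 M)" (is "PROP ?A")
    and perm_tens_elt: "S \<in> carrier (tpow H 3) \<Longrightarrow> x \<in> carrier M
      \<Longrightarrow> perm_tens H M [1, 0, 2] (tens_elt H 3 M S x)
          = tens_elt H 3 M (perm_tpow H [1, 0, 2] S) x" (is "PROP ?B")
proof -
  have n: "(3::nat) > 0" by simp
  interpret M: tensor_module H 3 M using n M by (rule tensor_moduleI)
  note p = perm_tpow_hom[OF perm_swap(1,2)]
  have "M.balanced (tens H 3 M) (\<lambda>S x. tens_elt H 3 M (perm_tpow H [1, 0, 2] S) x)"
    unfolding M.balanced_def
    using tens_elt_hom_right[OF n M] hom_compose[OF p tens_elt_hom_left[OF n M], unfolded o_def]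
    by (simp add: hom_in_carrier[OF p] perm_tpow_ract M.tens_elt_ract del: One_nat_def)
  note * = M.lift_tens[OF M.comm_group_module this]
  have len: "length [1, 0, 2::nat] = 3" by simp
  show "PROP ?A"
    using *(1) unfolding perm_tens_def[abs_def] len .
  show "PROP ?B"
    using *(2)[of S x] unfolding perm_tens_def len .
qed

lemma tens_map_perm_tens:
  assumes M: "left_module M" and N: "left_module N" and f: "left_hom M N f"
    and X: "X \<in> carrier (tens H 3 M)"
  shows "tens_map H 3 N f (perm_tens H M [1, 0, 2] X)
      = perm_tens H N [1, 0, 2] (tens_map H 3 N f X)"
proof -
  have n: "(3::nat) > 0" by simp
  show ?thesis
    by (rule tens_hom_eqI[OF n M group_tens[OF n N]
        hom_compose[OF perm_tens_hom[OF M] tens_map_hom[OF n M N f], unfolded o_def]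
        hom_compose[OF tens_map_hom[OF n M N f] perm_tens_hom[OF N], unfolded o_def] _ X])
      (simp add: perm_tens_elt[OF M] perm_tens_elt[OF N] tens_map_elt[OF n M N f] left_homD(2)[OF f]
        hom_in_carrier[OF perm_tpow_hom[OF perm_swap(1,2)]] del: One_nat_def)
qed

section \<open>Substitution into one argument of a bilinear map\<close>

text \<open>A bilinear map with one argument frozen: \<open>H\<close> acts on the free argument
  through factor \<open>m\<close>, while the other factor receives 1.\<close>

definition slot_linear ::
  "nat \<Rightarrow> ('h, 'l) lmod \<Rightarrow> ('h, 'm) lmod \<Rightarrow> ('l \<Rightarrow> ('h, 'm) tens) \<Rightarrow> bool" where
  "slot_linear m L M \<phi> \<longleftrightarrow> \<phi> \<in> hom L (tens H 2 M) \<and>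
     (\<forall>h. \<forall>e \<in> carrier L. \<phi> (act L h e) = act (tens H 2 M) (ptens H ([1, 1][m := h])) (\<phi> e))"

lemma slot_linearD:
  assumes "slot_linear m L M \<phi>"
  shows "\<phi> \<in> hom L (tens H 2 M)"
    and "e \<in> carrier L \<Longrightarrow> \<phi> e \<in> carrier (tens H 2 M)"
    and "e \<in> carrier L \<Longrightarrow> \<phi> (act L h e) = act (tens H 2 M) (ptens H ([1, 1][m := h])) (\<phi> e)"
  using assms hom_in_carrier unfolding slot_linear_def by metis+

lemma pos2: "(2::nat) > 0" and pos3: "(3::nat) > 0"
  by simp_all

lemma ptens_slot: "ptens H ([1, 1][m := h]) \<in> carrier (tpow H 2)"
  by (rule ptens_closed) (simp only: length_list_update, simp)

lemma slot_linear_tens_map: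
  assumes "left_module M" "left_module N" "left_hom M N f" "slot_linear m L M \<phi>"
  shows "slot_linear m L N (\<lambda>e. tens_map H 2 N f (\<phi> e))"
  unfolding slot_linear_def
  using hom_compose[OF slot_linearD(1)[OF assms(4)] tens_map_hom[OF pos2 assms(1-3)]]
  by (simp add: o_def slot_linearD[OF assms(4)] tens_map_act[OF pos2 assms(1-3)] ptens_slot
      del: list_update.simps)

lemma slot_linear_compose:
  assumes "left_hom K L f" "slot_linear m L M \<phi>"
  shows "slot_linear m K M (\<lambda>e. \<phi> (f e))"
  unfolding slot_linear_def
  using hom_compose[OF left_homD(1)[OF assms(1)] slot_linearD(1)[OF assms(2)]]
  by (simp add: o_def left_homD[OF assms(1)] slot_linearD[OF assms(2)] del: list_update.simps)

lemma slot_linear_add: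
  assumes M: "left_module M" and \<phi>: "slot_linear m L M \<phi>" and \<psi>: "slot_linear m L M \<psi>"
  shows "slot_linear m L M (\<lambda>e. \<phi> e \<boxplus>\<^bsub>tens H 2 M\<^esub> \<psi> e)"
  unfolding slot_linear_def
  using hom_add[OF comm_group_tens[OF pos2 M] slot_linearD(1)[OF \<phi>] slot_linearD(1)[OF \<psi>]]
  by (simp add: slot_linearD[OF \<phi>] slot_linearD[OF \<psi>]
    hom_mult[OF tens_act_hom[OF pos2 M ptens_slot]]
      del: list_update.simps)

lemma slot_linear_cong:
  assumes L: "left_module L" and \<phi>: "slot_linear m L M \<phi>" and eq: "\<And>e. e \<in> carrier L \<Longrightarrow> \<psi> e = \<phi> e"
  shows "slot_linear m L M \<psi>"
proof -
  interpret L: comm_group L by (rule left_moduleD(1)[OF L])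
  show ?thesis
    using \<phi> eq left_moduleD(2)[OF L] by (simp add: slot_linear_def hom_def Pi_iff)
qed

text \<open>The inner of the two lifts in \<open>plug\<close>, for a fixed inserted tensor
  \<open>S\<close>. Each lift needs its own balancing condition, which rests on coassociativity for
  this one and on slot linearity for the outer one.\<close>

definition ins :: "nat \<Rightarrow> ('h, 'm) lmod \<Rightarrow> 'h tpow \<Rightarrow> ('h, 'm) tens \<Rightarrow> ('h, 'm) tens" where
  "ins m M S = lift (tens H 3 M) (\<lambda>(T, e). tens_elt H 3 M (insert_factors H 2 2 m S T) e)"

lemma plug_eq: "plug H 2 2 m M \<phi> = lift (tens H 3 M) (\<lambda>(S, e). ins m M S (\<phi> e))"
  by (rule ext) (simp add: plug_def ins_def)

context
  fixes m :: nat assumes m: "m < 2"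
begin

lemma ins:
  assumes M: "left_module M" and S: "S \<in> carrier (tpow H 2)"
  shows ins_hom: "ins m M S \<in> hom (tens H 2 M) (tens H 3 M)" (is "PROP ?A")
    and ins_elt: "T \<in> carrier (tpow H 2) \<Longrightarrow> e \<in> carrier M
      \<Longrightarrow> ins m M S (tens_elt H 2 M T e) = tens_elt H 3 M (insert_factors H 2 2 m S T)
          e" (is "PROP ?B")
proof -
  interpret M: tensor_module H 2 M using pos2 M by (rule tensor_moduleI)
  interpret M3: tensor_module H 3 M using pos3 M by (rule tensor_moduleI)
  note i = insert_factors_hom[OF m S]
  have "M.balanced (tens H 3 M) (\<lambda>T e. tens_elt H 3 M (insert_factors H 2 2 m S T) e)"
    unfolding M.balanced_def
    using tens_elt_hom_right[OF pos3 M] hom_compose[OF i tens_elt_hom_left[OF pos3 M], unfolded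
        o_def]
    by (simp add: hom_in_carrier[OF i] insert_factors_ract_right[OF m S] M3.tens_elt_ract)
  note * = M.lift_tens[OF M3.comm_group_module this]
  show "PROP ?A"
    unfolding ins_def by (rule *(1))
  show "PROP ?B"
    unfolding ins_def by (rule *(2))
qed

lemma ins_hom_left:
  assumes M: "left_module M" and X: "X \<in> carrier (tens H 2 M)"
  shows "(\<lambda>S. ins m M S X) \<in> hom (tpow H 2) (tens H 3 M)"
proof (rule homI)
  interpret T2: comm_group "tpow H 2" by (rule comm_group_tpow)
  fix S assume S: "S \<in> carrier (tpow H 2)"
  show "ins m M S X \<in> carrier (tens H 3 M)"
    by (rule hom_in_carrier[OF ins_hom[OF M S] X])
  fix S' assume S': "S' \<in> carrier (tpow H 2)"
  have SS': "S \<boxplus>\<^bsub>tpow H 2\<^esub> S' \<in> carrier (tpow H 2)" using S S' by simp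
  show "ins m M (S \<boxplus>\<^bsub>tpow H 2\<^esub> S') X = ins m M S X \<boxplus>\<^bsub>tens H 3 M\<^esub> ins m M S' X"
    by (rule tens_hom_eqI[OF pos2 M group_tens[OF pos3 M] ins_hom[OF M SS']
          hom_add[OF comm_group_tens[OF pos3 M] ins_hom[OF M S] ins_hom[OF M S']] _ X])
      (simp add: ins_elt[OF M] S S' SS' hom_mult[OF insert_factors_hom_left[OF m]]
        hom_mult[OF tens_elt_hom_left[OF pos3 M]] insert_factors_closed[OF m])
qed

lemma ins_ract:
  assumes M: "left_module M" and S: "S \<in> carrier (tpow H 2)" and X: "X \<in> carrier (tens H 2 M)"
  shows "ins m M (tpow_ract H 2 S h) X = ins m M S (act (tens H 2 M) (ptens H ([1, 1][m := h])) X)"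
proof -
  have Sh: "tpow_ract H 2 S h \<in> carrier (tpow H 2)" by (rule tpow_ract_closed[OF pos2 S])
  show ?thesis
    by (rule tens_hom_eqI[OF pos2 M group_tens[OF pos3 M] ins_hom[OF M Sh]
          hom_compose[OF tens_act_hom[OF pos2 M ptens_slot] ins_hom[OF M S], unfolded o_def] _ X])
      (simp add: ins_elt[OF M] S Sh tens_act_elt[OF pos2 M ptens_slot] tpow_mult_closed ptens_slot
        insert_factors_ract_left[OF m] del: list_update.simps)
qed

lemma tens_map_ins:
  assumes M: "left_module M" and N: "left_module N" and f: "left_hom M N f"
    and S: "S \<in> carrier (tpow H 2)" and X: "X \<in> carrier (tens H 2 M)"
  shows "tens_map H 3 N f (ins m M S X) = ins m N S (tens_map H 2 N f X)"
  by (rule tens_hom_eqI[OF pos2 M group_tens[OF pos3 N]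
        hom_compose[OF ins_hom[OF M S] tens_map_hom[OF pos3 M N f], unfolded o_def]
        hom_compose[OF tens_map_hom[OF pos2 M N f] ins_hom[OF N S], unfolded o_def] _ X])
    (simp add: ins_elt[OF M S] ins_elt[OF N S] tens_map_elt[OF _ M N f] insert_factors_closed[OF m S]
      left_homD(2)[OF f])

text \<open>Moving \<open>h\<close> from \<open>S\<close> to the element \<open>e\<close> multiplies
  \<phi> \<open>e\<close> by \<open>h\<close> in slot \<open>m\<close>, which insertion turns back
  into the right action on \<open>S\<close>. So balancing is \<open>ins_ract\<close> read together
  with slot linearity.\<close>

lemma plug:
  assumes L: "left_module L" and M: "left_module M" and \<phi>: "slot_linear m L M \<phi>"
  shows plug_hom: "plug H 2 2 m M \<phi> \<in> hom (tens H 2 L) (tens H 3 M)" (is "PROP ?A")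
    and plug_elt: "S \<in> carrier (tpow H 2) \<Longrightarrow> e \<in> carrier L
      \<Longrightarrow> plug H 2 2 m M \<phi> (tens_elt H 2 L S e) = ins m M S (\<phi> e)" (is "PROP ?B")
proof -
  interpret L: tensor_module H 2 L using pos2 L by (rule tensor_moduleI)
  have "L.balanced (tens H 3 M) (\<lambda>S e. ins m M S (\<phi> e))"
    unfolding L.balanced_def
    using ins_hom_left[OF M] hom_compose[OF slot_linearD(1)[OF \<phi>] ins_hom[OF M], unfolded o_def]
    by (simp add: slot_linearD[OF \<phi>] ins_ract[OF M] del: list_update.simps)
  note * = L.lift_tens[OF comm_group_tens[OF pos3 M] this]
  show "PROP ?A"
    unfolding plug_eq by (rule *(1))
  show "PROP ?B"
    unfolding plug_eq by (rule *(2))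
qed

lemmas plug_closed = hom_in_carrier[OF plug_hom]

lemma plug_cong:
  assumes L: "left_module L" and M: "left_module M" and \<phi>: "slot_linear m L M \<phi>"
    and eq: "\<And>e. e \<in> carrier L \<Longrightarrow> \<psi> e = \<phi> e" and X: "X \<in> carrier (tens H 2 L)"
  shows "plug H 2 2 m M \<psi> X = plug H 2 2 m M \<phi> X"
  by (rule tens_hom_eqI[OF pos2 L group_tens[OF pos3 M] plug_hom[OF L M slot_linear_cong[OF L \<phi> eq]]
        plug_hom[OF L M \<phi>] _ X])
    (simp_all add: plug_elt[OF L M \<phi>] plug_elt[OF L M slot_linear_cong[OF L \<phi> eq]] eq)

lemma plug_add:
  assumes L: "left_module L" and M: "left_module M"
    and \<phi>: "slot_linear m L M \<phi>" and \<psi>: "slot_linear m L M \<psi>" and X: "X \<in> carrier (tens H 2 L)"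
  shows "plug H 2 2 m M (\<lambda>e. \<phi> e \<boxplus>\<^bsub>tens H 2 M\<^esub> \<psi> e) X
    = plug H 2 2 m M \<phi> X \<boxplus>\<^bsub>tens H 3 M\<^esub> plug H 2 2 m M \<psi> X"
  by (rule tens_hom_eqI[OF pos2 L group_tens[OF pos3 M] plug_hom[OF L M slot_linear_add[OF M \<phi> \<psi>]]
        hom_add[OF comm_group_tens[OF pos3 M] plug_hom[OF L M \<phi>] plug_hom[OF L M \<psi>]] _ X])
    (simp add: plug_elt[OF L M] \<phi> \<psi> slot_linear_add[OF M \<phi> \<psi>] hom_mult[OF ins_hom[OF M]]
      slot_linearD(2)[OF \<phi>] slot_linearD(2)[OF \<psi>])

text \<open>With the next lemma, substitution is natural at both ends. This is how source, target,
  identities and the components of a functor are moved through \<open>plug\<close>.\<close>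

lemma plug_tens_map:
  assumes K: "left_module K" and L: "left_module L" and M: "left_module M"
    and f: "left_hom K L f" and \<phi>: "slot_linear m L M \<phi>" and X: "X \<in> carrier (tens H 2 K)"
  shows "plug H 2 2 m M \<phi> (tens_map H 2 L f X) = plug H 2 2 m M (\<lambda>e. \<phi> (f e)) X"
  by (rule tens_hom_eqI[OF pos2 K group_tens[OF pos3 M]
        hom_compose[OF tens_map_hom[OF pos2 K L f] plug_hom[OF L M \<phi>], unfolded o_def]
        plug_hom[OF K M slot_linear_compose[OF f \<phi>]] _ X])
    (simp add: tens_map_elt[OF pos2 K L f] plug_elt[OF L M \<phi>]
      plug_elt[OF K M slot_linear_compose[OF f \<phi>]] left_homD(2)[OF f])

lemma tens_map_plug:
  assumes L: "left_module L" and M: "left_module M" and N: "left_module N"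
    and f: "left_hom M N f" and \<phi>: "slot_linear m L M \<phi>" and X: "X \<in> carrier (tens H 2 L)"
  shows "tens_map H 3 N f (plug H 2 2 m M \<phi> X) = plug H 2 2 m N (\<lambda>e. tens_map H 2 N f (\<phi> e)) X"
  by (rule tens_hom_eqI[OF pos2 L group_tens[OF pos3 N]
        hom_compose[OF plug_hom[OF L M \<phi>] tens_map_hom[OF pos3 M N f], unfolded o_def]
        plug_hom[OF L N slot_linear_tens_map[OF M N f \<phi>]] _ X])
    (simp add: plug_elt[OF L M \<phi>] plug_elt[OF L N slot_linear_tens_map[OF M N f \<phi>]]
      tens_map_ins[OF M N f] slot_linearD(2)[OF \<phi>])

end

end

section \<open>Categories internal to abelian groups\<close>

text \<open>In a category internal to abelian groups the composition is determined by the rest of the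
  structure: \<open>(g, f) = (g, 1) + (1, f) - (1, 1)\<close> with \<open>1\<close> the identity of the middle object.\<close>

locale group_category =
  fixes D :: "('r, 'o, 'a, 'z) twomod_scheme" (structure)
  assumes comm_group_Ob: "comm_group (Ob D)" and comm_group_Ar: "comm_group (Ar D)"
    and src_hom: "src D \<in> hom (Ar D) (Ob D)" and tgt_hom: "tgt D \<in> hom (Ar D) (Ob D)"
    and idn_hom: "idn D \<in> hom (Ob D) (Ar D)"
    and src_idn: "x \<in> carrier (Ob D) \<Longrightarrow> src D (idn D x) = x"
    and tgt_idn: "x \<in> carrier (Ob D) \<Longrightarrow> tgt D (idn D x) = x"
    and cmp_eq: "\<lbrakk>g \<in> carrier (Ar D); f \<in> carrier (Ar D); src D g = tgt D f\<rbrakk>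
      \<Longrightarrow> cmp D g f = (g \<boxplus>\<^bsub>Ar D\<^esub> f) \<boxminus>\<^bsub>Ar D\<^esub> idn D (src D g)"
begin

sublocale Ob: comm_group "Ob D" by (rule comm_group_Ob)
sublocale Ar: comm_group "Ar D" by (rule comm_group_Ar)
sublocale src: group_hom "Ar D" "Ob D" "src D"
  by (simp add: group_homI src_hom Ob.is_group Ar.is_group)
sublocale tgt: group_hom "Ar D" "Ob D" "tgt D"
  by (simp add: group_homI tgt_hom Ob.is_group Ar.is_group)
sublocale idn: group_hom "Ob D" "Ar D" "idn D"
  by (simp add: group_homI idn_hom Ob.is_group Ar.is_group)

lemma cmp_add_idn:
  assumes "g \<in> carrier (Ar D)" "f \<in> carrier (Ar D)" "src D g = tgt D f"
  shows "cmp D g f \<boxplus>\<^bsub>Ar D\<^esub> idn D (src D g) = g \<boxplus>\<^bsub>Ar D\<^esub> f"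
  using assms by (simp add: cmp_eq Ar.m_assoc)

lemma cmp_closed:
  assumes "g \<in> carrier (Ar D)" "f \<in> carrier (Ar D)" "src D g = tgt D f"
  shows "cmp D g f \<in> carrier (Ar D)"
  using assms by (simp add: cmp_eq)

lemma src_cmp:
  assumes "g \<in> carrier (Ar D)" "f \<in> carrier (Ar D)" "src D g = tgt D f"
  shows "src D (cmp D g f) = src D f"
proof -
  have "src D (cmp D g f) = (src D f \<boxplus>\<^bsub>Ob D\<^esub> tgt D f) \<boxminus>\<^bsub>Ob D\<^esub> tgt D f"
    using assms by (simp add: cmp_eq src_idn Ob.m_comm)
  then show ?thesis using assms(1,2) by (simp add: Ob.m_assoc)
qed

lemma tgt_cmp:
  assumes "g \<in> carrier (Ar D)" "f \<in> carrier (Ar D)" "src D g = tgt D f"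
  shows "tgt D (cmp D g f) = tgt D g"
  using assms by (simp add: cmp_eq tgt_idn Ob.m_assoc)

lemma cmp_idn:
  assumes "f \<in> carrier (Ar D)"
  shows "cmp D f (idn D (src D f)) = f" and "cmp D (idn D (tgt D f)) f = f"
proof -
  show "cmp D f (idn D (src D f)) = f"
    using assms by (simp add: cmp_eq tgt_idn Ar.m_assoc)
  have "cmp D (idn D (tgt D f)) f = (f \<boxplus>\<^bsub>Ar D\<^esub> idn D (tgt D f)) \<boxminus>\<^bsub>Ar D\<^esub> idn D (tgt D f)"
    using assms by (simp add: cmp_eq src_idn Ar.m_comm)
  then show "cmp D (idn D (tgt D f)) f = f"
    using assms by (simp add: Ar.m_assoc)
qed

lemma cmp_assoc:
  assumes "h \<in> carrier (Ar D)" "g \<in> carrier (Ar D)" "f \<in> carrier (Ar D)"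
    and "src D h = tgt D g" "src D g = tgt D f"
  shows "cmp D (cmp D h g) f = cmp D h (cmp D g f)"
proof -
  have "cmp D (cmp D h g) f = ((h \<boxplus>\<^bsub>Ar D\<^esub> g) \<boxminus>\<^bsub>Ar D\<^esub> idn D (tgt D g)) \<boxplus>\<^bsub>Ar D\<^esub> f
      \<boxminus>\<^bsub>Ar D\<^esub> idn D (tgt D f)"
    using assms by (simp add: cmp_eq[of "cmp D h g"] cmp_closed src_cmp) (simp add: cmp_eq)
  moreover have "cmp D h (cmp D g f) = h \<boxplus>\<^bsub>Ar D\<^esub> ((g \<boxplus>\<^bsub>Ar D\<^esub> f) \<boxminus>\<^bsub>Ar D\<^esub> idn D (tgt D f))
      \<boxminus>\<^bsub>Ar D\<^esub> idn D (tgt D g)"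
    using assms by (simp add: cmp_eq[of h] cmp_closed tgt_cmp) (simp add: cmp_eq)
  ultimately show ?thesis using assms by (simp add: Ar.m_ac)
qed

lemma cmp_add:
  assumes "g \<in> carrier (Ar D)" "f \<in> carrier (Ar D)" "src D g = tgt D f"
    and "g' \<in> carrier (Ar D)" "f' \<in> carrier (Ar D)" "src D g' = tgt D f'"
  shows "cmp D (g \<boxplus>\<^bsub>Ar D\<^esub> g') (f \<boxplus>\<^bsub>Ar D\<^esub> f') = cmp D g f \<boxplus>\<^bsub>Ar D\<^esub> cmp D g' f'"
  using assms by (simp add: cmp_eq Ar.inv_mult_group Ar.m_ac)

text \<open>The inverse of \<open>f\<close> is \<open>1 - f + 1\<close>.\<close>

lemma iso_from_to_iff: "iso_from_to D f x y \<longleftrightarrow> arrow_from_to D f x y"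
proof
  assume f: "arrow_from_to D f x y"
  then have fx: "f \<in> carrier (Ar D)" "x = src D f" "y = tgt D f"
    by (auto simp: arrow_from_to_def)
  let ?g = "(idn D x \<boxplus>\<^bsub>Ar D\<^esub> idn D y) \<boxminus>\<^bsub>Ar D\<^esub> f"
  have xy: "x \<in> carrier (Ob D)" "y \<in> carrier (Ob D)" using fx by simp_all
  have sg: "src D ?g = y"
  proof -
    have "src D ?g = (y \<boxplus>\<^bsub>Ob D\<^esub> x) \<boxminus>\<^bsub>Ob D\<^esub> x"
      using fx xy by (simp add: src_idn Ob.m_comm)
    then show ?thesis using xy by (simp add: Ob.m_assoc)
  qed
  have tg: "tgt D ?g = x"
    using fx xy by (simp add: tgt_idn Ob.m_assoc)
  have gc: "?g \<in> carrier (Ar D)" using fx xy by simp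
  have "cmp D ?g f = ((idn D x \<boxplus>\<^bsub>Ar D\<^esub> idn D y) \<boxplus>\<^bsub>Ar D\<^esub> (inv\<^bsub>Ar D\<^esub> f \<boxplus>\<^bsub>Ar D\<^esub> f)) \<boxminus>\<^bsub>Ar D\<^esub> idn D y"
    using fx(1) xy gc sg by (simp add: cmp_eq fx(3)[symmetric] Ar.m_assoc)
  then have 1: "cmp D ?g f = idn D x" using fx(1) xy by (simp add: Ar.m_assoc)
  have a: "idn D x \<boxplus>\<^bsub>Ar D\<^esub> idn D y \<in> carrier (Ar D)" using xy by simp
  have "f \<boxplus>\<^bsub>Ar D\<^esub> ?g = idn D y \<boxplus>\<^bsub>Ar D\<^esub> idn D x"
    using Ar.m_lcomm[of f "idn D x \<boxplus>\<^bsub>Ar D\<^esub> idn D y" "inv\<^bsub>Ar D\<^esub> f"] fx(1) a xy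
    by (simp add: Ar.m_comm)
  then have 2: "cmp D f ?g = idn D y"
    using fx(1) xy gc tg by (simp only: cmp_eq fx(2)[symmetric]) (simp add: Ar.m_assoc)
  show "iso_from_to D f x y"
    unfolding iso_from_to_def using f gc sg tg 1 2 by (auto simp: arrow_from_to_def)
qed (simp add: iso_from_to_def)

lemma arrow_src_closed: "arrow_from_to D f x y \<Longrightarrow> x \<in> carrier (Ob D)"
  by (auto simp: arrow_from_to_def)

lemma arrow_cmp:
  assumes "arrow_from_to D g y z" "arrow_from_to D f x y"
  shows "arrow_from_to D (cmp D g f) x z"
  using assms cmp_closed[of g f] src_cmp[of g f] tgt_cmp[of g f] by (simp add: arrow_from_to_def)

lemma arrow_idn: "x \<in> carrier (Ob D) \<Longrightarrow> arrow_from_to D (idn D x) x x"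
  by (simp add: arrow_from_to_def src_idn tgt_idn)

lemma arrow_minus:
  assumes "arrow_from_to D f x y" "arrow_from_to D f' x' y'"
  shows "arrow_from_to D (f \<boxminus>\<^bsub>Ar D\<^esub> f') (x \<boxminus>\<^bsub>Ob D\<^esub> x') (y \<boxminus>\<^bsub>Ob D\<^esub> y')"
  using assms by (auto simp: arrow_from_to_def)

text \<open>Interchange law for differences. It turns the composite of two alternating differences,
  as in the definition of a morphism, into the alternating difference of composites.\<close>

lemma cmp_minus_arrow:
  assumes "arrow_from_to D g y z" "arrow_from_to D f x y" "arrow_from_to D g' y' z'"
      "arrow_from_to D f' x' y'"
  shows "cmp D (g \<boxminus>\<^bsub>Ar D\<^esub> g') (f \<boxminus>\<^bsub>Ar D\<^esub> f') = cmp D g f \<boxminus>\<^bsub>Ar D\<^esub> cmp D g' f'"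
  using assms by (auto simp: arrow_from_to_def cmp_eq Ar.inv_mult_group Ar.m_ac)

lemma cmp_assoc_arrow:
  assumes "arrow_from_to D h z w" "arrow_from_to D g y z" "arrow_from_to D f x y"
  shows "cmp D (cmp D h g) f = cmp D h (cmp D g f)"
  using assms by (intro cmp_assoc) (simp_all add: arrow_from_to_def)

lemma cmp_idn_arrow:
  assumes "arrow_from_to D f x y"
  shows "cmp D f (idn D x) = f" and "cmp D (idn D y) f = f"
  using assms cmp_idn[of f] by (auto simp: arrow_from_to_def)

end

definition group_functor ::
  "('r, 'o, 'a, 'z) twomod_scheme \<Rightarrow> ('s, 'p, 'b, 'y) twomod_scheme \<Rightarrow> ('o \<Rightarrow> 'p) \<Rightarrow> ('a \<Rightarrow> 'b) \<Rightarrow> bool"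
      where
  "group_functor D E p0 p1 \<longleftrightarrow> p0 \<in> hom (Ob D) (Ob E) \<and> p1 \<in> hom (Ar D) (Ar E) \<and>
     (\<forall>f \<in> carrier (Ar D). src E (p1 f) = p0 (src D f) \<and> tgt E (p1 f) = p0 (tgt D f)) \<and>
     (\<forall>x \<in> carrier (Ob D). p1 (idn D x) = idn E (p0 x))"

lemma group_functor_cmp:
  assumes "group_category D" "group_category E" and p: "group_functor D E p0 p1"
    and gf: "g \<in> carrier (Ar D)" "f \<in> carrier (Ar D)" "src D g = tgt D f"
  shows "p1 (cmp D g f) = cmp E (p1 g) (p1 f)"
proof -
  interpret D: group_category D by fact
  interpret E: group_category E by fact
  interpret p1: group_hom "Ar D" "Ar E" p1
    using p by (simp add: group_homI group_functor_def)
  have s: "src E (p1 g) = p0 (src D g)" "tgt E (p1 f) = p0 (tgt D f)" using p gf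
      by (auto simp: group_functor_def)
  have i: "p1 (idn D (src D g)) = idn E (p0 (src D g))" using p gf D.src.hom_closed
      by (auto simp: group_functor_def)
  show ?thesis
    using gf by (simp add: D.cmp_eq E.cmp_eq s i[unfolded gf(3)])
qed

lemma group_functor_arrow:
  assumes "group_functor D E p0 p1" "arrow_from_to D f x y"
  shows "arrow_from_to E (p1 f) (p0 x) (p0 y)"
  using assms by (auto simp: arrow_from_to_def group_functor_def hom_def)

lemma group_functor_cmp_arrow:
  assumes "group_category D" "group_category E" "group_functor D E p0 p1"
    and "arrow_from_to D g y z" "arrow_from_to D f x y"
  shows "p1 (cmp D g f) = cmp E (p1 g) (p1 f)"
  using assms by (intro group_functor_cmp[OF assms(1-3)]) (simp_all add: arrow_from_to_def)

section \<open>The category obtained by tensoring\<close>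

lemma left_2moduleD:
  assumes "left_2module C"
  shows "left_module (Ob C)" "left_module (Ar C)"
    and "left_hom (Ar C) (Ob C) (src C)" "left_hom (Ar C) (Ob C) (tgt C)"
        "left_hom (Ob C) (Ar C) (idn C)"
    and "left_hom (composable C) (Ar C) (\<lambda>(g, f). cmp C g f)"
    and "x \<in> carrier (Ob C) \<Longrightarrow> src C (idn C x) = x"
    and "x \<in> carrier (Ob C) \<Longrightarrow> tgt C (idn C x) = x"
    and "f \<in> carrier (Ar C) \<Longrightarrow> cmp C f (idn C (src C f)) = f"
    and "f \<in> carrier (Ar C) \<Longrightarrow> cmp C (idn C (tgt C f)) f = f"
  using assms unfolding left_2module_def by blast+

lemma composable_simps:
  "(g, f) \<in> carrier (composable C) \<longleftrightarrow> g \<in> carrier (Ar C) \<and> f \<in> carrier (Ar C) \<and> src C g = tgt C f"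
  "(g, f) \<boxplus>\<^bsub>composable C\<^esub> (g', f') = (g \<boxplus>\<^bsub>Ar C\<^esub> g', f \<boxplus>\<^bsub>Ar C\<^esub> f')"
  "\<one>\<^bsub>composable C\<^esub> = (\<one>\<^bsub>Ar C\<^esub>, \<one>\<^bsub>Ar C\<^esub>)"
  "act (composable C) h (g, f) = (act (Ar C) h g, act (Ar C) h f)"
  by (simp_all add: composable_def)

lemma left_module_composable:
  assumes C: "left_2module C"
  shows "left_module (composable C)"
proof -
  note s = left_2moduleD(3)[OF C] and t = left_2moduleD(4)[OF C]
  note A = left_2moduleD(2)[OF C]
  interpret A: comm_group "Ar C" by (rule left_moduleD(1)[OF A])
  interpret O: comm_group "Ob C" by (rule left_moduleD(1)[OF left_2moduleD(1)[OF C]])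
  interpret s: group_hom "Ar C" "Ob C" "src C"
    by (simp add: group_homI left_homD(1)[OF s] A.is_group O.is_group)
  interpret t: group_hom "Ar C" "Ob C" "tgt C"
    by (simp add: group_homI left_homD(1)[OF t] A.is_group O.is_group)
  have "comm_group (composable C)"
  proof (rule comm_groupI)
    fix p assume p: "p \<in> carrier (composable C)"
    obtain g f where gf: "p = (g, f)" by (cases p)
    then show "\<exists>q\<in>carrier (composable C). q \<boxplus>\<^bsub>composable C\<^esub> p = \<one>\<^bsub>composable C\<^esub>"
      using p by (intro bexI[of _ "(inv\<^bsub>Ar C\<^esub> g, inv\<^bsub>Ar C\<^esub> f)"]) (auto simp: composable_simps)
  qed (auto simp: composable_simps A.m_ac)
  then show ?thesis
    unfolding left_module_def
    using left_moduleD[OF A] left_homD(4)[OF s] left_homD(4)[OF t]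
    by (auto simp: composable_simps)
qed

lemma left_hom_fst: "left_hom (composable C) (Ar C) fst"
  and left_hom_snd: "left_hom (composable C) (Ar C) snd"
  by (auto simp: left_hom_def hom_def composable_simps)

text \<open>The same pair is decomposed as (g, f) + (1, 1) and as (g, 1) + (1, f). Composition is
  additive on pairs, and the unit laws evaluate every summand except
  \<open>cmp C g f\<close>.\<close>

lemma left_2module_cmp_add_idn:
  assumes C: "left_2module C"
    and g: "g \<in> carrier (Ar C)" and f: "f \<in> carrier (Ar C)" and gf: "src C g = tgt C f"
  shows "cmp C g f \<boxplus>\<^bsub>Ar C\<^esub> idn C (src C g) = g \<boxplus>\<^bsub>Ar C\<^esub> f"
proof -
  interpret A: comm_group "Ar C" by (rule left_moduleD(1)[OF left_2moduleD(2)[OF C]])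
  have x: "src C g \<in> carrier (Ob C)" by (rule left_homD(2)[OF left_2moduleD(3)[OF C] g])
  let ?i = "idn C (src C g)"
  have i: "?i \<in> carrier (Ar C)" "src C ?i = src C g" "tgt C ?i = src C g"
    using left_homD(2)[OF left_2moduleD(5)[OF C] x] left_2moduleD(7,8)[OF C x] by simp_all
  note cmp_hom = hom_mult[OF left_homD(1)[OF left_2moduleD(6)[OF C]]]
  have "cmp C g f \<boxplus>\<^bsub>Ar C\<^esub> cmp C ?i ?i = cmp C (g \<boxplus>\<^bsub>Ar C\<^esub> ?i) (f \<boxplus>\<^bsub>Ar C\<^esub> ?i)"
    using cmp_hom[of "(g, f)" "(?i, ?i)"] f g gf i by (simp add: composable_simps)
  also have "\<dots> = cmp C (g \<boxplus>\<^bsub>Ar C\<^esub> ?i) (?i \<boxplus>\<^bsub>Ar C\<^esub> f)"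
    using f i by (simp add: A.m_comm)
  also have "\<dots> = cmp C g ?i \<boxplus>\<^bsub>Ar C\<^esub> cmp C ?i f"
    using cmp_hom[of "(g, ?i)" "(?i, f)"] f g gf i by (simp add: composable_simps)
  also have "\<dots> = g \<boxplus>\<^bsub>Ar C\<^esub> f"
    using left_2moduleD(9)[OF C g] left_2moduleD(10)[OF C f] gf by simp
  finally show ?thesis
    using left_2moduleD(9)[OF C i(1)] i by simp
qed

context coco_hopf begin

lemma tens_cat_simps:
  "Ob (tens_cat H n C) = tens H n (Ob C)" "Ar (tens_cat H n C) = tens H n (Ar C)"
  "src (tens_cat H n C) = tens_map H n (Ob C) (src C)" "tgt (tens_cat H n C)
      = tens_map H n (Ob C) (tgt C)"
  "idn (tens_cat H n C) = tens_map H n (Ar C) (idn C)"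
  by (simp_all add: tens_cat_def)

text \<open>Two tensored arrows with matching ends must come from exactly one tensored composable
  pair, or the definite description in \<open>tens_cat\<close> determines nothing. Once that pair is
  found, the formula for the composite follows by tensoring
  \<open>left_2module_cmp_add_idn\<close>.\<close>

lemma tens_cat_cmp:
  assumes n: "n > 0" and C: "left_2module C"
    and G: "G \<in> carrier (tens H n (Ar C))" and F: "F \<in> carrier (tens H n (Ar C))"
    and GF: "tens_map H n (Ob C) (src C) G = tens_map H n (Ob C) (tgt C) F"
  shows "cmp (tens_cat H n C) G F \<boxplus>\<^bsub>tens H n (Ar C)\<^esub> tens_map H n (Ar C) (idn C)
      (tens_map H n (Ob C) (src C) G)
      = G \<boxplus>\<^bsub>tens H n (Ar C)\<^esub> F"
    and "cmp (tens_cat H n C) G F \<in> carrier (tens H n (Ar C))"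
proof -
  note mO = left_2moduleD(1)[OF C] and mA = left_2moduleD(2)[OF C]
    and s = left_2moduleD(3)[OF C] and t = left_2moduleD(4)[OF C] and i = left_2moduleD(5)[OF C]
  note mP = left_module_composable[OF C]
  interpret A: comm_group "Ar C" by (rule left_moduleD(1)[OF mA])
  interpret P: comm_group "composable C" by (rule left_moduleD(1)[OF mP])
  interpret TA: comm_group "tens H n (Ar C)" by (rule comm_group_tens[OF n mA])
  interpret TP: comm_group "tens H n (composable C)" by (rule comm_group_tens[OF n mP])
  \<comment> \<open>The three maps produce the pairs (g, 1), (1, f) and (1, 1), as linear maps into
    the module of composable pairs.\<close>
  define i1 where "i1 g = (g, idn C (src C g))" for g
  define i2 where "i2 f = (idn C (tgt C f), f)" for f
  define i3 where "i3 x = (idn C x, idn C x)" for x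
  have i1: "left_hom (Ar C) (composable C) i1"
    using left_homD[OF s] left_homD[OF i] left_2moduleD(7,8)[OF C]
    by (auto simp: left_hom_def hom_def i1_def composable_simps)
  have i2: "left_hom (Ar C) (composable C) i2"
    using left_homD[OF t] left_homD[OF i] left_2moduleD(7,8)[OF C]
    by (auto simp: left_hom_def hom_def i2_def composable_simps)
  have i3: "left_hom (Ob C) (composable C) i3"
    using left_homD[OF i] left_2moduleD(7,8)[OF C]
    by (auto simp: left_hom_def hom_def i3_def composable_simps)
  note fs = left_hom_fst[of C] and sn = left_hom_snd[of C]
  let ?fst = "tens_map H n (Ar C) fst" and ?snd = "tens_map H n (Ar C) snd"
  let ?src = "tens_map H n (Ob C) (src C)" and ?tgt = "tens_map H n (Ob C) (tgt C)"
    and ?idn = "tens_map H n (Ar C) (idn C)"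
  let ?i1 = "tens_map H n (composable C) i1" and ?i2 = "tens_map H n (composable C) i2"
    and ?i3 = "tens_map H n (composable C) i3"
  note cp = tens_map_compose[OF n] and cl = tens_map_closed[OF n]
  let ?P = "tens H n (composable C)" and ?A = "tens H n (Ar C)"
  have ident: "left_hom M M (\<lambda>x. x)" for M :: "('h, 'y) lmod" by (simp add: left_hom_def hom_def)
  \<comment> \<open>An element of the tensored module of pairs is thereby recovered from its two
    projections; the term with \<open>i3\<close> compensates for the units contributed by
    \<open>i1\<close> and \<open>i2\<close>.\<close>
  have split: "X \<boxplus>\<^bsub>?P\<^esub> ?i3 (?src (?fst X))
      = ?i1 (?fst X) \<boxplus>\<^bsub>?P\<^esub> ?i2 (?snd X)"
    if X: "X \<in> carrier ?P" for X
  proof -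
    let ?h = "\<lambda>p. p \<boxplus>\<^bsub>composable C\<^esub> i3 (src C (fst p))"
    have si: "left_hom (composable C) (composable C) (\<lambda>p. i3 (src C (fst p)))"
      by (rule left_hom_compose[OF left_hom_compose[OF fs s] i3])
    have i1f: "left_hom (composable C) (composable C) (\<lambda>p. i1 (fst p))"
      by (rule left_hom_compose[OF fs i1])
    have i2s: "left_hom (composable C) (composable C) (\<lambda>p. i2 (snd p))"
      by (rule left_hom_compose[OF sn i2])
    have h: "left_hom (composable C) (composable C) ?h"
      unfolding left_hom_def
      using hom_add[OF P.comm_group_axioms left_homD(1)[OF ident] left_homD(1)[OF si]]
        left_moduleD(3)[OF mP] left_homD(2,4)[OF si] by simp
    have eq: "?h p = i1 (fst p) \<boxplus>\<^bsub>composable C\<^esub> i2 (snd p)" if "p \<in> carrier (composable C)" for p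
      using that left_homD(2)[OF i] left_homD(2)[OF t]
      by (cases p) (auto simp: i1_def i2_def i3_def composable_simps A.m_comm)
    have "X \<boxplus>\<^bsub>?P\<^esub> ?i3 (?src (?fst X)) = tens_map H n (composable C) ?h X"
      using tens_map_add[OF n mP mP ident si h refl X] tens_map_ident[OF n mP refl X]
        cp[OF mP mA mO fs s X] cp[OF mP mO mP left_hom_compose[OF fs s] i3 X] by simp
    also have "\<dots> = ?i1 (?fst X) \<boxplus>\<^bsub>?P\<^esub> ?i2 (?snd X)"
      using tens_map_add[OF n mP mP i1f i2s h eq X] cp[OF mP mA mP fs i1 X] cp[OF mP mA mP sn i2
          X] by simp
    finally show ?thesis .
  qed
  \<comment> \<open>The candidate dictated by \<open>split\<close>, with \<open>G\<close> and
    \<open>F\<close> in place of the two projections.\<close>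
  define P where "P = (?i1 G \<boxplus>\<^bsub>?P\<^esub> ?i2 F) \<boxminus>\<^bsub>?P\<^esub> ?i3 (?src G)"
  have c1: "?i1 G \<in> carrier ?P" by (rule cl[OF mA mP i1 G])
  have c2: "?i2 F \<in> carrier ?P" by (rule cl[OF mA mP i2 F])
  have cs: "?src G \<in> carrier (tens H n (Ob C))" by (rule cl[OF mA mO s G])
  have c3: "?i3 (?src G) \<in> carrier ?P" by (rule cl[OF mO mP i3 cs])
  have ci: "?idn (?src G) \<in> carrier ?A" by (rule cl[OF mO mA i cs])
  have Pc: "P \<in> carrier ?P" unfolding P_def using c1 c2 c3 by simp
  have hfst: "group_hom ?P ?A ?fst"
    and hsnd: "group_hom ?P ?A ?snd"
    using tens_map_hom[OF n mP mA fs] tens_map_hom[OF n mP mA sn]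
    by (simp_all add: group_homI TP.is_group TA.is_group)
  interpret hfst: group_hom ?P ?A ?fst by (rule hfst)
  interpret hsnd: group_hom ?P ?A ?snd by (rule hsnd)
  have "?fst P = (G \<boxplus>\<^bsub>?A\<^esub> ?idn (?tgt F)) \<boxminus>\<^bsub>?A\<^esub> ?idn (?src G)"
    unfolding P_def using c1 c2 c3
    by (simp add: cp[OF mA mP mA i1 fs G] cp[OF mA mP mA i2 fs F] cp[OF mO mP mA i3 fs cs]
        cp[OF mA mO mA t i F] i1_def i2_def i3_def tens_map_ident[OF n mA refl G])
  then have P1: "?fst P = G" using G ci by (simp add: GF[symmetric] TA.m_assoc)
  have "?snd P = (F \<boxplus>\<^bsub>?A\<^esub> ?idn (?src G)) \<boxminus>\<^bsub>?A\<^esub> ?idn (?src G)"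
    unfolding P_def using c1 c2 c3 F ci
    by (simp add: cp[OF mA mP mA i1 sn G] cp[OF mA mP mA i2 sn F] cp[OF mO mP mA i3 sn cs]
        cp[OF mA mO mA s i G] i1_def i2_def i3_def tens_map_ident[OF n mA refl F] TA.m_comm)
  then have P2: "?snd P = F" using F ci by (simp add: TA.m_assoc)
  have uniq: "X = P" if X: "X \<in> carrier ?P" "?fst X = G" "?snd X = F" for X
  proof -
    have "X \<boxplus>\<^bsub>?P\<^esub> ?i3 (?src G) = P \<boxplus>\<^bsub>?P\<^esub> ?i3 (?src G)"
      using split[OF X(1)] split[OF Pc] X P1 P2 by simp
    then show ?thesis using TP.right_cancel[OF c3 X(1) Pc] by simp
  qed
  have the: "(THE P. P \<in> carrier ?P \<and> ?fst P = G \<and> ?snd P = F) = P"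
    by (rule the_equality, intro conjI Pc P1 P2) (elim conjE, rule uniq)
  have cmpP: "cmp (tens_cat H n C) G F = tens_map H n (Ar C) (\<lambda>(g, f). cmp C g f) P"
    unfolding tens_cat_def by (simp add: the)
  note c = left_2moduleD(6)[OF C]
  show "cmp (tens_cat H n C) G F \<in> carrier ?A"
    unfolding cmpP by (rule cl[OF mP mA c Pc])
  let ?h = "\<lambda>p. fst p \<boxplus>\<^bsub>Ar C\<^esub> snd p"
  have h: "left_hom (composable C) (Ar C) ?h"
    unfolding left_hom_def
    using hom_add[OF A.comm_group_axioms left_homD(1)[OF fs] left_homD(1)[OF sn]]
      left_moduleD(3)[OF mA] left_homD(2,4)[OF fs] left_homD(2,4)[OF sn] by simp
  have si: "left_hom (composable C) (Ar C) (\<lambda>p. idn C (src C (fst p)))"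
    by (rule left_hom_compose[OF left_hom_compose[OF fs s] i])
  have eq: "?h p = (\<lambda>(g, f). cmp C g f) p \<boxplus>\<^bsub>Ar C\<^esub> idn C (src C (fst p))"
    if "p \<in> carrier (composable C)" for p
    using that left_2module_cmp_add_idn[OF C] by (cases p) (simp add: composable_simps)
  show "cmp (tens_cat H n C) G F \<boxplus>\<^bsub>?A\<^esub> ?idn (?src G) = G \<boxplus>\<^bsub>?A\<^esub> F"
    using tens_map_add[OF n mP mA fs sn h refl Pc] tens_map_add[OF n mP mA c si h eq Pc]
      cp[OF mP mA mO fs s Pc] cp[OF mP mO mA left_hom_compose[OF fs s] i Pc]
    by (simp add: cmpP P1 P2)
qed

lemma group_category_tens_cat:
  assumes n: "n > 0" and C: "left_2module C"
  shows "group_category (tens_cat H n C)"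
proof (rule group_category.intro)
  note mO = left_2moduleD(1)[OF C] and mA = left_2moduleD(2)[OF C]
    and s = left_2moduleD(3)[OF C] and t = left_2moduleD(4)[OF C] and i = left_2moduleD(5)[OF C]
  interpret TA: comm_group "tens H n (Ar C)" by (rule comm_group_tens[OF n mA])
  show "comm_group (Ob (tens_cat H n C))" "comm_group (Ar (tens_cat H n C))"
    unfolding tens_cat_simps by (rule comm_group_tens[OF n mO] comm_group_tens[OF n mA])+
  show "src (tens_cat H n C) \<in> hom (Ar (tens_cat H n C)) (Ob (tens_cat H n C))"
    "tgt (tens_cat H n C) \<in> hom (Ar (tens_cat H n C)) (Ob (tens_cat H n C))"
    "idn (tens_cat H n C) \<in> hom (Ob (tens_cat H n C)) (Ar (tens_cat H n C))"
    unfolding tens_cat_simps by (rule tens_map_hom[OF n mA mO s] tens_map_hom[OF n mA mO t]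
        tens_map_hom[OF n mO mA i])+
  fix X assume X: "X \<in> carrier (Ob (tens_cat H n C))"
  show "src (tens_cat H n C) (idn (tens_cat H n C) X) = X"
      "tgt (tens_cat H n C) (idn (tens_cat H n C) X) = X"
    using X tens_map_compose[OF n mO mA mO i s] tens_map_compose[OF n mO mA mO i t]
      left_2moduleD(7,8)[OF C] tens_map_ident[OF n mO]
    by (simp_all add: tens_cat_simps)
next
  note mA = left_2moduleD(2)[OF C] and mO = left_2moduleD(1)[OF C]
  interpret TA: comm_group "tens H n (Ar C)" by (rule comm_group_tens[OF n mA])
  fix G F assume G: "G \<in> carrier (Ar (tens_cat H n C))" and F: "F \<in> carrier (Ar (tens_cat H n C))"
    and GF: "src (tens_cat H n C) G = tgt (tens_cat H n C) F"
  have i: "tens_map H n (Ar C) (idn C) (tens_map H n (Ob C) (src C) G) \<in> carrier (tens H n (Ar C))"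
    using G by (intro tens_map_closed[OF n mO mA left_2moduleD(5)[OF C]]
        tens_map_closed[OF n mA mO left_2moduleD(3)[OF C]]) (simp add: tens_cat_simps)
  show "cmp (tens_cat H n C) G F = (G \<boxplus>\<^bsub>Ar (tens_cat H n C)\<^esub> F)
      \<boxminus>\<^bsub>Ar (tens_cat H n C)\<^esub> idn (tens_cat H n C) (src (tens_cat H n C) G)"
    using tens_cat_cmp[OF n C, of G F] G F GF i
    by (simp add: tens_cat_simps TA.inv_solve_right)
qed

section \<open>Functors between tensored categories\<close>

abbreviation "after n D \<equiv> cmp (tens_cat H n D)"
abbreviation "one_at n D \<equiv> idn (tens_cat H n D)"
abbreviation "arrow n D \<equiv> arrow_from_to (tens_cat H n D)"
abbreviation "ob_map n D \<equiv> tens_map H n (Ob D)"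
abbreviation "ar_map n D \<equiv> tens_map H n (Ar D)"
abbreviation "ob_plug m D \<equiv> plug H 2 2 m (Ob D)"
abbreviation "ar_plug m D \<equiv> plug H 2 2 m (Ar D)"
abbreviation "ob_perm D \<equiv> perm_tens H (Ob D) [1, 0, 2]"
abbreviation "ar_perm D \<equiv> perm_tens H (Ar D) [1, 0, 2]"

lemma tens_map_commute:
  assumes n: "n > 0" and mods: "left_module L" "left_module M" "left_module M'" "left_module N"
    and h: "left_hom L M f" "left_hom M N g" "left_hom L M' f'" "left_hom M' N g'"
    and eq: "\<And>x. x \<in> carrier L \<Longrightarrow> g (f x) = g' (f' x)" and X: "X \<in> carrier (tens H n L)"
  shows "tens_map H n N g (tens_map H n M f X) = tens_map H n N g' (tens_map H n M' f' X)"
  using tens_map_compose[OF n mods(1,2,4) h(1,2) X] tens_map_compose[OF n mods(1,3,4) h(3,4) X]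
    tens_map_cong[OF n mods(1,4) left_hom_compose[OF h(3,4)] eq X] by simp

lemma internal_functorD:
  assumes "internal_functor C D f0 f1"
  shows "left_hom (Ob C) (Ob D) f0" "left_hom (Ar C) (Ar D) f1"
    and "f \<in> carrier (Ar C) \<Longrightarrow> src D (f1 f) = f0 (src C f)"
    and "f \<in> carrier (Ar C) \<Longrightarrow> tgt D (f1 f) = f0 (tgt C f)"
    and "x \<in> carrier (Ob C) \<Longrightarrow> f1 (idn C x) = idn D (f0 x)"
  using assms unfolding internal_functor_def by blast+

lemma group_functor_tens_map:
  assumes n: "n > 0" and C: "left_2module C" and D: "left_2module D"
      and F: "internal_functor C D f0 f1"
  shows "group_functor (tens_cat H n C) (tens_cat H n D) (ob_map n D f0) (ar_map n D f1)"
proof -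
  note c = left_2moduleD[OF C] and d = left_2moduleD[OF D] and f = internal_functorD[OF F]
  show ?thesis
    unfolding group_functor_def tens_cat_simps
    using tens_map_hom[OF n c(1) d(1) f(1)] tens_map_hom[OF n c(2) d(2) f(2)]
      tens_map_commute[OF n c(2) d(2) c(1) d(1) f(2) d(3) c(3) f(1,3)]
      tens_map_commute[OF n c(2) d(2) c(1) d(1) f(2) d(4) c(4) f(1,4)]
      tens_map_commute[OF n c(1) c(2) d(1) d(2) c(5) f(2) f(1) d(5) f(5)]
    by simp
qed

text \<open>Viewing multiplication by \<open>S\<close> as a functor makes it commute with
  composition, which gives the \<open>H\<close>-linearity of composites of slot-linear and of
  polylinear families of arrows.\<close>

lemma group_functor_act:
  assumes n: "n > 0" and D: "left_2module D" and S: "S \<in> carrier (tpow H n)"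
  shows "group_functor (tens_cat H n D) (tens_cat H n D) (act (tens H n (Ob D)) S)
      (act (tens H n (Ar D)) S)"
proof -
  note d = left_2moduleD[OF D]
  show ?thesis
    unfolding group_functor_def tens_cat_simps
    using tens_act_hom[OF n d(1) S] tens_act_hom[OF n d(2) S]
    by (simp add: tens_map_act[OF n d(2,1,3) S] tens_map_act[OF n d(2,1,4) S]
      tens_map_act[OF n d(1,2,5) S])
qed

lemma group_functor_perm_tens:
  assumes D: "left_2module D"
  shows "group_functor (tens_cat H 3 D) (tens_cat H 3 D) (ob_perm D) (ar_perm D)"
proof -
  note d = left_2moduleD[OF D]
  show ?thesis
    unfolding group_functor_def tens_cat_simps
    using perm_tens_hom[OF d(1)] perm_tens_hom[OF d(2)]
      tens_map_perm_tens[OF d(2,1,3)] tens_map_perm_tens[OF d(2,1,4)]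
          tens_map_perm_tens[OF d(1,2,5)]
    by (simp del: One_nat_def)
qed

text \<open>Such a pair, for instance the bracket with a fixed object on objects and with its
  identity on arrows, is functorial in its free argument, and substitution preserves this. So a
  bracket with a fixed argument can be applied to a composite of tensored arrows one arrow at a
  time.\<close>

lemma group_functor_plug:
  assumes m: "m < 2" and D: "left_2module D" and E: "left_2module E"
    and \<chi>0: "slot_linear m (Ob D) (Ob E) \<chi>0" and \<chi>1: "slot_linear m (Ar D) (Ar E) \<chi>1"
    and src: "\<And>f. f \<in> carrier (Ar D) \<Longrightarrow> ob_map 2 E (src E) (\<chi>1 f) = \<chi>0 (src D f)"
    and tgt: "\<And>f. f \<in> carrier (Ar D) \<Longrightarrow> ob_map 2 E (tgt E) (\<chi>1 f) = \<chi>0 (tgt D f)"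
    and idn: "\<And>x. x \<in> carrier (Ob D) \<Longrightarrow> \<chi>1 (idn D x) = ar_map 2 E (idn E) (\<chi>0 x)"
  shows "group_functor (tens_cat H 2 D) (tens_cat H 3 E) (ob_plug m E \<chi>0) (ar_plug m E \<chi>1)"
proof -
  note d = left_2moduleD[OF D] and e = left_2moduleD[OF E]
  note pm = plug_tens_map[OF m] and mp = tens_map_plug[OF m] and pc = plug_cong[OF m]
  have "ob_map 3 E (src E) (ar_plug m E \<chi>1 X)
      = ob_plug m E \<chi>0 (ob_map 2 D (src D) X)" if "X \<in> carrier (tens H 2 (Ar D))" for X
    using mp[OF d(2) e(2,1,3) \<chi>1 that] pm[OF d(2,1) e(1) d(3) \<chi>0 that]
      pc[OF d(2) e(1) slot_linear_compose[OF d(3) \<chi>0] src that] by simp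
  moreover have "ob_map 3 E (tgt E) (ar_plug m E \<chi>1 X)
      = ob_plug m E \<chi>0 (ob_map 2 D (tgt D) X)" if "X \<in> carrier (tens H 2 (Ar D))" for X
    using mp[OF d(2) e(2,1,4) \<chi>1 that] pm[OF d(2,1) e(1) d(4) \<chi>0 that]
      pc[OF d(2) e(1) slot_linear_compose[OF d(4) \<chi>0] tgt that] by simp
  moreover have "ar_plug m E \<chi>1 (ar_map 2 D (idn D) X)
      = ar_map 3 E (idn E) (ob_plug m E \<chi>0 X)" if "X \<in> carrier (tens H 2 (Ob D))" for X
    using pm[OF d(1,2) e(2) d(5) \<chi>1 that] mp[OF d(1) e(1,2,5) \<chi>0 that]
      pc[OF d(1) e(2) slot_linear_tens_map[OF e(1,2,5) \<chi>0] idn that] by simp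
  ultimately show ?thesis
    unfolding group_functor_def tens_cat_simps
    using plug_hom[OF m d(1) e(1) \<chi>0] plug_hom[OF m d(2) e(2) \<chi>1] by simp
qed

lemma slot_linear_cmp:
  assumes E: "left_2module E"
    and \<phi>: "slot_linear m L (Ar E) \<phi>" and \<psi>: "slot_linear m L (Ar E) \<psi>" and L: "left_module L"
    and eq: "\<And>e. e \<in> carrier L \<Longrightarrow>
      ob_map 2 E (src E) (\<phi> e) = ob_map 2 E (tgt E) (\<psi> e)"
  shows "slot_linear m L (Ar E) (\<lambda>e. after 2 E (\<phi> e) (\<psi> e))"
proof -
  interpret T: group_category "tens_cat H 2 E" by (rule group_category_tens_cat[OF pos2 E])
  interpret L: comm_group L by (rule left_moduleD(1)[OF L])
  have cl: "after 2 E (\<phi> e) (\<psi> e) \<in> carrier (tens H 2 (Ar E))" if "e \<in> carrier L" for e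
    using T.cmp_closed[of "\<phi> e" "\<psi> e"] slot_linearD(2)[OF \<phi> that] slot_linearD(2)[OF \<psi> that]
        eq[OF that]
    by (simp add: tens_cat_simps)
  have add: "after 2 E (\<phi> (e \<boxplus>\<^bsub>L\<^esub> e')) (\<psi> (e \<boxplus>\<^bsub>L\<^esub> e'))
      = after 2 E (\<phi> e) (\<psi> e) \<boxplus>\<^bsub>tens H 2 (Ar E)\<^esub> after 2 E (\<phi> e') (\<psi> e')"
    if "e \<in> carrier L" "e' \<in> carrier L" for e e'
    using T.cmp_add[of "\<phi> e" "\<psi> e" "\<phi> e'" "\<psi> e'"] that eq
    by (simp add: tens_cat_simps slot_linearD(2)[OF \<phi>] slot_linearD(2)[OF \<psi>]
        hom_mult[OF slot_linearD(1)[OF \<phi>]] hom_mult[OF slot_linearD(1)[OF \<psi>]])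
  have act: "after 2 E (\<phi> (act L h e)) (\<psi> (act L h e))
      = act (tens H 2 (Ar E)) (ptens H ([1, 1][m := h])) (after 2 E (\<phi> e) (\<psi> e))"
    if "e \<in> carrier L" for h e
    using group_functor_cmp[OF T.group_category_axioms T.group_category_axioms
        group_functor_act[OF pos2 E ptens_slot], of "\<phi> e" "\<psi> e" m h] that eq
    by (simp add: tens_cat_simps slot_linearD[OF \<phi>] slot_linearD[OF \<psi>] del: list_update.simps)
  show ?thesis
    unfolding slot_linear_def using cl add act by (simp add: hom_def del: list_update.simps)
qed

text \<open>Pointwise the composite is \<phi> + \<psi> minus a unit. Substitution preserves sums and
  units, so the two candidates agree after adding the same unit, which is then cancelled.\<close>

lemma plug_cmp:
  assumes m: "m < 2" and E: "left_2module E"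
    and \<phi>: "slot_linear m L (Ar E) \<phi>" and \<psi>: "slot_linear m L (Ar E) \<psi>" and L: "left_module L"
    and eq: "\<And>e. e \<in> carrier L \<Longrightarrow>
      ob_map 2 E (src E) (\<phi> e) = ob_map 2 E (tgt E) (\<psi> e)"
    and X: "X \<in> carrier (tens H 2 L)"
  shows "ob_map 3 E (src E) (ar_plug m E \<phi> X)
      = ob_map 3 E (tgt E) (ar_plug m E \<psi> X)"
    and "ar_plug m E (\<lambda>e. after 2 E (\<phi> e) (\<psi> e)) X
      = after 3 E (ar_plug m E \<phi> X) (ar_plug m E \<psi> X)"
proof -
  let ?src = "ob_map 3 E (src E)" and ?tgt = "ob_map 3 E (tgt E)"
    and ?cmp = "after 3 E" and ?T = "tens H 3 (Ar E)"
    and ?\<phi> = "ar_plug m E \<phi> X" and ?\<psi> = "ar_plug m E \<psi> X"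
  note d = left_2moduleD[OF E]
  interpret T: group_category "tens_cat H 2 E" by (rule group_category_tens_cat[OF pos2 E])
  interpret T3: group_category "tens_cat H 3 E" by (rule group_category_tens_cat[OF pos3 E])
  interpret A: comm_group "tens H 3 (Ar E)" by (rule comm_group_tens[OF pos3 d(2)])
  have src\<phi>: "slot_linear m L (Ob E) (\<lambda>e. ob_map 2 E (src E) (\<phi> e))"
    by (rule slot_linear_tens_map[OF d(2,1,3) \<phi>])
  have tgt\<psi>: "slot_linear m L (Ob E) (\<lambda>e. ob_map 2 E (tgt E) (\<psi> e))"
    by (rule slot_linear_tens_map[OF d(2,1,4) \<psi>])
  have isrc\<phi>: "slot_linear m L (Ar E) (\<lambda>e. ar_map 2 E (idn E) (ob_map 2 E (src E) (\<phi> e)))"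
    by (rule slot_linear_tens_map[OF d(1,2,5) src\<phi>])
  show 1: "?src ?\<phi>
      = ?tgt ?\<psi>"
    using tens_map_plug[OF m L d(2,1,3) \<phi> X] tens_map_plug[OF m L d(2,1,4) \<psi> X]
      plug_cong[OF m L d(1) tgt\<psi> eq X] by simp
  let ?k = "\<lambda>e. after 2 E (\<phi> e) (\<psi> e)"
  have k: "slot_linear m L (Ar E) ?k" by (rule slot_linear_cmp[OF E \<phi> \<psi> L eq])
  have keq: "?k e \<boxplus>\<^bsub>tens H 2 (Ar E)\<^esub> ar_map 2 E (idn E) (ob_map 2 E (src E) (\<phi> e))
      = \<phi> e \<boxplus>\<^bsub>tens H 2 (Ar E)\<^esub> \<psi> e" if "e \<in> carrier L" for e
    using T.cmp_add_idn[of "\<phi> e" "\<psi> e"] slot_linearD(2)[OF \<phi> that] slot_linearD(2)[OF \<psi> that]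
        eq[OF that]
    by (simp add: tens_cat_simps)
  let ?i = "ar_map 3 E (idn E) (?src ?\<phi>)"
  note p = plug_closed[OF m L d(2) \<phi> X] plug_closed[OF m L d(2) \<psi> X] plug_closed[OF m L d(2) k X]
  have i: "?i \<in> carrier (tens H 3 (Ar E))"
    by (rule tens_map_closed[OF pos3 d(1,2,5) tens_map_closed[OF pos3 d(2,1,3) p(1)]])
  have "ar_plug m E ?k X \<boxplus>\<^bsub>?T\<^esub> ?i
      = ?\<phi> \<boxplus>\<^bsub>?T\<^esub> ?\<psi>"
    using plug_add[OF m L d(2) k isrc\<phi> X] plug_add[OF m L d(2) \<phi> \<psi> X]
      plug_cong[OF m L d(2) slot_linear_add[OF d(2) \<phi> \<psi>] keq X]
      tens_map_plug[OF m L d(2,1,3) \<phi> X] tens_map_plug[OF m L d(1,2,5) src\<phi> X] by simp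
  also have "\<dots> = ?cmp ?\<phi> ?\<psi>
      \<boxplus>\<^bsub>?T\<^esub> ?i"
    using T3.cmp_add_idn[of "?\<phi>" "?\<psi>"] p 1
    by (simp add: tens_cat_simps)
  finally show "ar_plug m E ?k X
      = ?cmp ?\<phi> ?\<psi>"
    using A.right_cancel[OF i p(3) T3.cmp_closed[unfolded tens_cat_simps, OF p(1,2) 1]] by simp
qed

section \<open>Substitution of the second component of a morphism\<close>

text \<open>In the application \<phi> is \<open>F2\<close> with one argument frozen,
  \<open>c0\<close>, \<open>d0\<close>, \<open>d1\<close> are brackets with that argument,
  \<open>Z\<close> is a bracket and \<Phi> the value of \<open>F2\<close> ending over it. The second
  arrow ends where the first begins: they are the two factors of \<open>F2_right\<close> and of
  \<open>F2_left\<close>.\<close>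

lemma plug_morphism:
  assumes m: "m < 2" and C: "left_2module C" and D: "left_2module D"
    and f0: "left_hom (Ob C) (Ob D) f0"
    and \<phi>: "slot_linear m (Ob C) (Ar D) \<phi>" and c0: "slot_linear m (Ob C) (Ob C) c0"
    and d0: "slot_linear m (Ob D) (Ob D) d0" and d1: "slot_linear m (Ar D) (Ar D) d1"
    and d1_arr: "\<And>f. f \<in> carrier (Ar D) \<Longrightarrow> arrow 2 D (d1 f) (d0 (src D f)) (d0 (tgt D f))"
    and \<phi>_arr: "\<And>u. u \<in> carrier (Ob C)
      \<Longrightarrow> arrow 2 D (\<phi> u) (d0 (f0 u)) (ob_map 2 D f0 (c0 u))"
    and Z: "Z \<in> carrier (tens H 2 (Ob C))"
    and \<Phi>: "arrow 2 D \<Phi> X (ob_map 2 D f0 Z)"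
  shows "arrow 3 D (ar_plug m D \<phi> Z)
      (ob_plug m D d0 (ob_map 2 D f0 Z)) (ob_map 3 D f0 (ob_plug m C c0 Z))" (is "PROP ?A")
    and "arrow 3 D (ar_plug m D d1 \<Phi>)
      (ob_plug m D d0 X) (ob_plug m D d0 (ob_map 2 D f0 Z))" (is "PROP ?B")
proof -
  note c = left_2moduleD[OF C] and d = left_2moduleD[OF D]
  note simps = tens_cat_simps arrow_from_to_def
  have \<phi>s: "ob_map 2 D (src D) (\<phi> u) = d0 (f0 u)"
    and \<phi>t: "ob_map 2 D (tgt D) (\<phi> u) = ob_map 2 D f0 (c0 u)"
    if "u \<in> carrier (Ob C)" for u
    using \<phi>_arr[OF that] by (simp_all add: simps)
  have d1s: "ob_map 2 D (src D) (d1 f) = d0 (src D f)"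
    and d1t: "ob_map 2 D (tgt D) (d1 f) = d0 (tgt D f)"
    if "f \<in> carrier (Ar D)" for f
    using d1_arr[OF that] by (simp_all add: simps)
  note pm = plug_tens_map[OF m] and mp = tens_map_plug[OF m] and pc = plug_cong[OF m]
  show "PROP ?A"
    unfolding simps
    using plug_closed[OF m c(1) d(2) \<phi> Z] mp[OF c(1) d(2,1,3) \<phi> Z] mp[OF c(1) d(2,1,4) \<phi> Z]
      pm[OF c(1) d(1) d(1) f0 d0 Z] mp[OF c(1) c(1) d(1) f0 c0 Z]
      pc[OF c(1) d(1) slot_linear_compose[OF f0 d0] \<phi>s Z]
      pc[OF c(1) d(1) slot_linear_tens_map[OF c(1) d(1) f0 c0] \<phi>t Z]
    by simp
  have \<Phi>': "\<Phi> \<in> carrier (tens H 2 (Ar D))" "ob_map 2 D (src D) \<Phi> = X"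
    "ob_map 2 D (tgt D) \<Phi> = ob_map 2 D f0 Z"
    using \<Phi> by (simp_all add: simps)
  show "PROP ?B"
    unfolding simps
    using plug_closed[OF m d(2) d(2) d1 \<Phi>'(1)] mp[OF d(2) d(2,1,3) d1 \<Phi>'(1)] mp[OF d(2) d(2,1,4)
        d1 \<Phi>'(1)]
      pm[OF d(2) d(1) d(1) d(3) d0 \<Phi>'(1)] pm[OF d(2) d(1) d(1) d(4) d0 \<Phi>'(1)]
      pc[OF d(2) d(1) slot_linear_compose[OF d(3) d0] d1s \<Phi>'(1)]
      pc[OF d(2) d(1) slot_linear_compose[OF d(4) d0] d1t \<Phi>'(1)] \<Phi>'(2,3)
    by simp
qed

text \<open>Both sides of \<open>nat\<close> are slot linear in the arrow \<open>f\<close>, so the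
  equation may be substituted along the tensored arrow \<Phi>; \<open>plug_cmp\<close> turns the
  pointwise composites into composites, and the ends \<open>W\<close>, \<open>W'\<close> of \<Phi>
  replace the source and target of \<open>f\<close>.\<close>

lemma plug_naturality:
  assumes m: "m < 2" and D: "left_2module D" and E: "left_2module E"
      and G: "internal_functor D E G0 G1"
    and \<gamma>: "slot_linear m (Ob D) (Ar E) \<gamma>"
    and d0: "slot_linear m (Ob D) (Ob D) d0" and d1: "slot_linear m (Ar D) (Ar D) d1"
    and e0: "slot_linear m (Ob E) (Ob E) e0" and e1: "slot_linear m (Ar E) (Ar E) e1"
    and d1_arr: "\<And>f. f \<in> carrier (Ar D) \<Longrightarrow> arrow 2 D (d1 f) (d0 (src D f)) (d0 (tgt D f))"
    and e1_arr: "\<And>f. f \<in> carrier (Ar E) \<Longrightarrow> arrow 2 E (e1 f) (e0 (src E f)) (e0 (tgt E f))"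
    and \<gamma>_arr: "\<And>v. v \<in> carrier (Ob D) \<Longrightarrow> arrow 2 E (\<gamma> v) (e0 (G0 v)) (ob_map 2 E G0 (d0 v))"
    and nat: "\<And>f. f \<in> carrier (Ar D) \<Longrightarrow> after 2 E (\<gamma> (tgt D f)) (e1 (G1 f))
      = after 2 E (ar_map 2 E G1 (d1 f)) (\<gamma> (src D f))"
    and \<Phi>: "arrow 2 D \<Phi> W W'"
  shows "after 3 E (ar_plug m E \<gamma> W') (ar_plug m E e1 (ar_map 2 E G1 \<Phi>))
    = after 3 E (ar_map 3 E G1 (ar_plug m D d1 \<Phi>)) (ar_plug m E \<gamma> W)"
proof -
  note d = left_2moduleD[OF D] and e = left_2moduleD[OF E] and g = internal_functorD[OF G]
  note simps = tens_cat_simps arrow_from_to_def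
  have \<Phi>': "\<Phi> \<in> carrier (tens H 2 (Ar D))" "ob_map 2 D (src D) \<Phi> = W" "ob_map 2 D (tgt D) \<Phi> = W'"
    using \<Phi> by (simp_all add: simps)
  note \<gamma>t = slot_linear_compose[OF d(4) \<gamma>] and \<gamma>s = slot_linear_compose[OF d(3) \<gamma>]
    and eG = slot_linear_compose[OF g(2) e1] and Gd = slot_linear_tens_map[OF d(2) e(2) g(2) d1]
  have \<gamma>D: "ob_map 2 E (src E) (\<gamma> v) = e0 (G0 v)" "ob_map 2 E (tgt E) (\<gamma> v) = ob_map 2 E G0 (d0 v)"
    if "v \<in> carrier (Ob D)" for v
    using \<gamma>_arr[OF that] by (simp_all add: simps)
  have eq2: "ob_map 2 E (src E) (\<gamma> (tgt D f)) = ob_map 2 E (tgt E) (e1 (G1 f))"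
    if "f \<in> carrier (Ar D)" for f
    using e1_arr[OF left_homD(2)[OF g(2) that]] that by (simp add: \<gamma>D left_homD(2)[OF d(4)] g simps)
  have eq3: "ob_map 2 E (src E) (ar_map 2 E G1 (d1 f)) = ob_map 2 E (tgt E) (\<gamma> (src D f))"
    if "f \<in> carrier (Ar D)" for f
    using group_functor_arrow[OF group_functor_tens_map[OF pos2 D E G] d1_arr[OF that]] that
    by (simp add: \<gamma>D left_homD(2)[OF d(3)] simps)
  show ?thesis
    using plug_cmp(2)[OF m E \<gamma>t eG d(2) eq2 \<Phi>'(1)] plug_cmp(2)[OF m E Gd \<gamma>s d(2) eq3 \<Phi>'(1)]
      plug_cong[OF m d(2) e(2) slot_linear_cmp[OF E Gd \<gamma>s d(2) eq3] nat \<Phi>'(1)]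
      plug_tens_map[OF m d(2,1) e(2) d(4) \<gamma> \<Phi>'(1)] plug_tens_map[OF m d(2) e(2) e(2) g(2) e1 \<Phi>'(1)]
      tens_map_plug[OF m d(2) d(2) e(2) g(2) d1 \<Phi>'(1)] plug_tens_map[OF m d(2,1) e(2) d(3) \<gamma>
          \<Phi>'(1)] \<Phi>'(2,3)
    by simp
qed

text \<open>The slot-wise form of the compatibility of \<open>(GF)\<^sub>2\<close> with the Jacobiators.  Here
  \<open>\<phi>\<close> and \<open>\<gamma>\<close> stand for \<open>F\<^sub>2\<close> and \<open>G\<^sub>2\<close> with one argument fixed, \<open>\<psi>\<close> for their
  composite, and \<open>c0\<close>, \<open>d0, d1\<close>, \<open>e0, e1\<close> for the brackets with that argument on objects
  and arrows.\<close>

lemma plug_comp_morphisms: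
  assumes m: "m < 2" and C: "left_2module C" and D: "left_2module D" and E: "left_2module E"
    and f0: "left_hom (Ob C) (Ob D) f0" and G: "internal_functor D E G0 G1"
    and \<phi>: "slot_linear m (Ob C) (Ar D) \<phi>" and \<gamma>: "slot_linear m (Ob D) (Ar E) \<gamma>"
    and c0: "slot_linear m (Ob C) (Ob C) c0"
    and d0: "slot_linear m (Ob D) (Ob D) d0" and d1: "slot_linear m (Ar D) (Ar D) d1"
    and e0: "slot_linear m (Ob E) (Ob E) e0" and e1: "slot_linear m (Ar E) (Ar E) e1"
    and d1_arr: "\<And>f. f \<in> carrier (Ar D) \<Longrightarrow> arrow 2 D (d1 f) (d0 (src D f)) (d0 (tgt D f))"
    and e1_arr: "\<And>f. f \<in> carrier (Ar E) \<Longrightarrow> arrow 2 E (e1 f) (e0 (src E f)) (e0 (tgt E f))"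
    and e1_idn: "\<And>x. x \<in> carrier (Ob E) \<Longrightarrow> e1 (idn E x) = one_at 2 E (e0 x)"
    and \<phi>_arr: "\<And>u. u \<in> carrier (Ob C) \<Longrightarrow> arrow 2 D (\<phi> u) (d0 (f0 u)) (ob_map 2 D f0 (c0 u))"
    and \<gamma>_arr: "\<And>v. v \<in> carrier (Ob D) \<Longrightarrow> arrow 2 E (\<gamma> v) (e0 (G0 v)) (ob_map 2 E G0 (d0 v))"
    and nat: "\<And>f. f \<in> carrier (Ar D) \<Longrightarrow> after 2 E (\<gamma> (tgt D f)) (e1 (G1 f))
      = after 2 E (ar_map 2 E G1 (d1 f)) (\<gamma> (src D f))"
    and Z: "Z \<in> carrier (tens H 2 (Ob C))"
    and \<Phi>: "arrow 2 D \<Phi> W (ob_map 2 D f0 Z)" and \<Gamma>: "arrow 2 E \<Gamma> V (ob_map 2 E G0 W)"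
    and \<psi>: "\<And>u. u \<in> carrier (Ob C) \<Longrightarrow> \<psi> u = after 2 E (ar_map 2 E G1 (\<phi> u)) (\<gamma> (f0 u))"
  shows "after 3 E (ar_plug m E \<psi> Z) (ar_plug m E e1 (after 2 E (ar_map 2 E G1 \<Phi>) \<Gamma>))
    = after 3 E (ar_map 3 E G1 (after 3 D (ar_plug m D \<phi> Z) (ar_plug m D d1 \<Phi>)))
      (after 3 E (ar_plug m E \<gamma> W) (ar_plug m E e1 \<Gamma>))"
proof -
  note c = left_2moduleD[OF C] and d = left_2moduleD[OF D] and e = left_2moduleD[OF E]
  note g = internal_functorD[OF G] and simps = tens_cat_simps arrow_from_to_def
  interpret D2: group_category "tens_cat H 2 D" by (rule group_category_tens_cat[OF pos2 D])
  interpret D3: group_category "tens_cat H 3 D" by (rule group_category_tens_cat[OF pos3 D])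
  interpret E2: group_category "tens_cat H 2 E" by (rule group_category_tens_cat[OF pos2 E])
  interpret E3: group_category "tens_cat H 3 E" by (rule group_category_tens_cat[OF pos3 E])
  note G2 = group_functor_tens_map[OF pos2 D E G] and G3 = group_functor_tens_map[OF pos3 D E G]
  note G\<Phi> = group_functor_arrow[OF G2 \<Phi>]
  have W: "W \<in> carrier (tens H 2 (Ob D))" using D2.arrow_src_closed[OF \<Phi>] by (simp add: simps)
  have f0Z: "ob_map 2 D f0 Z \<in> carrier (tens H 2 (Ob D))"
    by (rule tens_map_closed[OF pos2 c(1) d(1) f0 Z])
  let ?after = "after 3 E" and ?G = "ar_map 3 E G1"
  define T where "T = ar_plug m D \<phi> Z"
  define R where "R = ar_plug m D d1 \<Phi>"
  define TG where "TG = ar_plug m E \<gamma> W"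
  define RG where "RG = ar_plug m E e1 \<Gamma>"
  define T' where "T' = ar_plug m E \<gamma> (ob_map 2 D f0 Z)"
  define R' where "R' = ar_plug m E e1 (ar_map 2 E G1 \<Phi>)"
  note TR = plug_morphism[OF m C D f0 \<phi> c0 d0 d1 d1_arr \<phi>_arr Z \<Phi>, folded T_def R_def]
  note TRG = plug_morphism[OF m D E g(1) \<gamma> d0 e0 e1 e1_arr \<gamma>_arr W \<Gamma>, folded TG_def RG_def]
  note TR' = plug_morphism[OF m D E g(1) \<gamma> d0 e0 e1 e1_arr \<gamma>_arr f0Z G\<Phi>, folded T'_def R'_def]
  note GT = group_functor_arrow[OF G3 TR(1)] and GR = group_functor_arrow[OF G3 TR(2)]
  note G\<phi> = slot_linear_tens_map[OF d(2) e(2) g(2) \<phi>] and \<gamma>f = slot_linear_compose[OF f0 \<gamma>]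
  have eq: "ob_map 2 E (src E) (ar_map 2 E G1 (\<phi> u)) = ob_map 2 E (tgt E) (\<gamma> (f0 u))"
    if "u \<in> carrier (Ob C)" for u
    using group_functor_arrow[OF G2 \<phi>_arr[OF that]] \<gamma>_arr[OF left_homD(2)[OF f0 that]]
        by (simp add: simps)
  have TGF: "ar_plug m E \<psi> Z = ?after (?G T) T'"
    using plug_cong[OF m c(1) e(2) slot_linear_cmp[OF E G\<phi> \<gamma>f c(1) eq] \<psi> Z]
      plug_cmp(2)[OF m E G\<phi> \<gamma>f c(1) eq Z] tens_map_plug[OF m c(1) d(2) e(2) g(2) \<phi> Z]
      plug_tens_map[OF m c(1) d(1) e(2) f0 \<gamma> Z]
    by (simp add: T_def T'_def)
  have e1D: "ob_map 2 E (src E) (e1 f) = e0 (src E f)" "ob_map 2 E (tgt E) (e1 f) = e0 (tgt E f)"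
    if "f \<in> carrier (Ar E)" for f
    using e1_arr[OF that] by (simp_all add: simps)
  have RGF: "ar_plug m E e1 (after 2 E (ar_map 2 E G1 \<Phi>) \<Gamma>) = ?after R' RG"
    unfolding R'_def RG_def
    by (rule group_functor_cmp_arrow[OF E2.group_category_axioms E3.group_category_axioms
          group_functor_plug[OF m E E e0 e1 e1D e1_idn[unfolded tens_cat_simps]] G\<Phi> \<Gamma>])
  have N: "?after T' R' = ?after (?G R) TG"
    unfolding T'_def R'_def R_def TG_def
    by (rule plug_naturality[OF m D E G \<gamma> d0 d1 e0 e1 d1_arr e1_arr \<gamma>_arr nat \<Phi>])
  \<comment> \<open>Of the four arrows the outer two stay. The middle pair \<open>T'\<close>,
    \<open>R'\<close> is exchanged by naturality for \<open>?G R\<close>, \<open>TG\<close>, which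
    brings the two arrows of the first morphism together under \<open>?G\<close>.\<close>
  have "?after (?after (?G T) T') (?after R' RG) = ?after (?G T) (?after (?after T' R') RG)"
    using E3.cmp_assoc_arrow[OF GT TR'(1) E3.arrow_cmp[OF TR'(2) TRG(2)]]
        E3.cmp_assoc_arrow[OF TR' TRG(2)]
    by simp
  also have "\<dots> = ?after (?after (?G T) (?G R)) (?after TG RG)"
    using E3.cmp_assoc_arrow[OF GR TRG] E3.cmp_assoc_arrow[OF GT GR E3.arrow_cmp[OF TRG]]
        by (simp add: N)
  also have "?after (?G T) (?G R) = ?G (after 3 D T R)"
    by (rule group_functor_cmp_arrow[OF D3.group_category_axioms E3.group_category_axioms G3 TR,
      symmetric])
  finally show ?thesis
    unfolding TGF RGF by (simp add: T_def R_def TG_def RG_def)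
qed

section \<open>Bilinear maps and the two slots of the bracket\<close>

lemma polylinear2I:
  assumes "\<And>x y. x \<in> carrier L \<Longrightarrow> y \<in> carrier L \<Longrightarrow> b x y \<in> carrier (tens H 2 M)"
    and "\<And>x x' y. x \<in> carrier L \<Longrightarrow> x' \<in> carrier L \<Longrightarrow> y \<in> carrier L
      \<Longrightarrow> b (x \<boxplus>\<^bsub>L\<^esub> x') y = b x y \<boxplus>\<^bsub>tens H 2 M\<^esub> b x' y"
    and "\<And>x y y'. x \<in> carrier L \<Longrightarrow> y \<in> carrier L \<Longrightarrow> y' \<in> carrier L
      \<Longrightarrow> b x (y \<boxplus>\<^bsub>L\<^esub> y') = b x y \<boxplus>\<^bsub>tens H 2 M\<^esub> b x y'"
    and "\<And>h g x y. x \<in> carrier L \<Longrightarrow> y \<in> carrier L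
      \<Longrightarrow> b (act L h x) (act L g y) = act (tens H 2 M) (ptens H [h, g]) (b x y)"
  shows "polylinear H 2 L M (\<lambda>xs. b (xs ! 0) (xs ! 1))"
  unfolding polylinear_def
proof (intro allI impI conjI ballI; (elim conjE)?)
  fix xs assume "length xs = 2" and xs: "set xs \<subseteq> carrier L"
  then obtain x y where xy: "xs = [x, y]" by (auto simp: length_Suc_conv numeral_2_eq_2)
  then have c: "x \<in> carrier L" "y \<in> carrier L" using xs by auto
  show "b (xs ! 0) (xs ! 1) \<in> carrier (tens H 2 M)" using assms(1) c by (simp add: xy)
  show "b (xs[i := u \<boxplus>\<^bsub>L\<^esub> v] ! 0) (xs[i := u \<boxplus>\<^bsub>L\<^esub> v] ! 1)
      = b (xs[i := u] ! 0) (xs[i := u] ! 1) \<boxplus>\<^bsub>tens H 2 M\<^esub> b (xs[i := v] ! 0) (xs[i := v] ! 1)"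
    if "i < 2" "u \<in> carrier L" "v \<in> carrier L" for i u v
  proof -
    have "i = 0 \<or> i = 1" using that(1) by auto
    then show ?thesis using assms(2,3) c that by (auto simp: xy)
  qed
  show "b (map2 (act L) hs xs ! 0) (map2 (act L) hs xs ! 1)
      = act (tens H 2 M) (ptens H hs) (b (xs ! 0) (xs ! 1))"
    if hs: "length hs = 2" for hs
  proof -
    obtain h g where "hs = [h, g]" using hs by (auto simp: length_Suc_conv numeral_2_eq_2)
    then show ?thesis using assms(4) c by (simp add: xy)
  qed
qed

lemma polylinear2D:
  assumes "polylinear H 2 L M (\<lambda>xs. b (xs ! 0) (xs ! 1))" and c: "x \<in> carrier L" "y \<in> carrier L"
  shows "b x y \<in> carrier (tens H 2 M)"
    and "x' \<in> carrier L \<Longrightarrow> b (x \<boxplus>\<^bsub>L\<^esub> x') y = b x y \<boxplus>\<^bsub>tens H 2 M\<^esub> b x' y"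
    and "y' \<in> carrier L \<Longrightarrow> b x (y \<boxplus>\<^bsub>L\<^esub> y') = b x y \<boxplus>\<^bsub>tens H 2 M\<^esub> b x y'"
    and "b (act L h x) (act L g y) = act (tens H 2 M) (ptens H [h, g]) (b x y)" (is "PROP ?A")
proof -
  have xs: "length [x, y] = 2 \<and> set [x, y] \<subseteq> carrier L" using c by simp
  note p = assms(1)[unfolded polylinear_def, rule_format, OF xs]
  show "b x y \<in> carrier (tens H 2 M)" using p by simp
  show "b (x \<boxplus>\<^bsub>L\<^esub> x') y = b x y \<boxplus>\<^bsub>tens H 2 M\<^esub> b x' y" if "x' \<in> carrier L"
    using p[THEN conjunct2, THEN conjunct1, rule_format, of 0 x x'] c that by simp
  show "b x (y \<boxplus>\<^bsub>L\<^esub> y') = b x y \<boxplus>\<^bsub>tens H 2 M\<^esub> b x y'" if "y' \<in> carrier L"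
    using p[THEN conjunct2, THEN conjunct1, rule_format, of 1 y y'] c that by simp
  show "PROP ?A"
    using p[THEN conjunct2, THEN conjunct2, rule_format, of "[h, g]"] by simp
qed

lemma polylinear2_slot:
  assumes b: "polylinear H 2 L M (\<lambda>xs. b (xs ! 0) (xs ! 1))" and L: "left_module L"
      and x: "x \<in> carrier L"
  shows "slot_linear 0 L M (\<lambda>e. b e x)" and "slot_linear 1 L M (\<lambda>e. b x e)"
proof -
  show "slot_linear 0 L M (\<lambda>e. b e x)"
    using polylinear2D[OF b _ x] polylinear2D(4)[OF b _ x, where g = 1] left_moduleD(6)[OF L x]
    by (simp add: slot_linear_def hom_def)
  show "slot_linear 1 L M (\<lambda>e. b x e)"
    using polylinear2D[OF b x] polylinear2D(4)[OF b x, where h = 1] left_moduleD(6)[OF L x]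
    by (simp add: slot_linear_def hom_def)
qed

lemma lie2_pseudoalgebraD:
  assumes "lie2_pseudoalgebra H C"
  shows "left_2module C"
    and "polylinear H 2 (Ob C) (Ob C) (\<lambda>xs. br0 C (xs ! 0) (xs ! 1))"
    and "polylinear H 2 (Ar C) (Ar C) (\<lambda>fs. br1 C (fs ! 0) (fs ! 1))"
    and "f \<in> carrier (Ar C) \<Longrightarrow> g \<in> carrier (Ar C) \<Longrightarrow>
      arrow 2 C (br1 C f g) (br0 C (src C f) (src C g)) (br0 C (tgt C f) (tgt C g))"
    and "x \<in> carrier (Ob C) \<Longrightarrow> y \<in> carrier (Ob C) \<Longrightarrow>
      br1 C (idn C x) (idn C y) = one_at 2 C (br0 C x y)"
    and "x \<in> carrier (Ob C) \<Longrightarrow> y \<in> carrier (Ob C) \<Longrightarrow> z \<in> carrier (Ob C) \<Longrightarrow>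
      arrow 3 C (jac C x y z) (jsrc0 H C x y z) (jtgt0 H C x y z)"
  using assms unfolding lie2_pseudoalgebra_def lie2_bracket_def lie2_jacobiator_def iso_from_to_def
  by blast+

text \<open>Freezing an object on the level of objects and its identity on the level of arrows makes
  the bracket functorial in the remaining argument; these are the data that the substitution lemmas
  ask for.\<close>

lemma bracket_slots:
  assumes C: "lie2_pseudoalgebra H C" and x: "x \<in> carrier (Ob C)"
  shows "slot_linear 0 (Ob C) (Ob C) (\<lambda>e. br0 C e x)" (is "PROP ?A")
      "slot_linear 1 (Ob C) (Ob C) (\<lambda>e. br0 C x e)"
    and "slot_linear 0 (Ar C) (Ar C) (\<lambda>e. br1 C e (idn C x))" (is "PROP ?B")
        "slot_linear 1 (Ar C) (Ar C) (\<lambda>e. br1 C (idn C x) e)"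
    and "f \<in> carrier (Ar C) \<Longrightarrow> arrow 2 C (br1 C f (idn C x)) (br0 C (src C f) x)
        (br0 C (tgt C f) x)" (is "PROP ?C")
    and "f \<in> carrier (Ar C) \<Longrightarrow> arrow 2 C (br1 C (idn C x) f) (br0 C x (src C f)) (br0 C x (tgt C f))"
proof -
  note c = lie2_pseudoalgebraD[OF C] and m = left_2moduleD[OF lie2_pseudoalgebraD(1)[OF C]]
  have i: "idn C x \<in> carrier (Ar C)" by (rule left_homD(2)[OF m(5) x])
  show "PROP ?A" "slot_linear 1 (Ob C) (Ob C) (\<lambda>e. br0 C x e)"
    by (rule polylinear2_slot[OF c(2) m(1) x])+
  show "PROP ?B" "slot_linear 1 (Ar C) (Ar C) (\<lambda>e. br1 C (idn C x) e)"
    by (rule polylinear2_slot[OF c(3) m(2) i])+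
  show "PROP ?C"
    "f \<in> carrier (Ar C) \<Longrightarrow> arrow 2 C (br1 C (idn C x) f) (br0 C x (src C f)) (br0 C x (tgt C f))"
    using c(4)[OF _ i, of f] c(4)[OF i, of f] m(7,8)[OF x] by simp_all
qed

section \<open>Morphisms: the functorial part and the Jacobi compatibility\<close>

text \<open>What remains of a morphism without extensionality and without the compatibility with the
  Jacobiators. Since all arrows of a tensored category are invertible, an arrow is asked for in
  place of an isomorphism.\<close>

definition lie2_premorphism ::
  "('h, 'o, 'a) lie2 \<Rightarrow> ('h, 'p, 'b) lie2 \<Rightarrow> ('h, 'o, 'a, 'p, 'b) lie2_mor \<Rightarrow> bool" where
  "lie2_premorphism C D F \<longleftrightarrow>
     internal_functor C D (F0 F) (F1 F) \<and>
     polylinear H 2 (Ob C) (Ar D) (\<lambda>xs. F2 F (xs ! 0, xs ! 1)) \<and>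
     (\<forall>x \<in> carrier (Ob C). \<forall>y \<in> carrier (Ob C).
        arrow 2 D (F2 F (x, y))
          (br0 D (F0 F x) (F0 F y)) (ob_map 2 D (F0 F) (br0 C x y))) \<and>
     (\<forall>f \<in> carrier (Ar C). \<forall>g \<in> carrier (Ar C).
        after 2 D (F2 F (tgt C f, tgt C g)) (br1 D (F1 F f) (F1 F g))
        = after 2 D (ar_map 2 D (F1 F) (br1 C f g)) (F2 F (src C f, src C g)))"

lemma lie2_premorphismD:
  assumes "lie2_premorphism C D F"
  shows "internal_functor C D (F0 F) (F1 F)"
    and "polylinear H 2 (Ob C) (Ar D) (\<lambda>xs. F2 F (xs ! 0, xs ! 1))"
    and "x \<in> carrier (Ob C) \<Longrightarrow> y \<in> carrier (Ob C) \<Longrightarrow>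
      arrow 2 D (F2 F (x, y)) (br0 D (F0 F x) (F0 F y)) (ob_map 2 D (F0 F) (br0 C x y))"
    and "f \<in> carrier (Ar C) \<Longrightarrow> g \<in> carrier (Ar C) \<Longrightarrow>
      after 2 D (F2 F (tgt C f, tgt C g)) (br1 D (F1 F f) (F1 F g))
      = after 2 D (ar_map 2 D (F1 F) (br1 C f g)) (F2 F (src C f, src C g))"
  using assms unfolding lie2_premorphism_def by blast+

lemma F2_slots:
  assumes F: "lie2_premorphism C D F" and C: "left_2module C" and x: "x \<in> carrier (Ob C)"
  shows "slot_linear 0 (Ob C) (Ar D) (\<lambda>e. F2 F (e, x))"
      "slot_linear 1 (Ob C) (Ar D) (\<lambda>e. F2 F (x, e))"
  using polylinear2_slot[OF lie2_premorphismD(2)[OF F] left_2moduleD(1)[OF C] x] by simp_all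

definition F2_right ::
  "('h, 'o, 'a) lie2 \<Rightarrow> ('h, 'p, 'b) lie2 \<Rightarrow> ('h, 'o, 'a, 'p, 'b) lie2_mor \<Rightarrow> 'o \<Rightarrow> 'o \<Rightarrow> 'o \<Rightarrow> ('h, 'b)
      tens" where
  "F2_right C D F x y z = after 3 D (ar_plug 1 D (\<lambda>e. F2 F (x, e)) (br0 C y z))
     (rbr1 H D 2 (idn D (F0 F x)) (F2 F (y, z)))"

definition F2_left ::
  "('h, 'o, 'a) lie2 \<Rightarrow> ('h, 'p, 'b) lie2 \<Rightarrow> ('h, 'o, 'a, 'p, 'b) lie2_mor \<Rightarrow> 'o \<Rightarrow> 'o \<Rightarrow> 'o \<Rightarrow> ('h, 'b)
      tens" where
  "F2_left C D F x y z = after 3 D (ar_plug 0 D (\<lambda>e. F2 F (e, z)) (br0 C x y))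
     (lbr1 H D 2 (F2 F (x, y)) (idn D (F0 F z)))"

lemma slots: "(0::nat) < 2" "(1::nat) < 2"
  by simp_all

context
  fixes C :: "('h, 'o, 'a) lie2" and D :: "('h, 'p, 'b) lie2"
      and F :: "('h, 'o, 'a, 'p, 'b) lie2_mor"
  assumes C: "lie2_pseudoalgebra H C" and D: "lie2_pseudoalgebra H D"
      and F: "lie2_premorphism C D F"
begin

private lemmas C_mod = lie2_pseudoalgebraD(1)[OF C] and D_mod = lie2_pseudoalgebraD(1)[OF D]
private lemmas F_hom = internal_functorD[OF lie2_premorphismD(1)[OF F]]
private lemmas F0_closed = left_homD(2)[OF F_hom(1)]

private lemmas br0_closed = polylinear2D(1)[OF lie2_pseudoalgebraD(2)[OF C]]

lemma F2_right_factors: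
  assumes x: "x \<in> carrier (Ob C)" and y: "y \<in> carrier (Ob C)" and z: "z \<in> carrier (Ob C)"
  shows "arrow 3 D (ar_plug 1 D (\<lambda>e. F2 F (x, e)) (br0 C y z))
      (rbr0 H D 2 (F0 F x) (ob_map 2 D (F0 F) (br0 C y z)))
      (ob_map 3 D (F0 F) (rbr0 H C 2 x (br0 C y z)))"
    and "arrow 3 D (rbr1 H D 2 (idn D (F0 F x)) (F2 F (y, z)))
      (rbr0 H D 2 (F0 F x) (br0 D (F0 F y) (F0 F z)))
      (rbr0 H D 2 (F0 F x) (ob_map 2 D (F0 F) (br0 C y z)))"
  by (rule plug_morphism[OF slots(2) C_mod D_mod F_hom(1) F2_slots(2)[OF F C_mod x]
        bracket_slots(2)[OF C x] bracket_slots(2,4,6)[OF D F0_closed[OF x]]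
        lie2_premorphismD(3)[OF F x] br0_closed[OF y z] lie2_premorphismD(3)[OF F y z]];
            assumption)+

lemma F2_left_factors:
  assumes x: "x \<in> carrier (Ob C)" and y: "y \<in> carrier (Ob C)" and z: "z \<in> carrier (Ob C)"
  shows "arrow 3 D (ar_plug 0 D (\<lambda>e. F2 F (e, z)) (br0 C x y))
      (lbr0 H D 2 (ob_map 2 D (F0 F) (br0 C x y)) (F0 F z))
      (ob_map 3 D (F0 F) (jsrc0 H C x y z))"
    and "arrow 3 D (lbr1 H D 2 (F2 F (x, y)) (idn D (F0 F z)))
      (jsrc0 H D (F0 F x) (F0 F y) (F0 F z))
      (lbr0 H D 2 (ob_map 2 D (F0 F) (br0 C x y)) (F0 F z))"
  unfolding jsrc0_def
  by (rule plug_morphism[OF slots(1) C_mod D_mod F_hom(1) F2_slots(1)[OF F C_mod z]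
        bracket_slots(1)[OF C z] bracket_slots(1,3,5)[OF D F0_closed[OF z]]
        lie2_premorphismD(3)[OF F _ z] br0_closed[OF x y] lie2_premorphismD(3)[OF F x y]];
            assumption)+

lemma F2_right_arrow:
  assumes "x \<in> carrier (Ob C)" "y \<in> carrier (Ob C)" "z \<in> carrier (Ob C)"
  shows "arrow 3 D (F2_right C D F x y z)
      (rbr0 H D 2 (F0 F x) (br0 D (F0 F y) (F0 F z))) (ob_map 3 D (F0 F)
          (rbr0 H C 2 x (br0 C y z)))"
  unfolding F2_right_def
  by (rule group_category.arrow_cmp[OF group_category_tens_cat[OF pos3 D_mod]
    F2_right_factors[OF assms]])

lemma F2_left_arrow:
  assumes "x \<in> carrier (Ob C)" "y \<in> carrier (Ob C)" "z \<in> carrier (Ob C)"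
  shows "arrow 3 D (F2_left C D F x y z)
      (jsrc0 H D (F0 F x) (F0 F y) (F0 F z)) (ob_map 3 D (F0 F) (jsrc0 H C x y z))"
  unfolding F2_left_def
  by (rule group_category.arrow_cmp[OF group_category_tens_cat[OF pos3 D_mod]
    F2_left_factors[OF assms]])

text \<open>These ends make pasting possible: the difference starts where the Jacobiator of
  \<open>D\<close> ends, and it ends at the image of the target of the Jacobiator of
  \<open>C\<close>.\<close>

lemma F2_right_alternating_arrow:
  assumes x: "x \<in> carrier (Ob C)" and y: "y \<in> carrier (Ob C)" and z: "z \<in> carrier (Ob C)"
  shows "arrow 3 D (F2_right C D F x y z \<boxminus>\<^bsub>tens H 3 (Ar D)\<^esub> ar_perm D (F2_right C D F y x z))
    (jtgt0 H D (F0 F x) (F0 F y) (F0 F z)) (ob_map 3 D (F0 F) (jtgt0 H C x y z))"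
proof -
  interpret D3: group_category "tens_cat H 3 D" by (rule group_category_tens_cat[OF pos3 D_mod])
  let ?c = "rbr0 H C 2 x (br0 C y z)" and ?c' = "rbr0 H C 2 y (br0 C x z)"
  note m = left_2moduleD(1)[OF C_mod] left_2moduleD(1)[OF D_mod]
  interpret F0: group_hom "tens H 3 (Ob C)" "tens H 3 (Ob D)" "ob_map 3 D (F0 F)"
    by (intro group_homI group_tens pos3 m tens_map_hom F_hom)
  have c: "?c \<in> carrier (tens H 3 (Ob C))" "?c' \<in> carrier (tens H 3 (Ob C))"
    by (rule plug_closed[OF slots(2) m(1,1) bracket_slots(2)[OF C x] br0_closed[OF y z]],
        rule plug_closed[OF slots(2) m(1,1) bracket_slots(2)[OF C y] br0_closed[OF x z]])
  have "ob_map 3 D (F0 F) (jtgt0 H C x y z)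
    = ob_map 3 D (F0 F) ?c \<boxminus>\<^bsub>tens H 3 (Ob D)\<^esub> ob_perm D (ob_map 3 D (F0 F) ?c')"
    using c hom_in_carrier[OF perm_tens_hom[OF m(1)] c(2)] tens_map_perm_tens[OF m F_hom(1) c(2)]
    by (simp add: jtgt0_def del: One_nat_def)
  then show ?thesis
    using D3.arrow_minus[OF F2_right_arrow[OF x y z]
        group_functor_arrow[OF group_functor_perm_tens[OF D_mod]
          F2_right_arrow[OF y x z]]]
    by (simp add: jtgt0_def tens_cat_simps(1,2))
qed

end

definition lie2_coherent ::
  "('h, 'o, 'a) lie2 \<Rightarrow> ('h, 'p, 'b) lie2 \<Rightarrow> ('h, 'o, 'a, 'p, 'b) lie2_mor \<Rightarrow> bool" where
  "lie2_coherent C D F \<longleftrightarrow>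
     (\<forall>x \<in> carrier (Ob C). \<forall>y \<in> carrier (Ob C). \<forall>z \<in> carrier (Ob C).
        after 3 D
          (F2_right C D F x y z \<boxminus>\<^bsub>tens H 3 (Ar D)\<^esub> ar_perm D (F2_right C D F y x z))
          (jac D (F0 F x) (F0 F y) (F0 F z))
        = after 3 D (ar_map 3 D (F1 F) (jac C x y z)) (F2_left C D F x y z))"

text \<open>The definition composes differences: one of brackets with values of \<open>F2\<close>,
  then one of \<open>F2\<close> at brackets. Interchange regroups this term by term into
  \<open>F2_right\<close>, and associativity isolates the Jacobiator of \<open>C\<close> on the
  other side.\<close>

lemma lie2_morphism_iff:
  fixes C :: "('h, 'o, 'a) lie2" and D :: "('h, 'p, 'b) lie2"
  assumes C: "lie2_pseudoalgebra H C" and D: "lie2_pseudoalgebra H D"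
  shows "lie2_morphism H C D F \<longleftrightarrow>
     F0 F \<in> extensional (carrier (Ob C)) \<and> F1 F \<in> extensional (carrier (Ar C)) \<and>
     F2 F \<in> extensional (carrier (Ob C) \<times> carrier (Ob C)) \<and>
     lie2_premorphism C D F \<and> lie2_coherent C D F"
proof -
  interpret D2: group_category "tens_cat H 2 D"
    by (rule group_category_tens_cat[OF pos2 lie2_pseudoalgebraD(1)[OF D]])
  interpret D3: group_category "tens_cat H 3 D"
    by (rule group_category_tens_cat[OF pos3 lie2_pseudoalgebraD(1)[OF D]])
  let ?po = "ob_perm D" and ?p = "ar_perm D"
  note perm = group_functor_perm_tens[OF lie2_pseudoalgebraD(1)[OF D]]
  note cmp_perm = group_functor_cmp_arrow[OF D3.group_category_axioms D3.group_category_axioms perm]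
    and arrow_perm = group_functor_arrow[OF perm]
  let ?R = "\<lambda>x y z. rbr1 H D 2 (idn D (F0 F x)) (F2 F (y, z))"
    and ?T = "\<lambda>x y z. ar_plug 1 D (\<lambda>e. F2 F (x, e)) (br0 C y z)"
  let ?b1 = "\<lambda>x y z. lbr1 H D 2 (F2 F (x, y)) (idn D (F0 F z))"
    and ?b2 = "\<lambda>x y z. ar_plug 0 D (\<lambda>e. F2 F (e, z)) (br0 C x y)"
    and ?b3 = "\<lambda>x y z. ar_map 3 D (F1 F) (jac C x y z)"
  have right: "after 3 D (?T x y z \<boxminus>\<^bsub>tens H 3 (Ar D)\<^esub> ?p (?T y x z))
        (?R x y z \<boxminus>\<^bsub>tens H 3 (Ar D)\<^esub> ?p (?R y x z))
      = F2_right C D F x y z \<boxminus>\<^bsub>tens H 3 (Ar D)\<^esub> ?p (F2_right C D F y x z)"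
    if F: "lie2_premorphism C D F" and xyz: "x \<in> carrier (Ob C)" "y \<in> carrier (Ob C)"
        "z \<in> carrier (Ob C)" for x y z
    using D3.cmp_minus_arrow[OF F2_right_factors[OF C D F xyz]
        arrow_perm[OF F2_right_factors(1)[OF C D F xyz(2,1,3)]]
            arrow_perm[OF F2_right_factors(2)[OF C D F xyz(2,1,3)]]]
      cmp_perm[OF F2_right_factors[OF C D F xyz(2,1,3)]]
    by (simp add: F2_right_def tens_cat_simps(2) del: One_nat_def)
  have left: "after 3 D (after 3 D (?b3 x y z) (?b2 x y z)) (?b1 x y z)
      = after 3 D (?b3 x y z) (F2_left C D F x y z)"
    if F: "lie2_premorphism C D F" and xyz: "x \<in> carrier (Ob C)" "y \<in> carrier (Ob C)"
        "z \<in> carrier (Ob C)" for x y z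
    unfolding F2_left_def
    by (rule D3.cmp_assoc_arrow[OF group_functor_arrow[OF group_functor_tens_map[OF pos3
            lie2_pseudoalgebraD(1)[OF C] lie2_pseudoalgebraD(1)[OF D] lie2_premorphismD(1)[OF F]]
            lie2_pseudoalgebraD(6)[OF C xyz]] F2_left_factors[OF C D F xyz]])
  have coh: "lie2_coherent C D F \<longleftrightarrow>
     (\<forall>x \<in> carrier (Ob C). \<forall>y \<in> carrier (Ob C). \<forall>z \<in> carrier (Ob C).
        after 3 D (after 3 D (?T x y z \<boxminus>\<^bsub>tens H 3 (Ar D)\<^esub> ?p (?T y x z))
          (?R x y z \<boxminus>\<^bsub>tens H 3 (Ar D)\<^esub> ?p (?R y x z))) (jac D (F0 F x) (F0 F y) (F0 F z))
        = after 3 D (after 3 D (?b3 x y z) (?b2 x y z)) (?b1 x y z))"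
    if F: "lie2_premorphism C D F"
    unfolding lie2_coherent_def using right[OF F] left[OF F] by (simp del: One_nat_def)
  show ?thesis
    using coh
    unfolding lie2_morphism_def Let_def D2.iso_from_to_iff lie2_premorphism_def by blast
qed

lemma internal_functor_cong:
  assumes C: "left_2module C" and f: "internal_functor C D f0 f1"
    and eq: "\<And>x. x \<in> carrier (Ob C) \<Longrightarrow> f0' x = f0 x" "\<And>f. f \<in> carrier (Ar C) \<Longrightarrow> f1' f = f1 f"
  shows "internal_functor C D f0' f1'"
proof -
  note c = left_2moduleD[OF C]
  have "cmp C g f \<in> carrier (Ar C)" if "(g, f) \<in> carrier (composable C)" for g f
    using left_homD(2)[OF c(6) that] by simp
  then show ?thesis
    using f left_hom_cong[OF internal_functorD(1)[OF f] eq(1) c(1)]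
        left_hom_cong[OF internal_functorD(2)[OF f] eq(2) c(2)]
      left_homD(2)[OF c(3)] left_homD(2)[OF c(4)] left_homD(2)[OF c(5)]
    unfolding internal_functor_def by (auto simp: eq composable_simps)
qed

lemma internal_functor_compose:
  assumes f: "internal_functor C D f0 f1" and g: "internal_functor D E g0 g1"
  shows "internal_functor C E (\<lambda>x. g0 (f0 x)) (\<lambda>f. g1 (f1 f))"
proof -
  have "(f1 h, f1 k) \<in> carrier (composable D)" if "(h, k) \<in> carrier (composable C)" for h k
    using that internal_functorD[OF f] left_homD(2)[OF internal_functorD(2)[OF f]]
    by (simp add: composable_simps)
  then show ?thesis
    using f g left_hom_compose[OF internal_functorD(1)[OF f] internal_functorD(1)[OF g]]
      left_hom_compose[OF internal_functorD(2)[OF f] internal_functorD(2)[OF g]]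
      left_homD(2)[OF internal_functorD(1)[OF f]] left_homD(2)[OF internal_functorD(2)[OF f]]
    unfolding internal_functor_def by fastforce
qed

lemma internal_functor_ident:
  "internal_functor C C (\<lambda>x. x) (\<lambda>f. f)"
  by (auto simp: internal_functor_def left_hom_def hom_def)

lemma polylinear2_cong:
  assumes "polylinear H 2 L M (\<lambda>xs. b (xs ! 0) (xs ! 1))" and L: "left_module L"
    and "\<And>x y. x \<in> carrier L \<Longrightarrow> y \<in> carrier L \<Longrightarrow> b' x y = b x y"
  shows "polylinear H 2 L M (\<lambda>xs. b' (xs ! 0) (xs ! 1))"
proof -
  interpret L: comm_group L by (rule left_moduleD(1)[OF L])
  show ?thesis
    by (rule polylinear2I) (simp_all add: assms(3) polylinear2D[OF assms(1)] left_moduleD(2)[OF L])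
qed

lemma polylinear2_tens_map:
  assumes b: "polylinear H 2 L M (\<lambda>xs. b (xs ! 0) (xs ! 1))"
    and M: "left_module M" and N: "left_module N" and f: "left_hom M N f"
  shows "polylinear H 2 L N (\<lambda>xs. tens_map H 2 N f (b (xs ! 0) (xs ! 1)))"
  by (rule polylinear2I)
    (simp_all add: polylinear2D[OF b] tens_map_closed[OF pos2 M N f]
        hom_mult[OF tens_map_hom[OF pos2 M N f]]
      tens_map_act[OF pos2 M N f] ptens_closed)

section \<open>Identities\<close>

lemma lie2_id_simps:
  "x \<in> carrier (Ob C) \<Longrightarrow> F0 (lie2_id H C) x = x"
  "f \<in> carrier (Ar C) \<Longrightarrow> F1 (lie2_id H C) f = f"
  "x \<in> carrier (Ob C) \<Longrightarrow> y \<in> carrier (Ob C) \<Longrightarrow> F2 (lie2_id H C) (x, y) = one_at 2 C (br0 C x y)"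
  by (simp_all add: lie2_id_def)

lemma lie2_id_extensional:
  "F0 (lie2_id H C) \<in> extensional (carrier (Ob C))"
      "F1 (lie2_id H C) \<in> extensional (carrier (Ar C))"
  "F2 (lie2_id H C) \<in> extensional (carrier (Ob C) \<times> carrier (Ob C))"
  by (simp_all add: lie2_id_def)

context
  fixes C :: "('h, 'o, 'a) lie2"
  assumes C: "lie2_pseudoalgebra H C"
begin

text \<open>\<open>F2\<close> is the identity of the bracket, so its bilinearity is that of the
  bracket and its naturality is the two unit laws.\<close>

lemma lie2_id_premorphism: "lie2_premorphism C C (lie2_id H C)"
proof -
  let ?I = "lie2_id H C" and ?cmp = "after 2 C"
  note c = lie2_pseudoalgebraD[OF C]
  note m = left_2moduleD[OF c(1)]
  interpret C2: group_category "tens_cat H 2 C" by (rule group_category_tens_cat[OF pos2 c(1)])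
  have b0: "br0 C x y \<in> carrier (tens H 2 (Ob C))" if "x \<in> carrier (Ob C)" "y \<in> carrier (Ob C)"
      for x y
    by (rule polylinear2D(1)[OF c(2) that])
  have if0: "internal_functor C C (F0 ?I) (F1 ?I)"
    by (rule internal_functor_cong[OF c(1) internal_functor_ident]) (simp_all add: lie2_id_simps)
  have pl: "polylinear H 2 (Ob C) (Ar C) (\<lambda>xs. F2 ?I (xs ! 0, xs ! 1))"
    by (rule polylinear2_cong[OF polylinear2_tens_map[OF c(2) m(1,2,5)] m(1)])
      (simp add: lie2_id_simps tens_cat_simps)
  have ident0: "ob_map 2 C (F0 ?I) X = X" if "X \<in> carrier (tens H 2 (Ob C))" for X
    by (rule tens_map_ident[OF pos2 m(1) _ that]) (simp add: lie2_id_simps)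
  have ident1: "ar_map 2 C (F1 ?I) X = X" if "X \<in> carrier (tens H 2 (Ar C))" for X
    by (rule tens_map_ident[OF pos2 m(2) _ that]) (simp add: lie2_id_simps)
  have arr: "arrow 2 C (F2 ?I (x, y))
      (br0 C (F0 ?I x) (F0 ?I y)) (ob_map 2 C (F0 ?I) (br0 C x y))"
    if "x \<in> carrier (Ob C)" "y \<in> carrier (Ob C)" for x y
    using C2.arrow_idn[of "br0 C x y"] b0[OF that] that
        by (simp add: lie2_id_simps ident0 tens_cat_simps(1))
  have nat: "?cmp (F2 ?I (tgt C f, tgt C g)) (br1 C (F1 ?I f) (F1 ?I g))
      = ?cmp (ar_map 2 C (F1 ?I) (br1 C f g)) (F2 ?I (src C f, src C g))"
    if "f \<in> carrier (Ar C)" "g \<in> carrier (Ar C)" for f g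
    using C2.cmp_idn_arrow[OF c(4)[OF that]] that polylinear2D(1)[OF c(3) that]
    by (simp add: lie2_id_simps left_homD(2)[OF m(3)] left_homD(2)[OF m(4)] ident1)
  show ?thesis
    unfolding lie2_premorphism_def using if0 pl arr nat by blast
qed

text \<open>Substituting identities gives identities, so \<open>F2_left\<close> and
  \<open>F2_right\<close> are identity arrows and the compatibility reduces to the unit laws for the
  Jacobiator.\<close>

lemma lie2_id_morphism: "lie2_morphism H C C (lie2_id H C)"
proof -
  let ?I = "lie2_id H C" and ?cmp = "after 3 C" and ?T = "tens H 3 (Ar C)"
    and ?p = "ar_perm C" and ?po = "ob_perm C"
  note c = lie2_pseudoalgebraD[OF C]
  note m = left_2moduleD[OF c(1)]
  interpret C3: group_category "tens_cat H 3 C" by (rule group_category_tens_cat[OF pos3 c(1)])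
  have b0: "br0 C x y \<in> carrier (tens H 2 (Ob C))" if "x \<in> carrier (Ob C)" "y \<in> carrier (Ob C)"
      for x y
    by (rule polylinear2D(1)[OF c(2) that])
  let ?idn = "one_at 3 C"
  \<comment> \<open>Stated for an arbitrary slot \<open>s\<close> and arbitrary data
    \<open>c0\<close>, \<open>c1\<close>, so that \<open>F2_right\<close> and \<open>F2_left\<close>
    are both instances.\<close>
  have slot: "?cmp (ar_plug s C \<phi> Z) (ar_plug s C c1 (one_at 2 C Z))
      = ?idn (ob_plug s C c0 Z)"
    and slot_cl: "ob_plug s C c0 Z \<in> carrier (Ob (tens_cat H 3 C))"
    if s: "s < 2" and c0: "slot_linear s (Ob C) (Ob C) c0" and c1: "slot_linear s (Ar C) (Ar C) c1"
      and c1_idn: "\<And>x. x \<in> carrier (Ob C) \<Longrightarrow> c1 (idn C x) = one_at 2 C (c0 x)"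
      and \<phi>: "\<And>x. x \<in> carrier (Ob C) \<Longrightarrow> \<phi> x = one_at 2 C (c0 x)"
      and Z: "Z \<in> carrier (tens H 2 (Ob C))" for s c0 c1 \<phi> Z
  proof -
    have cl: "ob_plug s C c0 Z \<in> carrier (tens H 3 (Ob C))"
        by (rule plug_closed[OF s m(1) m(1) c0 Z])
    then show "ob_plug s C c0 Z \<in> carrier (Ob (tens_cat H 3 C))" by (simp add: tens_cat_simps)
    have 1: "ar_plug s C \<phi> Z = ?idn (ob_plug s C c0 Z)"
      using plug_cong[OF s m(1,2) slot_linear_tens_map[OF m(1,2,5) c0] \<phi>[unfolded tens_cat_simps] Z]
        tens_map_plug[OF s m(1) m(1,2,5) c0 Z] by (simp add: tens_cat_simps)
    have 2: "ar_plug s C c1 (one_at 2 C Z) = ?idn (ob_plug s C c0 Z)"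
      using plug_cong[OF s m(1,2) slot_linear_tens_map[OF m(1,2,5) c0]
          c1_idn[unfolded tens_cat_simps] Z]
        tens_map_plug[OF s m(1) m(1,2,5) c0 Z] plug_tens_map[OF s m(1,2) m(2,5) c1 Z]
      by (simp add: tens_cat_simps)
    show "?cmp (ar_plug s C \<phi> Z) (ar_plug s C c1 (one_at 2 C Z))
      = ?idn (ob_plug s C c0 Z)"
      unfolding 1 2 using C3.cmp_idn_arrow(1)[OF C3.arrow_idn] cl by (simp add: tens_cat_simps(1))
  qed
  have right: "F2_right C C (?I) x y z = ?idn (rbr0 H C 2 x (br0 C y z))"
    and right_cl: "rbr0 H C 2 x (br0 C y z) \<in> carrier (Ob (tens_cat H 3 C))"
    if x: "x \<in> carrier (Ob C)" and y: "y \<in> carrier (Ob C)" and z: "z \<in> carrier (Ob C)" for x y z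
  proof -
    note * = bracket_slots(2,4)[OF C x] c(5)[OF x]
    show "F2_right C C (?I) x y z = ?idn (rbr0 H C 2 x (br0 C y z))"
      unfolding F2_right_def
      using slot[OF slots(2) * _ b0[OF y z], of "\<lambda>e. F2 (?I) (x, e)"] x y z
      by (simp add: lie2_id_simps del: One_nat_def)
    show "rbr0 H C 2 x (br0 C y z) \<in> carrier (Ob (tens_cat H 3 C))"
      by (rule slot_cl[OF slots(2) * _ b0[OF y z]]) simp_all
  qed
  have left: "F2_left C C (?I) x y z = ?idn (jsrc0 H C x y z)"
    if x: "x \<in> carrier (Ob C)" and y: "y \<in> carrier (Ob C)" and z: "z \<in> carrier (Ob C)" for x y z
  proof -
    note * = bracket_slots(1,3)[OF C z] c(5)[OF _ z]
    show ?thesis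
      unfolding F2_left_def jsrc0_def
      using slot[OF slots(1) * _ b0[OF x y], of "\<lambda>e. F2 (?I) (e, z)"] x y z
      by (simp add: lie2_id_simps del: One_nat_def)
  qed
  have perm: "?p (?idn X) = ?idn (?po X)"
    "?po X \<in> carrier (Ob (tens_cat H 3 C))"
    if "X \<in> carrier (Ob (tens_cat H 3 C))" for X
    using group_functor_perm_tens[OF c(1)] that unfolding group_functor_def by (auto simp: hom_def)
  have coh: "lie2_coherent C C (?I)"
    unfolding lie2_coherent_def
  proof (intro ballI)
    fix x y z assume x: "x \<in> carrier (Ob C)" and y: "y \<in> carrier (Ob C)" and z: "z \<in> carrier (Ob C)"
    note J = c(6)[OF x y z]
    have "F2_right C C (?I) x y z
        \<boxminus>\<^bsub>?T\<^esub> ?p (F2_right C C (?I) y x z)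
      = ?idn (jtgt0 H C x y z)"
      unfolding jtgt0_def right[OF x y z] right[OF y x z] perm(1)[OF right_cl[OF y x z]]
          tens_cat_simps(1,2)[symmetric]
      using right_cl[OF x y z] perm(2)[OF right_cl[OF y x z]]
      by (simp del: One_nat_def)
    moreover have "ar_map 3 C (F1 (?I)) (jac C x y z) = jac C x y z"
      using J by (intro tens_map_ident[OF pos3 m(2)]) (simp_all add: lie2_id_simps
          arrow_from_to_def tens_cat_simps)
    ultimately show "?cmp
          (F2_right C C (?I) x y z \<boxminus>\<^bsub>?T\<^esub> ?p (F2_right C C (?I) y x z))
          (jac C (F0 (?I) x) (F0 (?I) y) (F0 (?I) z))
        = ?cmp (ar_map 3 C (F1 (?I)) (jac C x y z)) (F2_left C C (?I) x y z)"
      using C3.cmp_idn_arrow[OF J] x y z by (simp add: left lie2_id_simps del: One_nat_def)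
  qed
  show ?thesis
    unfolding lie2_morphism_iff[OF C C] using lie2_id_extensional lie2_id_premorphism coh by blast
qed

end

section \<open>Composition\<close>

lemma lie2_comp_simps:
  "x \<in> carrier (Ob C) \<Longrightarrow> F0 (lie2_comp H C D E G F) x = F0 G (F0 F x)"
  "f \<in> carrier (Ar C) \<Longrightarrow> F1 (lie2_comp H C D E G F) f = F1 G (F1 F f)"
  "x \<in> carrier (Ob C) \<Longrightarrow> y \<in> carrier (Ob C) \<Longrightarrow> F2 (lie2_comp H C D E G F) (x, y)
    = after 2 E (ar_map 2 E (F1 G) (F2 F (x, y))) (F2 G (F0 F x, F0 F y))"
  by (simp_all add: lie2_comp_def)

lemma lie2_comp_extensional:
  "F0 (lie2_comp H C D E G F) \<in> extensional (carrier (Ob C))"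
  "F1 (lie2_comp H C D E G F) \<in> extensional (carrier (Ar C))"
  "F2 (lie2_comp H C D E G F) \<in> extensional (carrier (Ob C) \<times> carrier (Ob C))"
  by (simp_all add: lie2_comp_def)

context
  fixes C :: "('h, 'o, 'a) lie2" and D :: "('h, 'p, 'b) lie2" and E :: "('h, 'q, 'c) lie2"
    and F :: "('h, 'o, 'a, 'p, 'b) lie2_mor" and G :: "('h, 'p, 'b, 'q, 'c) lie2_mor"
  assumes C: "lie2_pseudoalgebra H C" and D: "lie2_pseudoalgebra H D"
      and E: "lie2_pseudoalgebra H E"
    and F: "lie2_premorphism C D F" and G: "lie2_premorphism D E G"
begin

private abbreviation (input) GF :: "('h, 'o, 'a, 'q, 'c) lie2_mor" where
    "GF \<equiv> lie2_comp H C D E G F"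

private lemmas c = lie2_pseudoalgebraD[OF C] and d = lie2_pseudoalgebraD[OF D]
    and e = lie2_pseudoalgebraD[OF E]
private lemmas cm = left_2moduleD[OF c(1)] and dm = left_2moduleD[OF d(1)]
    and em = left_2moduleD[OF e(1)]
private lemmas f = internal_functorD[OF lie2_premorphismD(1)[OF F]]
    and g = internal_functorD[OF lie2_premorphismD(1)[OF G]]
private lemmas f_closed = left_homD(2)[OF f(1)] left_homD(2)[OF f(2)]
private lemmas g_closed = left_homD(2)[OF g(1)] left_homD(2)[OF g(2)]
private lemmas st_closed = left_homD(2)[OF cm(3)] left_homD(2)[OF cm(4)] left_homD(2)[OF dm(3)]
    left_homD(2)[OF dm(4)]

private lemmas tens_functor_G = group_functor_tens_map[OF _ d(1) e(1) lie2_premorphismD(1)[OF G]]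

lemma comp_factors:
  assumes x: "x \<in> carrier (Ob C)" and y: "y \<in> carrier (Ob C)"
  shows "arrow 2 E (ar_map 2 E (F1 G) (F2 F (x, y)))
      (ob_map 2 E (F0 G) (br0 D (F0 F x) (F0 F y)))
      (ob_map 2 E (F0 G) (ob_map 2 D (F0 F) (br0 C x y)))"
    and "arrow 2 E (F2 G (F0 F x, F0 F y))
      (br0 E (F0 G (F0 F x)) (F0 G (F0 F y))) (ob_map 2 E (F0 G) (br0 D (F0 F x) (F0 F y)))"
  by (rule group_functor_arrow[OF tens_functor_G[OF pos2] lie2_premorphismD(3)[OF F x y]],
      rule lie2_premorphismD(3)[OF G f_closed(1)[OF x] f_closed(1)[OF y]])

lemma tens_map_comp:
  assumes "n > 0"
  shows "X \<in> carrier (tens H n (Ob C)) \<Longrightarrow>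
      ob_map n E (F0 GF) X = ob_map n E (F0 G) (ob_map n D (F0 F) X)"
    and "Y \<in> carrier (tens H n (Ar C)) \<Longrightarrow>
      ar_map n E (F1 GF) Y = ar_map n E (F1 G) (ar_map n D (F1 F) Y)"
proof -
  show "ob_map n E (F0 GF) X = ob_map n E (F0 G) (ob_map n D (F0 F) X)"
    if "X \<in> carrier (tens H n (Ob C))"
    using tens_map_compose[OF assms cm(1) dm(1) em(1) f(1) g(1) that]
      tens_map_cong[OF assms cm(1) em(1) left_hom_compose[OF f(1) g(1)] lie2_comp_simps(1) that]
          by simp
  show "ar_map n E (F1 GF) Y = ar_map n E (F1 G) (ar_map n D (F1 F) Y)"
    if "Y \<in> carrier (tens H n (Ar C))"
    using tens_map_compose[OF assms cm(2) dm(2) em(2) f(2) g(2) that]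
      tens_map_cong[OF assms cm(2) em(2) left_hom_compose[OF f(2) g(2)] lie2_comp_simps(2) that]
          by simp
qed

text \<open>Naturality is obtained by pasting the square of \<open>F2 G\<close> at the arrows
  \<open>F1 F u\<close>, \<open>F1 F v\<close> with the image under \<open>F1 G\<close> of the
  square of \<open>F2 F\<close>. Bilinearity holds because composition is additive on composable
  pairs and commutes with the action.\<close>

lemma lie2_comp_premorphism: "lie2_premorphism C E GF"
proof -
  interpret E2: group_category "tens_cat H 2 E" by (rule group_category_tens_cat[OF pos2 e(1)])
  interpret D2: group_category "tens_cat H 2 D" by (rule group_category_tens_cat[OF pos2 d(1)])
  let ?cmp = "after 2 E" and ?G = "ar_map 2 E (F1 G)"
  note pF = polylinear2D[where b = "\<lambda>x y. F2 F (x, y)", OF lie2_premorphismD(2)[OF F]]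
    and pG = polylinear2D[where b = "\<lambda>x y. F2 G (x, y)", OF lie2_premorphismD(2)[OF G]]
  note G2 = tens_map_hom[OF pos2 dm(2) em(2) g(2)]
  interpret OC: comm_group "Ob C" by (rule left_moduleD(1)[OF cm(1)])
  have func: "internal_functor C E (F0 GF) (F1 GF)"
    by (rule internal_functor_cong[OF c(1) internal_functor_compose[OF lie2_premorphismD(1)[OF F]
            lie2_premorphismD(1)[OF G]]]) (simp_all add: lie2_comp_simps)
  have arr: "arrow 2 E (F2 GF (x, y))
      (br0 E (F0 GF x) (F0 GF y)) (ob_map 2 E (F0 GF) (br0 C x y))"
    if x: "x \<in> carrier (Ob C)" and y: "y \<in> carrier (Ob C)" for x y
    using E2.arrow_cmp[OF comp_factors[OF x y]] x y polylinear2D(1)[OF c(2) x y]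
    by (simp add: lie2_comp_simps tens_map_comp(1)[OF pos2])
  have "polylinear H 2 (Ob C) (Ar E) (\<lambda>xs. (\<lambda>x y. F2 GF (x, y)) (xs ! 0) (xs ! 1))"
  proof (rule polylinear2I)
    fix x y assume x: "x \<in> carrier (Ob C)" and y: "y \<in> carrier (Ob C)"
    show "F2 GF (x, y) \<in> carrier (tens H 2 (Ar E))"
      using arr[OF x y] by (simp add: arrow_from_to_def tens_cat_simps)
    note fac = comp_factors[unfolded arrow_from_to_def tens_cat_simps]
    show "F2 GF (x \<boxplus>\<^bsub>Ob C\<^esub> x', y) = F2 GF (x, y) \<boxplus>\<^bsub>tens H 2 (Ar E)\<^esub> F2 GF (x', y)"
      if x': "x' \<in> carrier (Ob C)" for x'
      using E2.cmp_add[of "?G (F2 F (x, y))" "F2 G (F0 F x, F0 F y)" "?G (F2 F (x', y))"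
          "F2 G (F0 F x', F0 F y)"]
        fac[OF x y] fac[OF x' y] x y x'
      by (simp add: lie2_comp_simps tens_cat_simps pF pG f_closed left_homD(3)[OF f(1)]
        hom_mult[OF G2])
    show "F2 GF (x, y \<boxplus>\<^bsub>Ob C\<^esub> y') = F2 GF (x, y) \<boxplus>\<^bsub>tens H 2 (Ar E)\<^esub> F2 GF (x, y')"
      if y': "y' \<in> carrier (Ob C)" for y'
      using E2.cmp_add[of "?G (F2 F (x, y))" "F2 G (F0 F x, F0 F y)" "?G (F2 F (x, y'))"
          "F2 G (F0 F x, F0 F y')"]
        fac[OF x y] fac[OF x y'] x y y'
      by (simp add: lie2_comp_simps tens_cat_simps pF pG f_closed left_homD(3)[OF f(1)]
        hom_mult[OF G2])
    show "F2 GF (act (Ob C) h x, act (Ob C) k y) = act (tens H 2 (Ar E)) (ptens H [h, k])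
        (F2 GF (x, y))" for h k
    proof -
      have S: "ptens H [h, k] \<in> carrier (tpow H 2)" by (rule ptens_closed) simp
      show ?thesis
        using group_functor_cmp_arrow[OF E2.group_category_axioms E2.group_category_axioms
            group_functor_act[OF pos2 e(1) S] comp_factors[OF x y]] x y
        by (simp add: lie2_comp_simps left_moduleD(2)[OF cm(1)] left_homD(4)[OF f(1)] pF pG f_closed
            tens_map_act[OF pos2 dm(2) em(2) g(2) S])
    qed
  qed
  then have poly: "polylinear H 2 (Ob C) (Ar E) (\<lambda>xs. F2 GF (xs ! 0, xs ! 1))" by simp
  have nat: "?cmp (F2 GF (tgt C u, tgt C v)) (br1 E (F1 GF u) (F1 GF v))
      = ?cmp (ar_map 2 E (F1 GF) (br1 C u v)) (F2 GF (src C u, src C v))"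
    if u: "u \<in> carrier (Ar C)" and v: "v \<in> carrier (Ar C)" for u v
  proof -
    let ?su = "F0 F (src C u)" and ?sv = "F0 F (src C v)" and ?tu = "F0 F (tgt C u)"
        and ?tv = "F0 F (tgt C v)"
    let ?Fs = "F2 F (src C u, src C v)" and ?Ft = "F2 F (tgt C u, tgt C v)"
      and ?Gs = "F2 G (?su, ?sv)" and ?Gt = "F2 G (?tu, ?tv)"
      and ?bD = "br1 D (F1 F u) (F1 F v)" and ?bE = "br1 E (F1 G (F1 F u)) (F1 G (F1 F v))"
    note uv = f_closed(2)[OF u] f_closed(2)[OF v]
    note t = st_closed(2)[OF u] st_closed(2)[OF v] and s = st_closed(1)[OF u] st_closed(1)[OF v]
    note src_tgt = f(3)[OF u] f(3)[OF v] f(4)[OF u] f(4)[OF v]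
    note src_tgtG = g(3)[OF uv(1)] g(3)[OF uv(2)] g(4)[OF uv(1)] g(4)[OF uv(2)]
    have bE: "arrow 2 E ?bE
      (br0 E (F0 G ?su) (F0 G ?sv)) (br0 E (F0 G ?tu) (F0 G ?tv))"
      using e(4)[OF g_closed(2)[OF uv(1)] g_closed(2)[OF uv(2)]] by (simp add: src_tgt src_tgtG)
    have bD: "arrow 2 D ?bD
      (br0 D ?su ?sv) (br0 D ?tu ?tv)"
      using d(4)[OF uv] by (simp add: src_tgt)
    note bC = group_functor_arrow[OF group_functor_tens_map[OF pos2 c(1) d(1)
        lie2_premorphismD(1)[OF F]] c(4)[OF u v]]
    note GbD = group_functor_arrow[OF tens_functor_G[OF pos2] bD]
        and GbC = group_functor_arrow[OF tens_functor_G[OF pos2] bC]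
    note Gcmp = group_functor_cmp_arrow[OF D2.group_category_axioms E2.group_category_axioms
        tens_functor_G[OF pos2]]
    have "?cmp (F2 GF (tgt C u, tgt C v)) (br1 E (F1 GF u) (F1 GF v))
        = ?cmp (?G ?Ft) (?cmp ?Gt ?bE)"
      using E2.cmp_assoc_arrow[OF comp_factors[OF t] bE] u v t by (simp add: lie2_comp_simps)
    also have "?cmp ?Gt ?bE
        = ?cmp (?G ?bD) ?Gs"
      using lie2_premorphismD(4)[OF G uv] by (simp add: src_tgt)
    also have "?cmp (?G ?Ft) (?cmp (?G ?bD) ?Gs)
        = ?cmp (?G (after 2 D ?Ft ?bD)) ?Gs"
      using E2.cmp_assoc_arrow[OF comp_factors(1)[OF t] GbD comp_factors(2)[OF s]]
        Gcmp[OF lie2_premorphismD(3)[OF F t] bD] by simp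
    also have "\<dots> = ?cmp (?G (ar_map 2 D (F1 F) (br1 C u v))) (?cmp (?G ?Fs) ?Gs)"
      using E2.cmp_assoc_arrow[OF GbC comp_factors[OF s]] Gcmp[OF bC lie2_premorphismD(3)[OF F s]]
        lie2_premorphismD(4)[OF F u v] by simp
    also have "\<dots> = ?cmp (ar_map 2 E (F1 GF) (br1 C u v)) (F2 GF (src C u, src C v))"
      using s polylinear2D(1)[OF c(3) u v] by (simp add: lie2_comp_simps tens_map_comp(2)[OF pos2])
    finally show ?thesis .
  qed
  show ?thesis
    unfolding lie2_premorphism_def using func poly arr nat by blast
qed

text \<open>The pasting of \<open>plug_comp_morphisms\<close> in the second slot, with
  \<open>x\<close> frozen; there \<Phi> and \<Gamma> are the values of \<open>F2 F\<close> and
  \<open>F2 G\<close> from which \<open>F2\<close> of the composite at \<open>y\<close>,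
  \<open>z\<close> is formed.\<close>

lemma F2_right_comp:
  assumes x: "x \<in> carrier (Ob C)" and y: "y \<in> carrier (Ob C)" and z: "z \<in> carrier (Ob C)"
  shows "F2_right C E GF x y z = after 3 E
    (ar_map 3 E (F1 G) (F2_right C D F x y z)) (F2_right D E G (F0 F x) (F0 F y) (F0 F z))"
proof -
  note a = f_closed(1)[OF x]
  \<comment> \<open>Naturality of \<open>F2 G\<close> holds in both arguments together; putting the
    identity arrow of \<open>F0 F x\<close> into the first restricts it to one slot.\<close>
  have nat: "after 2 E (F2 G (F0 F x, tgt D u)) (br1 E (idn E (F0 G (F0 F x))) (F1 G u))
      = after 2 E (ar_map 2 E (F1 G) (br1 D (idn D (F0 F x)) u)) (F2 G (F0 F x, src D u))"
    if "u \<in> carrier (Ar D)" for u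
    using lie2_premorphismD(4)[OF G left_homD(2)[OF dm(5) a] that] by (simp add: dm(7,8) a g(5))
  show ?thesis
    unfolding F2_right_def lie2_comp_simps(1)[OF x] lie2_comp_simps(3)[OF y z]
    by (rule plug_comp_morphisms[OF slots(2) c(1) d(1) e(1) f(1) lie2_premorphismD(1)[OF G]
          F2_slots(2)[OF F c(1) x] F2_slots(2)[OF G d(1) a] bracket_slots(2)[OF C x]
              bracket_slots(2,4)[OF D a]
          bracket_slots(2,4)[OF E g_closed(1)[OF a]] bracket_slots(6)[OF D a]
          bracket_slots(6)[OF E g_closed(1)[OF a]] e(5)[OF g_closed(1)[OF a]]
              lie2_premorphismD(3)[OF F x]
          lie2_premorphismD(3)[OF G a] nat polylinear2D(1)[OF c(2) y z] lie2_premorphismD(3)[OF F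
              y z]
          comp_factors(2)[OF y z] lie2_comp_simps(3)[OF x]])
qed

text \<open>Mirror image of \<open>F2_right_comp\<close>: the first slot, with \<open>z\<close>
  frozen.\<close>

lemma F2_left_comp:
  assumes x: "x \<in> carrier (Ob C)" and y: "y \<in> carrier (Ob C)" and z: "z \<in> carrier (Ob C)"
  shows "F2_left C E GF x y z = after 3 E
    (ar_map 3 E (F1 G) (F2_left C D F x y z)) (F2_left D E G (F0 F x) (F0 F y) (F0 F z))"
proof -
  note a = f_closed(1)[OF z]
  have nat: "after 2 E (F2 G (tgt D u, F0 F z)) (br1 E (F1 G u) (idn E (F0 G (F0 F z))))
      = after 2 E (ar_map 2 E (F1 G) (br1 D u (idn D (F0 F z)))) (F2 G (src D u, F0 F z))"
    if "u \<in> carrier (Ar D)" for u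
    using lie2_premorphismD(4)[OF G that left_homD(2)[OF dm(5) a]] by (simp add: dm(7,8) a g(5))
  show ?thesis
    unfolding F2_left_def lie2_comp_simps(1)[OF z] lie2_comp_simps(3)[OF x y]
    by (rule plug_comp_morphisms[OF slots(1) c(1) d(1) e(1) f(1) lie2_premorphismD(1)[OF G]
          F2_slots(1)[OF F c(1) z] F2_slots(1)[OF G d(1) a] bracket_slots(1)[OF C z]
              bracket_slots(1,3)[OF D a]
          bracket_slots(1,3)[OF E g_closed(1)[OF a]] bracket_slots(5)[OF D a]
          bracket_slots(5)[OF E g_closed(1)[OF a]] e(5)[OF _ g_closed(1)[OF a]]
              lie2_premorphismD(3)[OF F _ z]
          lie2_premorphismD(3)[OF G _ a] nat polylinear2D(1)[OF c(2) x y]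
              lie2_premorphismD(3)[OF F x y]
          comp_factors(2)[OF x y] lie2_comp_simps(3)[OF _ z]])
qed

text \<open>The whole alternating difference is pasted at once. Between the two compatibilities
  stands the image under \<open>F1 G\<close> of the Jacobiator of \<open>D\<close>, which the one
  for \<open>G\<close> brings in and the one for \<open>F\<close> removes.\<close>

lemma lie2_comp_coherent:
  assumes cohF: "lie2_coherent C D F" and cohG: "lie2_coherent D E G"
  shows "lie2_coherent C E GF"
  unfolding lie2_coherent_def
proof (intro ballI)
  fix x y z assume x: "x \<in> carrier (Ob C)" and y: "y \<in> carrier (Ob C)" and z: "z \<in> carrier (Ob C)"
  interpret D3: group_category "tens_cat H 3 D" by (rule group_category_tens_cat[OF pos3 d(1)])
  interpret E3: group_category "tens_cat H 3 E" by (rule group_category_tens_cat[OF pos3 e(1)])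
  interpret G3: group_hom "tens H 3 (Ar D)" "tens H 3 (Ar E)" "ar_map 3 E (F1 G)"
    by (intro group_homI group_tens pos3 dm(2) em(2) tens_map_hom g(2))
  let ?a = "F0 F x" and ?b = "F0 F y" and ?c = "F0 F z"
  let ?RF = "F2_right C D F x y z" and ?RF' = "F2_right C D F y x z" and ?LF = "F2_left C D F x y z"
  let ?RG = "F2_right D E G ?a ?b ?c" and ?RG' = "F2_right D E G ?b ?a ?c"
      and ?LG = "F2_left D E G ?a ?b ?c"
  let ?J = "ar_map 3 D (F1 F) (jac C x y z)" and ?J' = "jac D ?a ?b ?c"
    and ?J'' = "jac E (F0 G ?a) (F0 G ?b) (F0 G ?c)"
  let ?after = "after 3 E" and ?G = "ar_map 3 E (F1 G)"
  let ?WF = "?RF \<boxminus>\<^bsub>tens H 3 (Ar D)\<^esub> ar_perm D ?RF'"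
      and ?WG = "?RG \<boxminus>\<^bsub>tens H 3 (Ar E)\<^esub> ar_perm E ?RG'"
  note a = f_closed(1)[OF x] f_closed(1)[OF y] f_closed(1)[OF z]
  note G3 = tens_functor_G[OF pos3]
  note Gcmp = group_functor_cmp_arrow[OF D3.group_category_axioms E3.group_category_axioms G3]
    and Ga = group_functor_arrow[OF G3]
  note pE = group_functor_perm_tens[OF e(1)]
  note RF = F2_right_arrow[OF C D F x y z] and RF' = F2_right_arrow[OF C D F y x z]
  note RG = F2_right_arrow[OF D E G a] and RG' = F2_right_arrow[OF D E G a(2,1,3)]
  note LF = F2_left_arrow[OF C D F x y z] and LG = F2_left_arrow[OF D E G a]
  note WF = F2_right_alternating_arrow[OF C D F x y z]
      and WG = F2_right_alternating_arrow[OF D E G a]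
  note J = group_functor_arrow[OF group_functor_tens_map[OF pos3 c(1) d(1)
      lie2_premorphismD(1)[OF F]] c(6)[OF x y z]]
    and J' = d(6)[OF a] and J'' = e(6)[OF g_closed(1)[OF a(1)] g_closed(1)[OF a(2)]
        g_closed(1)[OF a(3)]]
  have closed: "?RF \<in> carrier (tens H 3 (Ar D))" "?RF' \<in> carrier (tens H 3 (Ar D))"
    using RF RF' by (simp_all add: arrow_from_to_def tens_cat_simps)
  have "?G ?WF = ?G ?RF \<boxminus>\<^bsub>tens H 3 (Ar E)\<^esub> ar_perm E (?G ?RF')"
    using closed hom_in_carrier[OF perm_tens_hom[OF dm(2)] closed(2)]
      tens_map_perm_tens[OF dm(2) em(2) g(2) closed(2)] by (simp del: One_nat_def)
  \<comment> \<open>The difference for the composite factors as a composite of differences: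
    \<open>ar_perm\<close> respects composition and commutes with the tensored \<open>F1 G\<close>,
    and interchange does the rest.\<close>
  then have W: "F2_right C E GF x y z \<boxminus>\<^bsub>tens H 3 (Ar E)\<^esub> ar_perm E (F2_right C E GF y x z)
      = ?after (?G ?WF) ?WG"
    using E3.cmp_minus_arrow[OF Ga[OF RF] RG group_functor_arrow[OF pE Ga[OF RF']]
        group_functor_arrow[OF pE RG']]
      group_functor_cmp_arrow[OF E3.group_category_axioms E3.group_category_axioms pE Ga[OF RF']
          RG']
    by (simp only: F2_right_comp[OF x y z] F2_right_comp[OF y x z] tens_cat_simps(2))
  have FJ: "after 3 D ?WF ?J' = after 3 D ?J ?LF"
    using cohF x y z unfolding lie2_coherent_def by blast
  have GJ: "?after ?WG ?J'' = ?after (?G ?J') ?LG"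
    using cohG a unfolding lie2_coherent_def by blast
  have "?after (?after (?G ?WF) ?WG) ?J'' = ?after (?G ?WF) (?after (?G ?J') ?LG)"
    unfolding GJ[symmetric] by (rule E3.cmp_assoc_arrow[OF Ga[OF WF] WG J''])
  also have "\<dots> = ?after (?G (after 3 D ?WF ?J')) ?LG"
    unfolding Gcmp[OF WF J'] by (rule E3.cmp_assoc_arrow[OF Ga[OF WF] Ga[OF J'] LG, symmetric])
  also have "\<dots> = ?after (?G ?J) (?after (?G ?LF) ?LG)"
    unfolding FJ Gcmp[OF J LF] by (rule E3.cmp_assoc_arrow[OF Ga[OF J] Ga[OF LF] LG])
  finally show "?after (F2_right C E GF x y z \<boxminus>\<^bsub>tens H 3 (Ar E)\<^esub> ar_perm E (F2_right C E GF y x z))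
      (jac E (F0 GF x) (F0 GF y) (F0 GF z))
    = ?after (ar_map 3 E (F1 GF) (jac C x y z)) (F2_left C E GF x y z)"
    using c(6)[OF x y z] unfolding W
    by (simp add: lie2_comp_simps x y z F2_left_comp tens_map_comp(2)[OF pos3] arrow_from_to_def
        tens_cat_simps(2) del: One_nat_def)
qed

end

section \<open>The category axioms\<close>

lemma lie2_comp_morphism:
  assumes C: "lie2_pseudoalgebra H C" and D: "lie2_pseudoalgebra H D"
      and E: "lie2_pseudoalgebra H E"
    and F: "lie2_morphism H C D F" and G: "lie2_morphism H D E G"
  shows "lie2_morphism H C E (lie2_comp H C D E G F)"
  using F G lie2_comp_premorphism[OF C D E] lie2_comp_coherent[OF C D E] lie2_comp_extensional
  unfolding lie2_morphism_iff[OF C D] lie2_morphism_iff[OF D E] lie2_morphism_iff[OF C E] by blast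

lemma lie2_mor_eqI:
  fixes F F' :: "('h, 'o, 'a, 'p, 'b) lie2_mor"
  assumes "F0 F \<in> extensional A" "F0 F' \<in> extensional A" "F1 F \<in> extensional B"
      "F1 F' \<in> extensional B"
    and "F2 F \<in> extensional (A \<times> A)" "F2 F' \<in> extensional (A \<times> A)"
    and "\<And>x. x \<in> A \<Longrightarrow> F0 F x = F0 F' x" "\<And>f. f \<in> B \<Longrightarrow> F1 F f = F1 F' f"
    and "\<And>x y. x \<in> A \<Longrightarrow> y \<in> A \<Longrightarrow> F2 F (x, y) = F2 F' (x, y)"
  shows "F = F'"
proof (rule lie2_mor.equality)
  show "F0 F = F0 F'" by (rule extensionalityI[OF assms(1,2,7)])
  show "F1 F = F1 F'" by (rule extensionalityI[OF assms(3,4,8)])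
  show "F2 F = F2 F'" by (rule extensionalityI[OF assms(5,6)]) (use assms(9) in auto)
qed simp

text \<open>On \<open>F2\<close> one of the two composed arrows is an identity: before
  \<open>F\<close> it is the image of a unit under \<open>F1 F\<close>, after \<open>F\<close> it is
  \<open>F2\<close> of the identity morphism itself.\<close>

lemma lie2_comp_id:
  assumes C: "lie2_pseudoalgebra H C" and D: "lie2_pseudoalgebra H D" and F: "lie2_morphism H C D F"
  shows "lie2_comp H C C D F (lie2_id H C) = F" and "lie2_comp H C D D (lie2_id H D) F = F"
proof -
  note F' = F[unfolded lie2_morphism_iff[OF C D]]
  have pre: "lie2_premorphism C D F" using F' by blast
  note c = lie2_pseudoalgebraD[OF C] and d = lie2_pseudoalgebraD[OF D]
  note cm = left_2moduleD[OF c(1)] and dm = left_2moduleD[OF d(1)]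
  note f = internal_functorD[OF lie2_premorphismD(1)[OF pre]]
  interpret D2: group_category "tens_cat H 2 D" by (rule group_category_tens_cat[OF pos2 d(1)])
  show "lie2_comp H C C D F (lie2_id H C) = F"
  proof (rule lie2_mor_eqI[where B = "carrier (Ar C)"])
    fix x y assume x: "x \<in> carrier (Ob C)" and y: "y \<in> carrier (Ob C)"
    note b = polylinear2D(1)[OF c(2) x y]
    have "ar_map 2 D (F1 F) (one_at 2 C (br0 C x y))
        = one_at 2 D (ob_map 2 D (F0 F) (br0 C x y))"
      using group_functor_tens_map[OF pos2 c(1) d(1) lie2_premorphismD(1)[OF pre]] b
      by (simp add: group_functor_def tens_cat_simps)
    then show "F2 (lie2_comp H C C D F (lie2_id H C)) (x, y) = F2 F (x, y)"
      using D2.cmp_idn_arrow(2)[OF lie2_premorphismD(3)[OF pre x y]] x y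
      by (simp add: lie2_comp_simps lie2_id_simps)
  qed (use F' in \<open>simp_all add: lie2_comp_extensional lie2_comp_simps lie2_id_simps\<close>)
  show "lie2_comp H C D D (lie2_id H D) F = F"
  proof (rule lie2_mor_eqI[where B = "carrier (Ar C)"])
    fix x y assume x: "x \<in> carrier (Ob C)" and y: "y \<in> carrier (Ob C)"
    note arr = lie2_premorphismD(3)[OF pre x y]
    have "ar_map 2 D (F1 (lie2_id H D)) (F2 F (x, y)) = F2 F (x, y)"
      using arr by (intro tens_map_ident[OF pos2 dm(2)]) (simp_all add: lie2_id_simps
          arrow_from_to_def tens_cat_simps)
    then show "F2 (lie2_comp H C D D (lie2_id H D) F) (x, y) = F2 F (x, y)"
      using D2.cmp_idn_arrow(1)[OF arr] x y left_homD(2)[OF f(1)]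
      by (simp add: lie2_comp_simps lie2_id_simps)
  qed (use F' in \<open>simp_all add: lie2_comp_extensional lie2_comp_simps lie2_id_simps
      left_homD(2)[OF f(1)] left_homD(2)[OF f(2)]\<close>)
qed

text \<open>On \<open>F2\<close> both sides compose three arrows, coming from \<open>F2 F\<close>,
  \<open>F2 G\<close> and \<open>F2 K\<close>. They differ in bracketing and in whether
  \<open>F1 K\<close> is applied before or after the arrows from \<open>F2 F\<close> and
  \<open>F2 G\<close> are composed.\<close>

lemma lie2_comp_assoc:
  assumes B: "lie2_pseudoalgebra H B" and C: "lie2_pseudoalgebra H C"
      and D: "lie2_pseudoalgebra H D"
    and E: "lie2_pseudoalgebra H E"
    and F: "lie2_premorphism B C F" and G: "lie2_premorphism C D G" and K: "lie2_premorphism D E K"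
  shows "lie2_comp H B C E (lie2_comp H C D E K G) F = lie2_comp H B D E K (lie2_comp H B C D G F)"
proof (rule lie2_mor_eqI[where B = "carrier (Ar B)"])
  note d = lie2_pseudoalgebraD[OF D] and e = lie2_pseudoalgebraD[OF E]
  note f = internal_functorD[OF lie2_premorphismD(1)[OF F]]
  interpret D2: group_category "tens_cat H 2 D" by (rule group_category_tens_cat[OF pos2 d(1)])
  interpret E2: group_category "tens_cat H 2 E" by (rule group_category_tens_cat[OF pos2 e(1)])
  fix x y assume x: "x \<in> carrier (Ob B)" and y: "y \<in> carrier (Ob B)"
  note a = left_homD(2)[OF f(1) x] left_homD(2)[OF f(1) y]
  note K2 = group_functor_tens_map[OF pos2 d(1) e(1) lie2_premorphismD(1)[OF K]]
  note GF = comp_factors[OF B C D F G x y] and KG = comp_factors[OF C D E G K a]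
  have carr: "F2 F (x, y) \<in> carrier (tens H 2 (Ar C))"
    using lie2_premorphismD(3)[OF F x y] by (simp add: arrow_from_to_def tens_cat_simps)
  show "F2 (lie2_comp H B C E (lie2_comp H C D E K G) F) (x, y)
      = F2 (lie2_comp H B D E K (lie2_comp H B C D G F)) (x, y)"
    using E2.cmp_assoc_arrow[OF group_functor_arrow[OF K2 GF(1)] KG]
      group_functor_cmp_arrow[OF D2.group_category_axioms E2.group_category_axioms K2 GF]
    by (simp add: lie2_comp_simps x y a tens_map_comp(2)[OF C D E G K pos2 carr])
next
  note f = internal_functorD[OF lie2_premorphismD(1)[OF F]]
  show "F0 (lie2_comp H B C E (lie2_comp H C D E K G) F) x
      = F0 (lie2_comp H B D E K (lie2_comp H B C D G F)) x"
    if "x \<in> carrier (Ob B)" for x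
    using that by (simp add: lie2_comp_simps left_homD(2)[OF f(1)])
  show "F1 (lie2_comp H B C E (lie2_comp H C D E K G) F) u
      = F1 (lie2_comp H B D E K (lie2_comp H B C D G F)) u"
    if "u \<in> carrier (Ar B)" for u
    using that by (simp add: lie2_comp_simps left_homD(2)[OF f(2)])
qed (simp_all add: lie2_comp_extensional)

lemma category_lie2:
  "category {C :: ('h, 'o, 'a) lie2. lie2_pseudoalgebra H C}
    (\<lambda>C D. {F. lie2_morphism H C D F}) (lie2_id H) (lie2_comp H)"
proof (unfold_locales, unfold mem_Collect_eq)
  fix A B C D :: "('h, 'o, 'a) lie2" and f g h
  assume A: "lie2_pseudoalgebra H A"
  show "lie2_morphism H A A (lie2_id H A)" by (rule lie2_id_morphism[OF A])
  assume B: "lie2_pseudoalgebra H B"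
  show "lie2_comp H A A B f (lie2_id H A) = f" "lie2_comp H A B B (lie2_id H B) f = f"
      if "lie2_morphism H A B f"
    by (rule lie2_comp_id[OF A B that])+
  assume C: "lie2_pseudoalgebra H C"
  show "lie2_morphism H A C (lie2_comp H A B C g f)"
      if "lie2_morphism H A B f" "lie2_morphism H B C g"
    by (rule lie2_comp_morphism[OF A B C that])
  assume D: "lie2_pseudoalgebra H D"
  show "lie2_comp H A B D (lie2_comp H B C D h g) f = lie2_comp H A C D h (lie2_comp H A B C g f)"
    if "lie2_morphism H A B f" "lie2_morphism H B C g" "lie2_morphism H C D h"
    using that lie2_comp_assoc[OF A B C D]
    unfolding lie2_morphism_iff[OF A B] lie2_morphism_iff[OF B C] lie2_morphism_iff[OF C D] by blast
qed

end

theorem theorem6p3: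
  fixes H :: "('k::field, 'h::ring_1) hopf"
  assumes "cocommutative_hopf_algebra H"
  shows "category {C :: ('h, 'o, 'a) lie2. lie2_pseudoalgebra H C}
    (\<lambda>C D. {F. lie2_morphism H C D F}) (lie2_id H) (lie2_comp H)"
  by (rule coco_hopf.category_lie2[OF coco_hopf.intro[OF assms]])

end
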